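(* Let $\phi=\sum_{i=1}^n F_i\,dz^i$ be a regular holomorphic $1$-form on an open subset $U\subset\mathbb{C}^n$. Then the corresponding (totally complex) holomorphic immersion $\phi:U\to V=T^*\mathbb{C}^n$ defines on $U$ the structure of a special symplectic manifold $(U,J,\nabla,\omega)$ of complex dimension $n$, where $J$ is the complex structure of $U$ and $\nabla,\omega$ are the connection and symplectic form induced by $\phi$. Conversely, any special symplectic manifold of complex dimension $n$ can be locally obtained in this way, i.e. every point has an open neighbourhood which is isomorphic, as a special symplectic manifold, to one defined by a regular holomorphic $1$-form on an open subset of $\mathbb{C}^n$.
   Context: A special complex manifold $(M,J,\nabla)$ is a complex manifold $(M,J)$ together with a flat torsionfree connection $\nabla$ on its real tangent bundle such that $d^\nabla J=0$, i.e. $(\nabla_XJ)Y=(\nabla_YJ)X$ for all $X,Y$. A special symplectic manifold $(M,J,\nabla,\omega)$ is a special complex manifold together with a $\nabla$-parallel symplectic form $\omega$. An isomorphism is a biholomorphic map identifying the connections and the symplectic forms. A holomorphic $1$-form $\sum F_i\,dz^i$ on an open set $U\subset\mathbb{C}^n$ is called regular if the real matrix $\left(\mathrm{Im}\,\partial F_i/\partial z^j\right)$ is invertible (at every point of $U$). A holomorphic $1$-form is considered as a holomorphic immersion $U\to V=T^*\mathbb{C}^n$ (a section over $U$): in the canonical coordinates $(z^1,\dots,z^n,w_1,\dots,w_n)$ of $V$ it is $z\mapsto(z^1,\dots,z^n,F_1(z),\dots,F_n(z))$. An immersion $\phi$ into $V$ is totally complex if $T^*\mathbb{R}^n\cap d\phi(T_pU)=0$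 for all $p$, where $T^*\mathbb{R}^n=\mathbb{R}^{2n}\subset\mathbb{C}^{2n}=V$. Put $x^i=\mathrm{Re}\,z^i$, $y_i=\mathrm{Re}\,w_i$. For a totally complex holomorphic immersion $\phi$, the functions $x^i\circ\phi,\ y_j\circ\phi$ are local coordinates around each point; the induced connection $\nabla$ is the flat torsionfree connection for which these functions are affine, and the induced symplectic form is $\omega=2\phi^*(\sum dx^i\wedge dy_i)$. *)

theory Defs
  imports "HOL-Analysis.Analysis"
begin

section \<open>Smooth and holomorphic maps\<close>

text \<open>Iterated directional derivatives; on an open subset of a finite-dimensional space this is
  the usual notion of a \<open>C\<^sup>k\<close> map.\<close>

primrec Ck_on :: "nat \<Rightarrow> 'a::euclidean_space set \<Rightarrow> ('a \<Rightarrow> 'b::real_normed_vector) \<Rightarrow> bool" where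
  "Ck_on 0 S f \<longleftrightarrow> continuous_on S f"
| "Ck_on (Suc k) S f \<longleftrightarrow> (\<forall>x\<in>S. f differentiable (at x)) \<and>
     (\<forall>v. Ck_on k S (\<lambda>x. frechet_derivative f (at x) v))"

definition smooth_on :: "'a::euclidean_space set \<Rightarrow> ('a \<Rightarrow> 'b::real_normed_vector) \<Rightarrow> bool" where
  "smooth_on S f \<longleftrightarrow> (\<forall>k. Ck_on k S f)"

text \<open>Holomorphic maps of several variables (on an open set): real differentiable with complex
  linear differential. The library predicate \<open>holomorphic_on\<close> is for functions of one variable.\<close>

definition holo_on :: "(complex^'n) set \<Rightarrow> (complex^'n \<Rightarrow> complex^'m) \<Rightarrow> bool" where
  "holo_on S f \<longleftrightarrow> (\<forall>x\<in>S. f differentiable (at x) \<and>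
     (\<forall>c v. frechet_derivative f (at x) (c *s v) = c *s frechet_derivative f (at x) v))"


section \<open>Tensor calculus on open subsets of \<open>\<complex>\<^sup>n\<close>\<close>

text \<open>The real tangent space of \<open>\<complex>\<^sup>n\<close> at any point is identified with the real vector space
  \<open>complex^'n\<close>, on which the complex structure \<open>J\<close> is multiplication by \<open>\<i>\<close>.\<close>

type_synonym 'n vfield = "complex^'n \<Rightarrow> complex^'n"

text \<open>A connection is given by its Christoffel map \<open>\<Gamma>\<close>, i.e. \<open>\<nabla>\<^sub>X Y = dY(X) + \<Gamma>(X, Y)\<close>.\<close>

type_synonym 'n christoffel = "complex^'n \<Rightarrow> complex^'n \<Rightarrow> complex^'n \<Rightarrow> complex^'n"

type_synonym 'n twoform = "complex^'n \<Rightarrow> complex^'n \<Rightarrow> complex^'n \<Rightarrow> real"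

definition Jc :: "complex^'n \<Rightarrow> complex^'n" where
  "Jc v = \<i> *s v"

text \<open>Derivative \<open>X f\<close> of a function (or of a vector-valued map) along a vector field.\<close>

definition along :: "'n::finite vfield \<Rightarrow> (complex^'n \<Rightarrow> 'b::real_normed_vector) \<Rightarrow> complex^'n \<Rightarrow> 'b" where
  "along X f p = frechet_derivative f (at p) (X p)"

definition bracket :: "'n::finite vfield \<Rightarrow> 'n vfield \<Rightarrow> 'n vfield" where
  "bracket X Y p = along X Y p - along Y X p"

definition covd :: "'n::finite christoffel \<Rightarrow> 'n vfield \<Rightarrow> 'n vfield \<Rightarrow> 'n vfield" where
  "covd \<Gamma> X Y p = along X Y p + \<Gamma> p (X p) (Y p)"

definition local_connection :: "(complex^'n) set \<Rightarrow> 'n::finite christoffel \<Rightarrow> bool" where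
  "local_connection S \<Gamma> \<longleftrightarrow> (\<forall>p\<in>S. bilinear (\<Gamma> p)) \<and> (\<forall>u v. smooth_on S (\<lambda>p. \<Gamma> p u v))"

definition local_torsionfree :: "(complex^'n) set \<Rightarrow> 'n::finite christoffel \<Rightarrow> bool" where
  "local_torsionfree S \<Gamma> \<longleftrightarrow> (\<forall>X Y. smooth_on S X \<longrightarrow> smooth_on S Y \<longrightarrow>
     (\<forall>p\<in>S. covd \<Gamma> X Y p - covd \<Gamma> Y X p - bracket X Y p = 0))"

definition local_flat :: "(complex^'n) set \<Rightarrow> 'n::finite christoffel \<Rightarrow> bool" where
  "local_flat S \<Gamma> \<longleftrightarrow> (\<forall>X Y Z. smooth_on S X \<longrightarrow> smooth_on S Y \<longrightarrow> smooth_on S Z \<longrightarrow>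
     (\<forall>p\<in>S. covd \<Gamma> X (covd \<Gamma> Y Z) p - covd \<Gamma> Y (covd \<Gamma> X Z) p - covd \<Gamma> (bracket X Y) Z p = 0))"

text \<open>\<open>(\<nabla>\<^sub>X J) Y = \<nabla>\<^sub>X (J Y) - J (\<nabla>\<^sub>X Y)\<close>\<close>

definition nablaJ :: "'n::finite christoffel \<Rightarrow> 'n vfield \<Rightarrow> 'n vfield \<Rightarrow> 'n vfield" where
  "nablaJ \<Gamma> X Y p = covd \<Gamma> X (\<lambda>q. Jc (Y q)) p - Jc (covd \<Gamma> X Y p)"

definition local_special :: "(complex^'n) set \<Rightarrow> 'n::finite christoffel \<Rightarrow> bool" where
  "local_special S \<Gamma> \<longleftrightarrow> (\<forall>X Y. smooth_on S X \<longrightarrow> smooth_on S Y \<longrightarrow>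
     (\<forall>p\<in>S. nablaJ \<Gamma> X Y p = nablaJ \<Gamma> Y X p))"

definition local_2form :: "(complex^'n) set \<Rightarrow> 'n::finite twoform \<Rightarrow> bool" where
  "local_2form S \<omega> \<longleftrightarrow> (\<forall>p\<in>S. bilinear (\<omega> p) \<and> (\<forall>u. \<omega> p u u = 0)) \<and>
     (\<forall>u v. smooth_on S (\<lambda>p. \<omega> p u v))"

definition ext_deriv2 :: "'n::finite twoform \<Rightarrow> 'n vfield \<Rightarrow> 'n vfield \<Rightarrow> 'n vfield \<Rightarrow> complex^'n \<Rightarrow> real" where
  "ext_deriv2 \<omega> X Y Z p =
     along X (\<lambda>q. \<omega> q (Y q) (Z q)) p - along Y (\<lambda>q. \<omega> q (X q) (Z q)) p
     + along Z (\<lambda>q. \<omega> q (X q) (Y q)) p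
     - \<omega> p (bracket X Y p) (Z p) + \<omega> p (bracket X Z p) (Y p) - \<omega> p (bracket Y Z p) (X p)"

definition local_symplectic :: "(complex^'n) set \<Rightarrow> 'n::finite twoform \<Rightarrow> bool" where
  "local_symplectic S \<omega> \<longleftrightarrow> local_2form S \<omega> \<and>
     (\<forall>p\<in>S. \<forall>u. (\<forall>v. \<omega> p u v = 0) \<longrightarrow> u = 0) \<and>
     (\<forall>X Y Z. smooth_on S X \<longrightarrow> smooth_on S Y \<longrightarrow> smooth_on S Z \<longrightarrow>
        (\<forall>p\<in>S. ext_deriv2 \<omega> X Y Z p = 0))"

definition local_parallel :: "(complex^'n) set \<Rightarrow> 'n::finite christoffel \<Rightarrow> 'n twoform \<Rightarrow> bool" where
  "local_parallel S \<Gamma> \<omega> \<longleftrightarrow> (\<forall>X Y Z. smooth_on S X \<longrightarrow> smooth_on S Y \<longrightarrow> smooth_on S Z \<longrightarrow>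
     (\<forall>p\<in>S. along X (\<lambda>q. \<omega> q (Y q) (Z q)) p
             = \<omega> p (covd \<Gamma> X Y p) (Z p) + \<omega> p (Y p) (covd \<Gamma> X Z p)))"

text \<open>A function \<open>f\<close> is affine if \<open>\<nabla> df = 0\<close>, i.e. \<open>X (Y f) = df (\<nabla>\<^sub>X Y)\<close>.\<close>

definition affine_function :: "(complex^'n) set \<Rightarrow> 'n::finite christoffel \<Rightarrow> (complex^'n \<Rightarrow> real) \<Rightarrow> bool" where
  "affine_function S \<Gamma> f \<longleftrightarrow> smooth_on S f \<and>
     (\<forall>X Y. smooth_on S X \<longrightarrow> smooth_on S Y \<longrightarrow>
       (\<forall>p\<in>S. along X (along Y f) p - along (covd \<Gamma> X Y) f p = 0))"

text \<open>For a diffeomorphism \<open>g\<close> of the open set \<open>S\<close> onto the open set \<open>g ` S\<close>: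
  \<open>g\<close> identifies the connections (resp. the two-forms).\<close>

definition vf_related :: "(complex^'n) set \<Rightarrow> (complex^'n \<Rightarrow> complex^'n) \<Rightarrow> 'n::finite vfield \<Rightarrow> 'n vfield \<Rightarrow> bool" where
  "vf_related S g X X' \<longleftrightarrow> (\<forall>p\<in>S. X' (g p) = frechet_derivative g (at p) (X p))"

definition conn_related :: "(complex^'n) set \<Rightarrow> (complex^'n \<Rightarrow> complex^'n) \<Rightarrow> 'n::finite christoffel \<Rightarrow> 'n christoffel \<Rightarrow> bool" where
  "conn_related S g \<Gamma> \<Gamma>' \<longleftrightarrow>
     (\<forall>X Y X' Y'. smooth_on S X \<longrightarrow> smooth_on S Y \<longrightarrow> smooth_on (g ` S) X' \<longrightarrow> smooth_on (g ` S) Y' \<longrightarrow>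
        vf_related S g X X' \<longrightarrow> vf_related S g Y Y' \<longrightarrow>
        vf_related S g (covd \<Gamma> X Y) (covd \<Gamma>' X' Y'))"

definition form_related :: "(complex^'n) set \<Rightarrow> (complex^'n \<Rightarrow> complex^'n) \<Rightarrow> 'n::finite twoform \<Rightarrow> 'n twoform \<Rightarrow> bool" where
  "form_related S g \<omega> \<omega>' \<longleftrightarrow> (\<forall>p\<in>S. \<forall>u v.
     \<omega>' (g p) (frechet_derivative g (at p) u) (frechet_derivative g (at p) v) = \<omega> p u v)"


section \<open>Special symplectic manifolds\<close>

text \<open>An atlas is a family of charts \<open>coord M i\<close> on domains \<open>cdom M i\<close>, for \<open>i \<in> charts M\<close>.\<close>

record ('a, 'i, 'n::finite) atlas_data =
  mtop :: "'a topology"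
  charts :: "'i set"
  cdom :: "'i \<Rightarrow> 'a set"
  coord :: "'i \<Rightarrow> 'a \<Rightarrow> complex^'n"

text \<open>A connection and a two-form on \<open>M\<close> are given by their expressions in the charts of the atlas,
  subject to the transformation laws imposed below.\<close>

record ('a, 'i, 'n::finite) special_data = "('a, 'i, 'n) atlas_data" +
  conn :: "'i \<Rightarrow> 'n christoffel"
  form :: "'i \<Rightarrow> 'n twoform"

abbreviation cimage :: "('a, 'i, 'n::finite, 'z) atlas_data_scheme \<Rightarrow> 'i \<Rightarrow> (complex^'n) set" where
  "cimage M i \<equiv> coord M i ` cdom M i"

text \<open>The expression of a map \<open>f : M \<rightarrow> N\<close> in charts, and its domain. For \<open>f = id\<close> and \<open>N = M\<close> these
  are the coordinate changes.\<close>

definition loc_dom :: "('a, 'i, 'n::finite, 'z) atlas_data_scheme \<Rightarrow> ('b, 'j, 'n, 'y) atlas_data_scheme \<Rightarrow>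
    ('a \<Rightarrow> 'b) \<Rightarrow> 'i \<Rightarrow> 'j \<Rightarrow> (complex^'n) set" where
  "loc_dom M N f i j = coord M i ` {p \<in> cdom M i. f p \<in> cdom N j}"

definition loc_rep :: "('a, 'i, 'n::finite, 'z) atlas_data_scheme \<Rightarrow> ('b, 'j, 'n, 'y) atlas_data_scheme \<Rightarrow>
    ('a \<Rightarrow> 'b) \<Rightarrow> 'i \<Rightarrow> 'j \<Rightarrow> complex^'n \<Rightarrow> complex^'n" where
  "loc_rep M N f i j = coord N j \<circ> f \<circ> inv_into (cdom M i) (coord M i)"

definition complex_manifold :: "('a, 'i, 'n::finite, 'z) atlas_data_scheme \<Rightarrow> bool" where
  "complex_manifold M \<longleftrightarrow>
     Hausdorff_space (mtop M) \<and> second_countable (mtop M) \<and>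
     (\<Union>i\<in>charts M. cdom M i) = topspace (mtop M) \<and>
     (\<forall>i\<in>charts M. openin (mtop M) (cdom M i) \<and> open (cimage M i) \<and>
        homeomorphic_map (subtopology (mtop M) (cdom M i)) (top_of_set (cimage M i)) (coord M i)) \<and>
     (\<forall>i\<in>charts M. \<forall>j\<in>charts M. holo_on (loc_dom M M id i j) (loc_rep M M id i j))"

definition is_connection :: "('a, 'i, 'n::finite, 'z) special_data_scheme \<Rightarrow> bool" where
  "is_connection M \<longleftrightarrow>
     (\<forall>i\<in>charts M. local_connection (cimage M i) (conn M i)) \<and>
     (\<forall>i\<in>charts M. \<forall>j\<in>charts M.
        conn_related (loc_dom M M id i j) (loc_rep M M id i j) (conn M i) (conn M j))"

definition is_symplectic_form :: "('a, 'i, 'n::finite, 'z) special_data_scheme \<Rightarrow> bool" where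
  "is_symplectic_form M \<longleftrightarrow>
     (\<forall>i\<in>charts M. local_symplectic (cimage M i) (form M i)) \<and>
     (\<forall>i\<in>charts M. \<forall>j\<in>charts M.
        form_related (loc_dom M M id i j) (loc_rep M M id i j) (form M i) (form M j))"

text \<open>Since the charts are holomorphic, the complex structure of the manifold is \<open>Jc\<close> in each chart.\<close>

definition special_complex_manifold :: "('a, 'i, 'n::finite, 'z) special_data_scheme \<Rightarrow> bool" where
  "special_complex_manifold M \<longleftrightarrow> complex_manifold M \<and> is_connection M \<and>
     (\<forall>i\<in>charts M. local_flat (cimage M i) (conn M i) \<and>
        local_torsionfree (cimage M i) (conn M i) \<and> local_special (cimage M i) (conn M i))"

definition special_symplectic_manifold :: "('a, 'i, 'n::finite, 'z) special_data_scheme \<Rightarrow> bool" where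
  "special_symplectic_manifold M \<longleftrightarrow> special_complex_manifold M \<and> is_symplectic_form M \<and>
     (\<forall>i\<in>charts M. local_parallel (cimage M i) (conn M i) (form M i))"

definition open_part :: "('a, 'i, 'n::finite) special_data \<Rightarrow> 'a set \<Rightarrow> ('a, 'i, 'n) special_data" where
  "open_part M W = M\<lparr>mtop := subtopology (mtop M) W, cdom := (\<lambda>i. cdom M i \<inter> W)\<rparr>"

definition holomorphic_map :: "('a, 'i, 'n::finite, 'z) atlas_data_scheme \<Rightarrow> ('b, 'j, 'n, 'y) atlas_data_scheme \<Rightarrow>
    ('a \<Rightarrow> 'b) \<Rightarrow> bool" where
  "holomorphic_map M N f \<longleftrightarrow> continuous_map (mtop M) (mtop N) f \<and>
     (\<forall>i\<in>charts M. \<forall>j\<in>charts N. holo_on (loc_dom M N f i j) (loc_rep M N f i j))"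

definition biholomorphic :: "('a, 'i, 'n::finite, 'z) atlas_data_scheme \<Rightarrow> ('b, 'j, 'n, 'y) atlas_data_scheme \<Rightarrow>
    ('a \<Rightarrow> 'b) \<Rightarrow> bool" where
  "biholomorphic M N f \<longleftrightarrow> bij_betw f (topspace (mtop M)) (topspace (mtop N)) \<and>
     holomorphic_map M N f \<and> holomorphic_map N M (inv_into (topspace (mtop M)) f)"

definition special_symplectic_iso :: "('a, 'i, 'n::finite, 'z) special_data_scheme \<Rightarrow> ('b, 'j, 'n, 'y) special_data_scheme \<Rightarrow>
    ('a \<Rightarrow> 'b) \<Rightarrow> bool" where
  "special_symplectic_iso M N f \<longleftrightarrow> biholomorphic M N f \<and>
     (\<forall>i\<in>charts M. \<forall>j\<in>charts N.
        conn_related (loc_dom M N f i j) (loc_rep M N f i j) (conn M i) (conn N j) \<and>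
        form_related (loc_dom M N f i j) (loc_rep M N f i j) (form M i) (form N j))"


section \<open>Immersions into \<open>T\<^sup>*\<complex>\<^sup>n\<close> and the induced structures\<close>

text \<open>\<open>T\<^sup>*\<complex>\<^sup>n = \<complex>\<^sup>2\<^sup>n\<close> is \<open>complex^('n + 'n)\<close>; the component \<open>Inl i\<close> is the coordinate \<open>z\<^sup>i\<close> and the
  component \<open>Inr i\<close> is the coordinate \<open>w\<^sub>i\<close>. A one-form \<open>\<Sum> F\<^sub>i dz\<^sup>i\<close> is represented by
  \<open>F = (F\<^sub>1, \<dots>, F\<^sub>n)\<close>.\<close>

definition cpartial :: "(complex^'n \<Rightarrow> complex^'n) \<Rightarrow> 'n \<Rightarrow> 'n \<Rightarrow> complex^'n \<Rightarrow> complex" where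
  "cpartial F i j z = deriv (\<lambda>t. F (z + t *s axis j 1) $ i) 0"

definition regular_1form :: "(complex^'n) set \<Rightarrow> (complex^'n \<Rightarrow> complex^'n) \<Rightarrow> bool" where
  "regular_1form U F \<longleftrightarrow> holo_on U F \<and>
     (\<forall>z\<in>U. invertible ((\<chi> i j. Im (cpartial F i j z)) :: real^'n^'n))"

definition one_form_map :: "(complex^'n \<Rightarrow> complex^'n) \<Rightarrow> complex^'n \<Rightarrow> complex^('n + 'n)" where
  "one_form_map F z = (\<chi> k. case k of Inl i \<Rightarrow> z $ i | Inr i \<Rightarrow> F z $ i)"

definition real_points :: "(complex^'m) set" where
  "real_points = {v. \<forall>k. Im (v $ k) = 0}"

definition holomorphic_immersion :: "(complex^'n) set \<Rightarrow> (complex^'n \<Rightarrow> complex^'m) \<Rightarrow> bool" where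
  "holomorphic_immersion U \<phi> \<longleftrightarrow> holo_on U \<phi> \<and> (\<forall>p\<in>U. inj (frechet_derivative \<phi> (at p)))"

definition totally_complex :: "(complex^'n) set \<Rightarrow> (complex^'n \<Rightarrow> complex^('n + 'n)) \<Rightarrow> bool" where
  "totally_complex U \<phi> \<longleftrightarrow> (\<forall>p\<in>U. real_points \<inter> range (frechet_derivative \<phi> (at p)) = {0})"

definition induced_connection :: "(complex^'n) set \<Rightarrow> (complex^'n \<Rightarrow> complex^('n + 'n)) \<Rightarrow>
    'n::finite christoffel \<Rightarrow> bool" where
  "induced_connection U \<phi> \<Gamma> \<longleftrightarrow> local_connection U \<Gamma> \<and> local_flat U \<Gamma> \<and> local_torsionfree U \<Gamma> \<and>
     (\<forall>i. affine_function U \<Gamma> (\<lambda>z. Re (\<phi> z $ Inl i))) \<and>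
     (\<forall>i. affine_function U \<Gamma> (\<lambda>z. Re (\<phi> z $ Inr i)))"

text \<open>\<open>\<Sum> dx\<^sup>i \<and> dy\<^sub>i\<close>, with \<open>(\<alpha> \<and> \<beta>)(u, v) = \<alpha>(u) \<beta>(v) - \<alpha>(v) \<beta>(u)\<close>.\<close>

definition dx_wedge_dy :: "complex^('n::finite + 'n) \<Rightarrow> complex^('n + 'n) \<Rightarrow> real" where
  "dx_wedge_dy u v = (\<Sum>i\<in>UNIV. Re (u $ Inl i) * Re (v $ Inr i) - Re (v $ Inl i) * Re (u $ Inr i))"

definition induced_form :: "(complex^'n \<Rightarrow> complex^('n + 'n)) \<Rightarrow> 'n::finite twoform" where
  "induced_form \<phi> p u v =
     2 * dx_wedge_dy (frechet_derivative \<phi> (at p) u) (frechet_derivative \<phi> (at p) v)"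

text \<open>An open subset \<open>U\<close> of \<open>\<complex>\<^sup>n\<close> with a connection and a two-form, as a manifold with one chart.\<close>

definition open_set_data :: "(complex^'n) set \<Rightarrow> 'n christoffel \<Rightarrow> 'n twoform \<Rightarrow>
    (complex^'n, unit, 'n::finite) special_data" where
  "open_set_data U \<Gamma> \<omega> = \<lparr>mtop = top_of_set U, charts = {()}, cdom = (\<lambda>_. U), coord = (\<lambda>_ z. z),
     conn = (\<lambda>_. \<Gamma>), form = (\<lambda>_. \<omega>)\<rparr>"

end

theory Submission
  imports Defs "HOL-Complex_Analysis.Cauchy_Integral_Formula"
begin

text \<open>
  For a regular one-form \<open>F\<close> put \<open>\<rho> = Re \<phi>\<close>. Regularity of \<open>F\<close> means that \<open>D\<rho>\<close> is invertible, and affinity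
  of the components of \<open>\<rho>\<close> means that \<open>D\<rho> (\<nabla>\<^sub>X Y) = X (D\<rho> Y)\<close>. This identity determines \<open>\<nabla>\<close>, and
  applying \<open>D\<rho>\<close> reduces every property of \<open>\<nabla>\<close> and \<open>\<omega>\<close> to the fact that vector fields act on
  functions with \<open>[X, Y] = X Y - Y X\<close>.

  Conversely, flatness, torsion-freeness and \<open>d\<^sup>\<nabla> J = 0\<close> are the integrability conditions of a total linear
  system whose solutions are holomorphic functions with affine real part; the initial differential of
  the real part is arbitrary. By linear algebra, the initial differentials can be chosen as a symplectic
  coframe \<open>\<xi>\<^sub>i, \<eta>\<^sub>i\<close> such that the functions \<open>z\<^sup>i\<close> belonging to the \<open>\<xi>\<^sub>i\<close> have complex independent
  differentials. Parallel transport keeps the coframe symplectic, the \<open>z\<^sup>i\<close> are local holomorphic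
  coordinates, and the functions \<open>w\<^sub>i\<close> belonging to the \<open>\<eta>\<^sub>i\<close> are the components of \<open>F\<close>.
\<close>

section \<open>Smooth maps\<close>

text \<open>A total linear system \<open>D s(x) v = A(x)(v, s(x))\<close> has a solution for every
  initial value once the second derivative that it predicts is symmetric. In the converse the
  unknown is a pair (f, a), where a is the real covector Re df, and the system reads df = a - \<i>
  (a o J), \<nabla> a = 0. So f is obtained together with its differential, with a radius that does
  not depend on the initial covector. The coframe needs care because \<omega> is not related to J:
  covectors \<xi>_1 and \<xi>_2 = \<xi>_1 o J may belong to one symplectic coframe, and then dz^2 is
  a complex multiple of dz^1. Symplectic shears remove this degeneracy. A regularity gap has to be
  closed as well. \<open>holo_on\<close> asks for one real derivative with complex linear
  differential, whereas connections and forms are smooth. Cauchy's formula on complex lines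
  expresses a directional derivative by values of the function, and differentiation under the
  integral then gives all orders. Finally, \<open>conn_related\<close> speaks of vector fields while
  the constructions are pointwise; the transformation law of Christoffel maps connects the
  two.\<close>

abbreviation FD :: "('a::euclidean_space \<Rightarrow> 'b::real_normed_vector) \<Rightarrow> 'a \<Rightarrow> 'a \<Rightarrow> 'b" where
  "FD f x \<equiv> frechet_derivative f (at x)"

lemma FD_eq: "(f has_derivative f') (at x) \<Longrightarrow> FD f x = f'"
  by (metis frechet_derivative_at)

lemma FD_has: "f differentiable (at x) \<Longrightarrow> (f has_derivative FD f x) (at x)"
  by (simp add: frechet_derivative_works)

lemma FD_cong:
  assumes "open S" "x \<in> S" "\<And>y. y \<in> S \<Longrightarrow> f y = g y"
  shows "FD f x = FD g x"
proof -
  have "(f has_derivative f') (at x) \<longleftrightarrow> (g has_derivative f') (at x)" for f'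
    using assms has_derivative_transform_within_open by metis
  then show ?thesis
    by (simp add: frechet_derivative_def)
qed

lemma differentiable_cong_open:
  assumes "open S" "x \<in> S" "\<And>y. y \<in> S \<Longrightarrow> f y = g y"
  shows "f differentiable (at x) \<longleftrightarrow> g differentiable (at x)"
  using assms has_derivative_transform_within_open unfolding differentiable_def by metis

lemma Ck_on_cong:
  assumes "open S" "\<And>y. y \<in> S \<Longrightarrow> f y = g y"
  shows "Ck_on k S f = Ck_on k S g"
  using assms(2)
proof (induction k arbitrary: f g)
  case 0
  then show ?case by (simp cong: continuous_on_cong)
next
  case (Suc k)
  have "Ck_on k S (\<lambda>x. FD f x v) = Ck_on k S (\<lambda>x. FD g x v)" for v
    by (rule Suc.IH) (metis FD_cong[OF assms(1)] Suc.prems)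
  then show ?case
    using differentiable_cong_open[OF assms(1) _ Suc.prems] by auto
qed

lemma Ck_on_Suc_D: "Ck_on (Suc k) S f \<Longrightarrow> Ck_on k S f"
proof (induction k arbitrary: f)
  case 0
  then show ?case
    by (auto simp: continuous_at_imp_continuous_on differentiable_imp_continuous_within)
next
  case (Suc k)
  then show ?case by (metis Ck_on.simps(2))
qed

lemma Ck_on_subset: "Ck_on k S f \<Longrightarrow> T \<subseteq> S \<Longrightarrow> Ck_on k T f"
  by (induction k arbitrary: f) (auto intro: continuous_on_subset)

lemma Ck_on_const: "Ck_on k S (\<lambda>x. c)"
  by (induction k arbitrary: c) auto

lemma Ck_on_bounded_linear:
  assumes "bounded_linear h" "open S" "Ck_on k S f"
  shows "Ck_on k S (\<lambda>x. h (f x))"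
  using assms(3)
proof (induction k arbitrary: f)
  case 0
  then show ?case
    using assms(1) by (auto intro: bounded_linear.continuous_on)
next
  case (Suc k)
  have d: "((\<lambda>x. h (f x)) has_derivative (\<lambda>v. h (FD f x v))) (at x)" if "x \<in> S" for x
    using Suc.prems that by (auto intro!: bounded_linear.has_derivative[OF assms(1)] FD_has)
  have "Ck_on k S (\<lambda>x. FD (\<lambda>x. h (f x)) x v)" for v
    using Suc.IH[of "\<lambda>x. FD f x v"] Suc.prems
    by (subst Ck_on_cong[OF assms(2), where g = "\<lambda>x. h (FD f x v)"]) (auto simp: FD_eq[OF d])
  then show ?case
    using d by (auto simp: differentiable_def)
qed

lemma Ck_on_add:
  assumes "open S" "Ck_on k S f" "Ck_on k S g"
  shows "Ck_on k S (\<lambda>x. f x + g x)"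
  using assms(2,3)
proof (induction k arbitrary: f g)
  case 0
  then show ?case by (auto intro: continuous_intros)
next
  case (Suc k)
  have d: "((\<lambda>x. f x + g x) has_derivative (\<lambda>v. FD f x v + FD g x v)) (at x)" if "x \<in> S" for x
    using Suc.prems that by (auto intro!: has_derivative_add FD_has)
  have "Ck_on k S (\<lambda>x. FD (\<lambda>x. f x + g x) x v)" for v
    using Suc.IH[of "\<lambda>x. FD f x v" "\<lambda>x. FD g x v"] Suc.prems
    by (subst Ck_on_cong[OF assms(1), where g = "\<lambda>x. FD f x v + FD g x v"]) (auto simp: FD_eq[OF d])
  then show ?case
    using d by (auto simp: differentiable_def)
qed

text \<open>The product rule leaves one factor undifferentiated in each summand; that factor is only
  needed with one order less, so the induction closes.\<close>

lemma Ck_on_bounded_bilinear: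
  assumes "bounded_bilinear B" "open S" "Ck_on k S f" "Ck_on k S g"
  shows "Ck_on k S (\<lambda>x. B (f x) (g x))"
  using assms(3,4)
proof (induction k arbitrary: f g)
  case 0
  then show ?case
    by (auto intro: bounded_bilinear.continuous_on[OF assms(1)])
next
  case (Suc k)
  have d: "((\<lambda>x. B (f x) (g x)) has_derivative (\<lambda>v. B (f x) (FD g x v) + B (FD f x v) (g x))) (at x)"
    if "x \<in> S" for x
    using Suc.prems that by (auto intro!: bounded_bilinear.FDERIV[OF assms(1)] FD_has)
  have "Ck_on k S (\<lambda>x. FD (\<lambda>x. B (f x) (g x)) x v)" for v
    using Suc.IH[of "f" "\<lambda>x. FD g x v"] Suc.IH[of "\<lambda>x. FD f x v" g] Suc.prems
      Ck_on_Suc_D[OF Suc.prems(1)] Ck_on_Suc_D[OF Suc.prems(2)]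
    by (subst Ck_on_cong[OF assms(2), where g = "\<lambda>x. B (f x) (FD g x v) + B (FD f x v) (g x)"])
       (auto simp: FD_eq[OF d] intro!: Ck_on_add[OF assms(2)])
  then show ?case
    using d by (auto simp: differentiable_def)
qed

text \<open>The derivative of the inverse contains the inverse itself, one order lower. The
  induction therefore keeps \<open>f\<close> fixed and lowers only the order.\<close>

lemma Ck_on_inverse:
  fixes f :: "'a::euclidean_space \<Rightarrow> real"
  assumes "open S" "\<And>x. x \<in> S \<Longrightarrow> f x \<noteq> 0" "Ck_on k S f"
  shows "Ck_on k S (\<lambda>x. inverse (f x))"
  using assms(3)
proof (induction k)
  case 0
  then show ?case using assms(2) by (auto intro!: continuous_intros)
next
  case (Suc k)
  have d: "((\<lambda>x. inverse (f x)) has_derivative (\<lambda>v. - (inverse (f x) * FD f x v * inverse (f x)))) (at x)"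
    if "x \<in> S" for x
    using Suc.prems that assms(2) by (auto intro!: Deriv.has_derivative_inverse FD_has)
  note B = Ck_on_bounded_bilinear[OF bounded_bilinear_mult assms(1)]
  have 1: "Ck_on k S (\<lambda>x. inverse (f x))"
    using Suc Ck_on_Suc_D by blast
  have "Ck_on k S (\<lambda>x. - (inverse (f x) * FD f x v * inverse (f x)))" for v
    using Suc.prems
    by (intro Ck_on_bounded_linear[OF bounded_linear_minus[OF bounded_linear_ident] assms(1)] B 1) auto
  then have "Ck_on k S (\<lambda>x. FD (\<lambda>x. inverse (f x)) x v)" for v
    by (subst Ck_on_cong[OF assms(1), where g = "\<lambda>x. - (inverse (f x) * FD f x v * inverse (f x))"])
       (auto simp: FD_eq[OF d])
  then show ?case
    using d by (auto simp: differentiable_def)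
qed

lemma smooth_on_cong:
  assumes "open S" "\<And>y. y \<in> S \<Longrightarrow> f y = g y"
  shows "smooth_on S f = smooth_on S g"
  using Ck_on_cong[OF assms] by (simp add: smooth_on_def)

lemma smooth_on_subset: "smooth_on S f \<Longrightarrow> T \<subseteq> S \<Longrightarrow> smooth_on T f"
  by (auto simp: smooth_on_def intro: Ck_on_subset)

lemma smooth_on_const [simp]: "smooth_on S (\<lambda>x. c)"
  by (simp add: smooth_on_def Ck_on_const)

lemma smooth_on_bounded_linear:
  "bounded_linear h \<Longrightarrow> open S \<Longrightarrow> smooth_on S f \<Longrightarrow> smooth_on S (\<lambda>x. h (f x))"
  by (simp add: smooth_on_def Ck_on_bounded_linear)

lemma smooth_on_add:
  "open S \<Longrightarrow> smooth_on S f \<Longrightarrow> smooth_on S g \<Longrightarrow> smooth_on S (\<lambda>x. f x + g x)"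
  by (simp add: smooth_on_def Ck_on_add)

lemma smooth_on_bounded_bilinear:
  "bounded_bilinear B \<Longrightarrow> open S \<Longrightarrow> smooth_on S f \<Longrightarrow> smooth_on S g \<Longrightarrow> smooth_on S (\<lambda>x. B (f x) (g x))"
  by (simp add: smooth_on_def Ck_on_bounded_bilinear)

lemma smooth_on_inverse:
  fixes f :: "'a::euclidean_space \<Rightarrow> real"
  shows "open S \<Longrightarrow> (\<And>x. x \<in> S \<Longrightarrow> f x \<noteq> 0) \<Longrightarrow> smooth_on S f \<Longrightarrow> smooth_on S (\<lambda>x. inverse (f x))"
  by (simp add: smooth_on_def Ck_on_inverse)

lemma smooth_on_sum:
  assumes "open S" "\<And>i. i \<in> I \<Longrightarrow> smooth_on S (f i)"
  shows "smooth_on S (\<lambda>x. \<Sum>i\<in>I. f i x)"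
  using assms(2) by (induction I rule: infinite_finite_induct) (auto intro!: smooth_on_add[OF assms(1)])

lemma smooth_on_prod:
  fixes f :: "'i \<Rightarrow> 'a::euclidean_space \<Rightarrow> real"
  assumes "open S" "\<And>i. i \<in> I \<Longrightarrow> smooth_on S (f i)"
  shows "smooth_on S (\<lambda>x. \<Prod>i\<in>I. f i x)"
  using assms(2)
  by (induction I rule: infinite_finite_induct)
     (auto intro!: smooth_on_bounded_bilinear[OF bounded_bilinear_mult assms(1)])

lemma smooth_on_componentwise:
  fixes f :: "'a::euclidean_space \<Rightarrow> 'b::euclidean_space"
  assumes "open S" "\<And>b. b \<in> Basis \<Longrightarrow> smooth_on S (\<lambda>x. f x \<bullet> b)"
  shows "smooth_on S f"
proof -
  have "smooth_on S (\<lambda>x. \<Sum>b\<in>Basis. (f x \<bullet> b) *\<^sub>R b)"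
    by (intro smooth_on_sum assms smooth_on_bounded_linear[OF bounded_linear_scaleR_left assms(1)])
  then show ?thesis by (simp add: euclidean_representation)
qed

lemma smooth_on_det:
  fixes A :: "'a::euclidean_space \<Rightarrow> real^'n^'n"
  assumes "open S" "\<And>i j. smooth_on S (\<lambda>x. A x $ i $ j)"
  shows "smooth_on S (\<lambda>x. det (A x))"
  unfolding det_def
  by (intro smooth_on_sum assms smooth_on_bounded_bilinear[OF bounded_bilinear_mult assms(1)]
      smooth_on_prod smooth_on_const)

lemma smooth_on_differentiable: "smooth_on S f \<Longrightarrow> x \<in> S \<Longrightarrow> f differentiable (at x)"
  unfolding smooth_on_def by (metis Ck_on.simps(2))

lemma smooth_on_FD: "smooth_on S f \<Longrightarrow> smooth_on S (\<lambda>x. FD f x v)"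
  unfolding smooth_on_def by (metis Ck_on.simps(2))

lemma smooth_on_continuous: "smooth_on S f \<Longrightarrow> continuous_on S f"
  unfolding smooth_on_def by (metis Ck_on.simps(1))

lemma smooth_on_FD_has: "smooth_on S f \<Longrightarrow> x \<in> S \<Longrightarrow> (f has_derivative FD f x) (at x)"
  by (simp add: FD_has smooth_on_differentiable)

lemma smooth_on_linear_FD: "smooth_on S f \<Longrightarrow> x \<in> S \<Longrightarrow> linear (FD f x)"
  by (simp add: linear_frechet_derivative smooth_on_differentiable)

text \<open>Two applications of the mean value theorem: along \<open>u\<close> to the difference of
  \<open>h\<close> on two parallel edges of the parallelogram, then along \<open>v\<close> to the
  derivative so obtained. The left side is symmetric in \<open>u\<close> and \<open>v\<close>, which
  is the source of the symmetry of second derivatives.\<close>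

lemma second_difference_mean_value:
  fixes h :: "'a::euclidean_space \<Rightarrow> real"
  assumes s: "0 < s" and r: "s * norm u + s * norm v < r"
    and d: "\<And>y. y \<in> ball x r \<Longrightarrow> h differentiable (at y)"
    and d2: "\<And>y. y \<in> ball x r \<Longrightarrow> (\<lambda>q. FD h q u) differentiable (at y)"
  obtains y where "y \<in> cball x (s * norm u + s * norm v)"
    "h (x + s *\<^sub>R u + s *\<^sub>R v) - h (x + s *\<^sub>R u) - h (x + s *\<^sub>R v) + h x = s\<^sup>2 * FD (\<lambda>q. FD h q u) y v"
proof -
  have B: "x + a *\<^sub>R u + b *\<^sub>R v \<in> cball x (s * norm u + s * norm v)"
    if "0 \<le> a" "a \<le> s" "0 \<le> b" "b \<le> s" for a b
  proof -
    have "norm (a *\<^sub>R u + b *\<^sub>R v) \<le> a * norm u + b * norm v"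
      using that by (metis norm_triangle_ineq norm_scaleR abs_of_nonneg)
    also have "\<dots> \<le> s * norm u + s * norm v"
      using that by (intro add_mono mult_right_mono) auto
    finally show ?thesis
      by (metis add.assoc add_diff_cancel_left' dist_commute dist_norm mem_cball)
  qed
  have B': "x + a *\<^sub>R u + b *\<^sub>R v \<in> ball x r" if "0 \<le> a" "a \<le> s" "0 \<le> b" "b \<le> s" for a b
    using B[OF that] r by auto
  define \<psi> where "\<psi> a = h (x + a *\<^sub>R u + s *\<^sub>R v) - h (x + a *\<^sub>R u)" for a
  have "(\<psi> has_derivative (\<lambda>t. FD h (x + a *\<^sub>R u + s *\<^sub>R v) (t *\<^sub>R u) - FD h (x + a *\<^sub>R u) (t *\<^sub>R u))) (at a)"
    if a: "0 \<le> a" "a \<le> s" for a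
    unfolding \<psi>_def using d[OF B'[OF a, of s]] d[OF B'[OF a, of 0]] s
    by (intro has_derivative_diff has_derivative_compose[OF _ FD_has, where g = h])
       (auto intro!: derivative_eq_intros)
  from mvt_simple[OF s has_derivative_at_withinI[OF this]] obtain a where a: "0 < a" "a < s"
    and "\<psi> s - \<psi> 0 = FD h (x + a *\<^sub>R u + s *\<^sub>R v) (s *\<^sub>R u) - FD h (x + a *\<^sub>R u) (s *\<^sub>R u)"
    by auto
  then have e1: "\<psi> s - \<psi> 0 = s * (FD h (x + a *\<^sub>R u + s *\<^sub>R v) u - FD h (x + a *\<^sub>R u) u)"
    using linear_cmul[OF linear_frechet_derivative[OF d[OF B'[of a s]]]]
      linear_cmul[OF linear_frechet_derivative[OF d[OF B'[of a 0]]]] s by (simp add: algebra_simps)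
  define \<theta> where "\<theta> b = FD h (x + a *\<^sub>R u + b *\<^sub>R v) u" for b
  have "(\<theta> has_derivative (\<lambda>t. FD (\<lambda>q. FD h q u) (x + a *\<^sub>R u + b *\<^sub>R v) (t *\<^sub>R v))) (at b)"
    if b: "0 \<le> b" "b \<le> s" for b
    unfolding \<theta>_def using d2[OF B'[of a b]] a b
    by (intro has_derivative_compose[OF _ FD_has, where g = "\<lambda>q. FD h q u"])
       (auto intro!: derivative_eq_intros)
  from mvt_simple[OF s has_derivative_at_withinI[OF this]] obtain b where b: "0 < b" "b < s"
    and "\<theta> s - \<theta> 0 = FD (\<lambda>q. FD h q u) (x + a *\<^sub>R u + b *\<^sub>R v) (s *\<^sub>R v)"
    by auto
  then have "\<theta> s - \<theta> 0 = s * FD (\<lambda>q. FD h q u) (x + a *\<^sub>R u + b *\<^sub>R v) v"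
    using linear_cmul[OF linear_frechet_derivative[OF d2[OF B'[of a b]]]] a by simp
  then have "\<psi> s - \<psi> 0 = s\<^sup>2 * FD (\<lambda>q. FD h q u) (x + a *\<^sub>R u + b *\<^sub>R v) v"
    using e1 by (simp add: \<theta>_def power2_eq_square)
  moreover have "x + a *\<^sub>R u + b *\<^sub>R v \<in> cball x (s * norm u + s * norm v)"
    using B a b by simp
  ultimately show ?thesis
    using that by (auto simp: \<psi>_def algebra_simps)
qed

text \<open>The same second difference equals both mixed derivatives, taken at two points of a small
  parallelogram. If the values at \<open>x\<close> differed, continuity would keep them apart
  there.\<close>

lemma FD_commute_real:
  fixes h :: "'a::euclidean_space \<Rightarrow> real"
  assumes "open S" "Ck_on 2 S h" "x \<in> S"
  shows "FD (\<lambda>q. FD h q u) x v = FD (\<lambda>q. FD h q v) x u"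
proof (rule ccontr)
  let ?f = "\<lambda>y. FD (\<lambda>q. FD h q u) y v" and ?g = "\<lambda>y. FD (\<lambda>q. FD h q v) y u"
  assume ne: "?f x \<noteq> ?g x"
  have C: "Ck_on 1 S (\<lambda>q. FD h q w)" "\<And>y. y \<in> S \<Longrightarrow> h differentiable (at y)" for w
    using assms(2) by (simp_all add: numeral_2_eq_2)
  have D: "continuous_on S (\<lambda>y. FD (\<lambda>q. FD h q w) y w')"
     "\<And>y. y \<in> S \<Longrightarrow> (\<lambda>q. FD h q w) differentiable (at y)" for w w'
    using C(1)[of w] by auto
  \<comment> \<open>Half the gap: two deviations below \<open>e\<close> cannot bridge it.\<close>
  define e where "e = \<bar>?f x - ?g x\<bar> / 2"
  have e: "e > 0" using ne by (simp add: e_def)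
  have "isCont ?f x" "isCont ?g x"
    using D(1) assms by (auto simp: continuous_on_eq_continuous_at)
  then obtain r1 r2 where r1: "r1 > 0" "\<And>y. dist y x < r1 \<Longrightarrow> dist (?f y) (?f x) < e"
    and r2: "r2 > 0" "\<And>y. dist y x < r2 \<Longrightarrow> dist (?g y) (?g x) < e"
    using e unfolding continuous_at_eps_delta dist_real_def by (metis dist_norm real_norm_def)
  obtain r3 where r3: "r3 > 0" "ball x r3 \<subseteq> S"
    using assms openE by blast
  define r where "r = min r1 (min r2 r3)"
  \<comment> \<open>The factor 2 keeps the parallelogram strictly inside the ball of radius
    \<open>r\<close>; the summand 1 avoids division by zero when both directions vanish.\<close>
  define s where "s = r / (2 * (norm u + norm v + 1))"
  have r: "r > 0" using r1 r2 r3 by (simp add: r_def)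
  have np: "norm u + norm v + 1 > 0" by (smt (verit) norm_ge_zero)
  have s: "s > 0" using r np by (simp add: s_def)
  have "s * (norm u + norm v) < s * (2 * (norm u + norm v + 1))"
    using s np by (intro mult_strict_left_mono) (smt (verit) norm_ge_zero)+
  also have "\<dots> = r" using np by (simp add: s_def)
  finally have sr: "s * norm u + s * norm v < r" by (simp add: algebra_simps)
  have sub: "ball x r \<subseteq> S" using r3 by (auto simp: r_def)
  obtain y where y: "y \<in> cball x (s * norm u + s * norm v)"
    "h (x + s *\<^sub>R u + s *\<^sub>R v) - h (x + s *\<^sub>R u) - h (x + s *\<^sub>R v) + h x = s\<^sup>2 * ?f y"
    by (rule second_difference_mean_value[OF s sr, of x h]) (use C(2) D(2) sub in blast)+
  obtain z where z: "z \<in> cball x (s * norm v + s * norm u)"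
    "h (x + s *\<^sub>R v + s *\<^sub>R u) - h (x + s *\<^sub>R v) - h (x + s *\<^sub>R u) + h x = s\<^sup>2 * ?g z"
    by (rule second_difference_mean_value[OF s, of v u r x h]) (use sr C(2) D(2) sub in \<open>auto simp: add.commute\<close>)
  have "s\<^sup>2 * ?f y = s\<^sup>2 * ?g z" using y(2) z(2) by (simp add: algebra_simps)
  then have "?f y = ?g z" using s by simp
  moreover have "dist y x < r1" "dist z x < r2"
    using y(1) z(1) sr by (auto simp: r_def dist_commute)
  ultimately have "\<bar>?f x - ?g x\<bar> < e + e"
    using r1(2)[of y] r2(2)[of z] by (simp add: dist_real_def)
  then show False by (simp add: e_def)
qed

lemma FD_bounded_linear:
  assumes "bounded_linear h" "f differentiable (at x)"
  shows "FD (\<lambda>x. h (f x)) x v = h (FD f x v)"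
  by (subst FD_eq[OF bounded_linear.has_derivative[OF assms(1) FD_has[OF assms(2)]]]) simp

lemma FD_commute:
  fixes h :: "'a::euclidean_space \<Rightarrow> 'b::euclidean_space"
  assumes "open S" "smooth_on S h" "x \<in> S"
  shows "FD (\<lambda>q. FD h q u) x v = FD (\<lambda>q. FD h q v) x u"
proof (rule euclidean_eqI)
  fix b :: 'b
  assume "b \<in> Basis"
  have E: "FD (\<lambda>q. FD h q u) x v \<bullet> b = FD (\<lambda>q. FD (\<lambda>y. h y \<bullet> b) q u) x v" for u v
  proof -
    have "FD (\<lambda>q. FD (\<lambda>y. h y \<bullet> b) q u) x v = FD (\<lambda>q. FD h q u \<bullet> b) x v"
      by (subst FD_cong[OF assms(1,3)])
         (auto simp: FD_bounded_linear[OF bounded_linear_inner_left smooth_on_differentiable[OF assms(2)]])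
    then show ?thesis
      by (simp add: FD_bounded_linear[OF bounded_linear_inner_left
            smooth_on_differentiable[OF smooth_on_FD[OF assms(2)] assms(3)]])
  qed
  have "Ck_on 2 S (\<lambda>y. h y \<bullet> b)"
    using smooth_on_bounded_linear[OF bounded_linear_inner_left assms(1,2)] by (simp add: smooth_on_def)
  from FD_commute_real[OF assms(1) this assms(3)]
  show "FD (\<lambda>q. FD h q u) x v \<bullet> b = FD (\<lambda>q. FD h q v) x u \<bullet> b"
    unfolding E .
qed

section \<open>Holomorphic maps are smooth\<close>

text \<open>Continuity of the differential is assumed one direction at a time. In finite dimension
  this is continuity of the operator-valued map \<open>F\<close>, which is the form in which
  differentiation under the integral applies.\<close>

lemma leibniz_unit_interval:
  fixes f :: "'a::euclidean_space \<Rightarrow> real \<Rightarrow> 'b::banach"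
  assumes U: "open U" "convex U" "x \<in> U"
    and der: "\<And>x t. x \<in> U \<Longrightarrow> t \<in> {0..1} \<Longrightarrow> ((\<lambda>x. f x t) has_derivative D x t) (at x)"
    and contD: "\<And>v. continuous_on (U \<times> {0..1}) (\<lambda>(x, t). D x t v)"
    and contf: "\<And>x. x \<in> U \<Longrightarrow> continuous_on {0..1} (f x)"
  shows "((\<lambda>x. integral {0..1} (f x)) has_derivative (\<lambda>v. integral {0..1} (\<lambda>t. D x t v))) (at x)"
proof -
  define F where "F x t = Blinfun (D x t)" for x t
  have F: "blinfun_apply (F y t) = D y t" if "y \<in> U" "t \<in> {0..1}" for y t
    unfolding F_def by (rule bounded_linear_Blinfun_apply) (use der[OF that] has_derivative_bounded_linear in blast)
  have contF: "continuous_on (U \<times> {0..1}) (\<lambda>(x, t). F x t)"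
  proof (rule continuous_on_blinfun_componentwise)
    fix i :: 'a
    show "continuous_on (U \<times> {0..1}) (\<lambda>p. blinfun_apply (case p of (x, t) \<Rightarrow> F x t) i)"
      by (rule continuous_on_eq[OF contD[of i]]) (auto simp: F)
  qed
  have "((\<lambda>x. integral (cbox 0 1) (f x)) has_derivative integral (cbox 0 1) (F x)) (at x within U)"
  proof (rule leibniz_rule[OF _ _ _ U(3,2)])
    show "f y integrable_on cbox 0 1" if "y \<in> U" for y
      using contf[OF that] by (simp add: integrable_continuous_real)
    show "continuous_on (U \<times> cbox 0 1) (\<lambda>(x, t). F x t)" using contF by simp
  qed (use der F in \<open>auto intro: has_derivative_at_withinI\<close>)
  then have "((\<lambda>x. integral {0..1} (f x)) has_derivative integral {0..1} (F x)) (at x)"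
    by (simp only: at_within_open[OF U(3,1)] interval_cbox)
  moreover have "blinfun_apply (integral {0..1} (F x)) = (\<lambda>v. integral {0..1} (\<lambda>t. D x t v))"
  proof
    fix v
    have "continuous_on {0..1} (\<lambda>t. (\<lambda>(x, t). F x t) (x, t))"
      by (rule continuous_on_compose2[OF contF]) (use U in \<open>auto intro!: continuous_intros\<close>)
    then have "F x integrable_on {0..1}"
      by (simp add: integrable_continuous_real)
    from blinfun_apply_integral[OF this, of v]
    show "blinfun_apply (integral {0..1} (F x)) v = integral {0..1} (\<lambda>t. D x t v)"
      by (simp only:) (rule integral_cong, simp add: F[OF U(3)])
  qed
  ultimately show ?thesis by simp
qed

lemma norm_vector_scalar_mult: "norm (c *s v) = norm c * norm (v :: complex^'n)"
  by (simp add: norm_vec_def norm_mult L2_set_right_distrib)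

lemma bounded_linear_vector_scalar_mult_left: "bounded_linear (\<lambda>c. c *s (v :: complex^'n))"
  by (rule bounded_linear_intro[where K = "norm v"])
     (simp_all add: vec_eq_iff distrib_right norm_vector_scalar_mult)

lemma bounded_linear_vector_scalar_mult_right: "bounded_linear (\<lambda>v. c *s (v :: complex^'n))"
  by (rule bounded_linear_intro[where K = "norm c"])
     (simp_all add: vec_eq_iff distrib_left norm_vector_scalar_mult mult.commute)

definition holo_fun_on :: "(complex^'n) set \<Rightarrow> (complex^'n \<Rightarrow> complex) \<Rightarrow> bool" where
  "holo_fun_on S h \<longleftrightarrow> (\<forall>x\<in>S. h differentiable (at x) \<and> (\<forall>c v. FD h x (c *s v) = c * FD h x v))"

text \<open>On the complex line \<open>x + \<zeta> *s v\<close> the function depends on one complex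
  variable, with derivative \<open>FD h x v\<close> at 0. On the circle du = 2 \<pi> \<i> u dt,
  which cancels the prefactor of Cauchy's formula and one power of u. The right side contains no
  derivative of \<open>h\<close>.\<close>

lemma holo_fun_on_Cauchy_derivative:
  fixes v :: "complex^'n"
  assumes h: "holo_fun_on S h" and \<rho>: "\<rho> > 0" and sub: "\<And>\<zeta>. norm \<zeta> \<le> \<rho> \<Longrightarrow> x + \<zeta> *s v \<in> S"
  defines "\<gamma> \<equiv> \<lambda>t::real. of_real \<rho> * exp (2 * of_real pi * \<i> * of_real t) :: complex"
  shows "FD h x v = integral {0..1} (\<lambda>t. inverse (\<gamma> t) * h (x + \<gamma> t *s v))"
proof -
  define g where "g \<zeta> = h (x + \<zeta> *s v)" for \<zeta>
  have d: "(g has_field_derivative FD h (x + \<zeta> *s v) v) (at \<zeta>)" if "norm \<zeta> \<le> \<rho>" for \<zeta>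
  proof -
    have "((\<lambda>\<zeta>. x + \<zeta> *s v) has_derivative (\<lambda>t. t *s v)) (at \<zeta>)"
      using bounded_linear.has_derivative[OF bounded_linear_vector_scalar_mult_left has_derivative_ident]
      by (auto intro!: derivative_eq_intros)
    moreover have "(h has_derivative FD h (x + \<zeta> *s v)) (at (x + \<zeta> *s v))"
      using h sub[OF that] by (auto simp: holo_fun_on_def FD_has)
    ultimately have "(g has_derivative (\<lambda>t. FD h (x + \<zeta> *s v) (t *s v))) (at \<zeta>)"
      unfolding g_def by (rule has_derivative_compose)
    moreover have "FD h (x + \<zeta> *s v) (t *s v) = FD h (x + \<zeta> *s v) v * t" for t
      using h sub[OF that] by (simp add: holo_fun_on_def)
    ultimately show ?thesis by (simp add: has_field_derivative_def)
  qed
  have "continuous_on (cball 0 \<rho>) g"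
    by (intro continuous_at_imp_continuous_on ballI DERIV_isCont[OF d]) auto
  moreover have "g holomorphic_on ball 0 \<rho>"
    unfolding holomorphic_on_open[OF open_ball] using d by (metis mem_ball_0 less_imp_le)
  ultimately have "(g has_field_derivative (1 / (2 * of_real pi * \<i>) * contour_integral (circlepath 0 \<rho>) (\<lambda>u. g u / (u-0)^2))) (at 0)"
    by (rule Cauchy_derivative_integral_circlepath) (use \<rho> in auto)
  moreover have "(g has_field_derivative FD h x v) (at 0)"
    using d[of 0] \<rho> by simp
  ultimately have "FD h x v = 1 / (2 * of_real pi * \<i>) * contour_integral (circlepath 0 \<rho>) (\<lambda>u. g u / (u-0)^2)"
    using DERIV_unique by blast
  also have "\<dots> = 1 / (2 * of_real pi * \<i>) * integral {0..1} (\<lambda>t. 2 * of_real pi * \<i> * (inverse (\<gamma> t) * g (\<gamma> t)))"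
  proof -
    have "integral {0..1} (\<lambda>t. g (circlepath 0 \<rho> t) / (circlepath 0 \<rho> t - 0)^2 * vector_derivative (circlepath 0 \<rho>) (at t))
        = integral {0..1} (\<lambda>t. 2 * of_real pi * \<i> * (inverse (\<gamma> t) * g (\<gamma> t)))"
    proof (rule integral_cong)
      fix t :: real assume "t \<in> {0..1}"
      have "\<gamma> t \<noteq> 0" using \<rho> by (simp add: \<gamma>_def)
      moreover have "circlepath 0 \<rho> t = \<gamma> t"
        by (simp add: circlepath \<gamma>_def)
      moreover have "vector_derivative (circlepath 0 \<rho>) (at t) = 2 * of_real pi * \<i> * \<gamma> t"
        by (simp add: vector_derivative_circlepath \<gamma>_def)
      ultimately show "g (circlepath 0 \<rho> t) / (circlepath 0 \<rho> t - 0)^2 * vector_derivative (circlepath 0 \<rho>) (at t)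
          = 2 * of_real pi * \<i> * (inverse (\<gamma> t) * g (\<gamma> t))"
        by (simp add: power2_eq_square field_simps)
    qed
    then show ?thesis by (simp add: contour_integral_integral)
  qed
  also have "\<dots> = integral {0..1} (\<lambda>t. inverse (\<gamma> t) * g (\<gamma> t))"
    by simp
  finally show ?thesis by (simp add: g_def)
qed

lemma holo_fun_on_continuous: "holo_fun_on S h \<Longrightarrow> continuous_on S h"
  by (auto simp: holo_fun_on_def continuous_at_imp_continuous_on differentiable_imp_continuous_within)

text \<open>One circle has to serve all \<open>x\<close> near \<open>x0\<close>, so that the formula
  can be treated as an integral depending on the parameter \<open>x\<close>.\<close>

lemma holo_fun_on_local_Cauchy_derivative:
  fixes v :: "complex^'n"
  assumes S: "open S" and h: "holo_fun_on S h" and x0: "x0 \<in> S"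
  shows "\<exists>R>0. \<exists>\<gamma> :: real \<Rightarrow> complex. (\<forall>A. continuous_on A \<gamma>) \<and> (\<forall>t. \<gamma> t \<noteq> 0) \<and>
    (\<forall>x\<in>ball x0 R. (\<forall>t. x + \<gamma> t *s v \<in> S) \<and> FD h x v = integral {0..1} (\<lambda>t. inverse (\<gamma> t) * h (x + \<gamma> t *s v)))"
proof -
  obtain R where R: "R > 0" "ball x0 R \<subseteq> S" by (rule openE[OF S x0])
  \<comment> \<open>With this radius the circle moves a point by at most \<open>R / 2\<close>, so
    points of the ball of radius \<open>R / 2\<close> stay in the ball of radius
    \<open>R\<close>.\<close>
  define \<rho> where "\<rho> = R / (2 * (norm v + 1))"
  have \<rho>: "\<rho> > 0" using R by (auto simp: \<rho>_def intro!: divide_pos_pos add_nonneg_pos)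
  have sub: "x + \<zeta> *s v \<in> S" if "x \<in> ball x0 (R/2)" "norm \<zeta> \<le> \<rho>" for x \<zeta>
  proof -
    have "norm (\<zeta> *s v) \<le> \<rho> * norm v"
      using that by (simp add: norm_vector_scalar_mult mult_right_mono)
    also have "\<dots> \<le> \<rho> * (norm v + 1)" using \<rho> by simp
    also have "\<dots> = R / 2" by (simp add: \<rho>_def field_simps add_nonneg_eq_0_iff)
    finally have "norm (\<zeta> *s v) \<le> R / 2" .
    moreover have "dist x0 (x + \<zeta> *s v) \<le> dist x0 x + norm (\<zeta> *s v)"
      by (metis add_diff_cancel_left' dist_norm dist_commute dist_triangle)
    ultimately show ?thesis using that R(2) by auto
  qed
  define \<gamma> where "\<gamma> = (\<lambda>t::real. of_real \<rho> * exp (2 * of_real pi * \<i> * of_real t) :: complex)"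
  have "norm (\<gamma> t) \<le> \<rho>" "\<gamma> t \<noteq> 0" "continuous_on A \<gamma>" for t A
    using \<rho> by (auto simp: \<gamma>_def norm_mult intro!: continuous_intros)
  moreover have "FD h x v = integral {0..1} (\<lambda>t. inverse (\<gamma> t) * h (x + \<gamma> t *s v))" if "x \<in> ball x0 (R/2)" for x
    using holo_fun_on_Cauchy_derivative[OF h \<rho> sub[OF that]] by (simp add: \<gamma>_def)
  ultimately show ?thesis
    using R(1) sub
    by (intro exI[of _ "R/2"] exI[of _ \<gamma>] conjI ballI allI) auto
qed

text \<open>Cauchy's formula transfers regularity from \<open>h\<close> to its derivative:
  continuity of \<open>h\<close> makes the derivative continuous, and this continuity is what allows
  differentiation under the integral. Complex linearity of the new differential is inherited from
  the integrand.\<close>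

lemma holo_fun_on_FD_continuous_and_holo_fun_on:
  fixes h :: "complex^'n \<Rightarrow> complex"
  assumes S: "open S" and h: "holo_fun_on S h"
  shows "continuous_on S (\<lambda>x. FD h x v)" and "holo_fun_on S (\<lambda>x. FD h x v)"
proof -
  note scalar = bounded_linear.continuous_on[OF bounded_linear_vector_scalar_mult_left]
  have cont: "continuous_on S (\<lambda>x. FD h x v)" for v
  proof (rule continuous_at_imp_continuous_on, rule ballI)
    fix x0 assume "x0 \<in> S"
    from holo_fun_on_local_Cauchy_derivative[OF S h this, of v]
    obtain R and \<gamma> :: "real \<Rightarrow> complex" where R: "R > 0" and \<gamma>: "\<And>A. continuous_on A \<gamma>" "\<And>t. \<gamma> t \<noteq> 0"
      and sub: "\<And>x t. x \<in> ball x0 R \<Longrightarrow> x + \<gamma> t *s v \<in> S"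
      and formula: "\<And>x. x \<in> ball x0 R \<Longrightarrow> FD h x v = integral {0..1} (\<lambda>t. inverse (\<gamma> t) * h (x + \<gamma> t *s v))"
      by blast
    have "continuous_on (ball x0 R \<times> cbox 0 1) (\<lambda>(x, t). inverse (\<gamma> t) * h (x + \<gamma> t *s v))"
      unfolding case_prod_unfold
      by (intro continuous_intros continuous_on_compose2[OF \<gamma>(1)] continuous_on_compose2[OF holo_fun_on_continuous[OF h]] scalar)
         (use \<gamma> sub in auto)
    from integral_continuous_on_param[OF this]
    have "continuous_on (ball x0 R) (\<lambda>x. FD h x v)"
      by (rule continuous_on_eq) (simp add: formula)
    then show "isCont (\<lambda>x. FD h x v) x0"
      using R by (simp add: continuous_on_eq_continuous_at)
  qed
  then show "continuous_on S (\<lambda>x. FD h x v)" .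
  show "holo_fun_on S (\<lambda>x. FD h x v)"
    unfolding holo_fun_on_def
  proof
    fix x0 assume "x0 \<in> S"
    from holo_fun_on_local_Cauchy_derivative[OF S h this, of v]
    obtain R and \<gamma> :: "real \<Rightarrow> complex" where R: "R > 0" and \<gamma>: "\<And>A. continuous_on A \<gamma>" "\<And>t. \<gamma> t \<noteq> 0"
      and sub: "\<And>x t. x \<in> ball x0 R \<Longrightarrow> x + \<gamma> t *s v \<in> S"
      and formula: "\<And>x. x \<in> ball x0 R \<Longrightarrow> FD h x v = integral {0..1} (\<lambda>t. inverse (\<gamma> t) * h (x + \<gamma> t *s v))"
      by blast
    define D where "D = (\<lambda>x t u. inverse (\<gamma> t) * FD h (x + \<gamma> t *s v) u)"
    have D: "((\<lambda>x. integral {0..1} (\<lambda>t. inverse (\<gamma> t) * h (x + \<gamma> t *s v))) has_derivative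
         (\<lambda>u. integral {0..1} (\<lambda>t. D x0 t u))) (at x0)"
    proof (rule leibniz_unit_interval[where U = "ball x0 R"])
      fix x and t :: real assume "x \<in> ball x0 R"
      then have "h differentiable (at (x + \<gamma> t *s v))"
        using h sub by (auto simp: holo_fun_on_def)
      moreover have "((\<lambda>x. x + \<gamma> t *s v) has_derivative (\<lambda>u. u)) (at x)"
        by (auto intro!: derivative_eq_intros)
      ultimately have "((\<lambda>x. h (x + \<gamma> t *s v)) has_derivative FD h (x + \<gamma> t *s v)) (at x)"
        using has_derivative_compose FD_has by blast
      then show "((\<lambda>x. inverse (\<gamma> t) * h (x + \<gamma> t *s v)) has_derivative D x t) (at x)"
        unfolding D_def by (rule has_derivative_mult_right)
    next
      show "continuous_on (ball x0 R \<times> {0..1}) (\<lambda>(x, t). D x t u)" for u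
        unfolding D_def case_prod_unfold
        by (intro continuous_intros continuous_on_compose2[OF \<gamma>(1)] continuous_on_compose2[OF cont] scalar)
           (use \<gamma> sub in auto)
    next
      show "continuous_on {0..1} (\<lambda>t. inverse (\<gamma> t) * h (x + \<gamma> t *s v))" if "x \<in> ball x0 R" for x
        by (intro continuous_intros \<gamma> continuous_on_compose2[OF holo_fun_on_continuous[OF h]] scalar)
           (use \<gamma> sub that in auto)
    qed (use R in auto)
    have E: "((\<lambda>x. FD h x v) has_derivative (\<lambda>u. integral {0..1} (\<lambda>t. D x0 t u))) (at x0)"
      by (rule has_derivative_transform_within_open[OF D open_ball centre_in_ball[THEN iffD2, OF R]])
         (simp add: formula)
    have "integral {0..1} (\<lambda>t. D x0 t (c *s u)) = c * integral {0..1} (\<lambda>t. D x0 t u)" for c u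
    proof -
      have "D x0 t (c *s u) = c * D x0 t u" for t
        using h sub R by (auto simp: holo_fun_on_def D_def)
      then show ?thesis by simp
    qed
    then show "(\<lambda>x. FD h x v) differentiable (at x0) \<and>
        (\<forall>c u. FD (\<lambda>x. FD h x v) x0 (c *s u) = c * FD (\<lambda>x. FD h x v) x0 u)"
      using E by (auto simp: FD_eq[OF E] differentiable_def)
  qed
qed

lemma holo_fun_on_smooth: "open S \<Longrightarrow> holo_fun_on S h \<Longrightarrow> smooth_on S h"
proof -
  assume S: "open S" and "holo_fun_on S h"
  then have "Ck_on k S h" for k
  proof (induction k arbitrary: h)
    case 0
    then show ?case by (simp add: holo_fun_on_continuous)
  next
    case (Suc k)
    then show ?case using holo_fun_on_FD_continuous_and_holo_fun_on[OF S Suc.prems(2)] by (auto simp: holo_fun_on_def)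
  qed
  then show "smooth_on S h" by (simp add: smooth_on_def)
qed

section \<open>Passage from holomorphic functions to vector-valued holomorphic maps\<close>

lemma FD_vec_nth: "f differentiable (at x) \<Longrightarrow> FD (\<lambda>y. f y $ i) x v = FD f x v $ i"
  by (rule FD_bounded_linear[OF bounded_linear_vec_nth])

lemma differentiable_vec_nth_iff:
  fixes f :: "'a::euclidean_space \<Rightarrow> 'b::euclidean_space^'m"
  shows "f differentiable (at x) \<longleftrightarrow> (\<forall>i. (\<lambda>y. f y $ i) differentiable (at x))"
proof
  show "f differentiable at x \<Longrightarrow> \<forall>i. (\<lambda>y. f y $ i) differentiable at x"
    unfolding differentiable_def using bounded_linear.has_derivative[OF bounded_linear_vec_nth] by blast
next
  assume A: "\<forall>i. (\<lambda>y. f y $ i) differentiable (at x)"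
  show "f differentiable at x"
    unfolding differentiable_componentwise_within[of f]
  proof
    fix b :: "'b^'m" assume "b \<in> Basis"
    then obtain i c where b: "b = axis i c" by (auto simp: Basis_vec_def)
    have "(\<lambda>y. f y $ i \<bullet> c) differentiable (at x)"
      using A bounded_linear.has_derivative[OF bounded_linear_inner_left[of c]]
      unfolding differentiable_def by blast
    then show "(\<lambda>y. f y \<bullet> b) differentiable at x" by (simp add: b inner_axis)
  qed
qed

lemma smooth_on_vecI:
  fixes f :: "'a::euclidean_space \<Rightarrow> 'b::euclidean_space^'m"
  assumes "open S" "\<And>i. smooth_on S (\<lambda>x. f x $ i)"
  shows "smooth_on S f"
proof (rule smooth_on_componentwise[OF assms(1)])
  fix b :: "'b^'m" assume "b \<in> Basis"
  then obtain i c where b: "b = axis i c" by (auto simp: Basis_vec_def)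
  show "smooth_on S (\<lambda>x. f x \<bullet> b)"
    using smooth_on_bounded_linear[OF bounded_linear_inner_left assms(1,2), of i c] by (simp add: b inner_axis)
qed

lemma holo_on_iff_holo_fun_on: "holo_on S f \<longleftrightarrow> (\<forall>i. holo_fun_on S (\<lambda>x. f x $ i))"
proof
  assume "holo_on S f"
  then show "\<forall>i. holo_fun_on S (\<lambda>x. f x $ i)"
    unfolding holo_on_def holo_fun_on_def using differentiable_vec_nth_iff[of f] by (auto simp: FD_vec_nth)
next
  assume A: "\<forall>i. holo_fun_on S (\<lambda>x. f x $ i)"
  then have "f differentiable (at x)" if "x \<in> S" for x
    using differentiable_vec_nth_iff[of f] that by (auto simp: holo_fun_on_def)
  with A show "holo_on S f"
    unfolding holo_on_def holo_fun_on_def by (auto simp: vec_eq_iff FD_vec_nth)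
qed

lemma holo_on_smooth: "open S \<Longrightarrow> holo_on S f \<Longrightarrow> smooth_on S f"
  by (auto simp: holo_on_iff_holo_fun_on intro: smooth_on_vecI holo_fun_on_smooth)

lemma holo_on_FD:
  assumes "open S" "holo_on S f"
  shows "holo_on S (\<lambda>x. FD f x v)"
  unfolding holo_on_iff_holo_fun_on
proof
  fix i
  have "holo_fun_on S (\<lambda>x. FD (\<lambda>y. f y $ i) x v)"
    using assms holo_fun_on_FD_continuous_and_holo_fun_on(2) by (auto simp: holo_on_iff_holo_fun_on)
  moreover have "FD (\<lambda>y. f y $ i) x v = FD f x v $ i" if "x \<in> S" for x
    using assms that by (auto simp: holo_on_def FD_vec_nth)
  ultimately show "holo_fun_on S (\<lambda>x. FD f x v $ i)"
    unfolding holo_fun_on_def using differentiable_cong_open[OF assms(1)] FD_cong[OF assms(1)]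
    by (smt (verit, ccfv_SIG))
qed

section \<open>Integrable total linear systems\<close>

lemma linear_representation:
  fixes x :: "'a::euclidean_space"
  assumes "linear f"
  shows "f x = (\<Sum>b\<in>Basis. (x \<bullet> b) *\<^sub>R f b)"
  by (subst euclidean_representation[of x, symmetric])
     (simp only: linear_sum[OF assms] linear_cmul[OF assms])

text \<open>The field \<open>L\<close> is known only through its values on fixed vectors. Expansion
  in a basis turns \<open>L q (X q)\<close> into a finite sum of products, and the same expansion
  for the constant vector \<open>X p\<close> recognizes the first half of the product rule.\<close>

lemma has_derivative_linear_field:
  fixes L :: "'p::euclidean_space \<Rightarrow> 'a::euclidean_space \<Rightarrow> 'c::real_normed_vector"
  assumes S: "open S" "p \<in> S" and lin: "\<And>q. q \<in> S \<Longrightarrow> linear (L q)"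
    and d: "\<And>v. (\<lambda>q. L q v) differentiable (at p)" and X: "(X has_derivative X') (at p)"
  shows "((\<lambda>q. L q (X q)) has_derivative (\<lambda>w. FD (\<lambda>q. L q (X p)) p w + L p (X' w))) (at p)"
proof -
  define F where "F v = FD (\<lambda>q. L q v) p" for v
  have F: "((\<lambda>q. L q v) has_derivative F v) (at p)" for v
    unfolding F_def by (rule FD_has[OF d])
  have "((\<lambda>q. \<Sum>b\<in>Basis. (X q \<bullet> b) *\<^sub>R L q b) has_derivative
      (\<lambda>w. \<Sum>b\<in>Basis. (X p \<bullet> b) *\<^sub>R F b w + (X' w \<bullet> b) *\<^sub>R L p b)) (at p)"
    by (intro has_derivative_sum has_derivative_scaleR F has_derivative_inner_left X)
  then have D: "((\<lambda>q. L q (X q)) has_derivative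
      (\<lambda>w. \<Sum>b\<in>Basis. (X p \<bullet> b) *\<^sub>R F b w + (X' w \<bullet> b) *\<^sub>R L p b)) (at p)"
    by (rule has_derivative_transform_within_open[OF _ S])
       (simp add: linear_representation[OF lin, symmetric])
  have "((\<lambda>q. \<Sum>b\<in>Basis. (X p \<bullet> b) *\<^sub>R L q b) has_derivative (\<lambda>w. \<Sum>b\<in>Basis. (X p \<bullet> b) *\<^sub>R F b w)) (at p)"
    by (intro has_derivative_sum has_derivative_scaleR_right F)
  then have "((\<lambda>q. L q (X p)) has_derivative (\<lambda>w. \<Sum>b\<in>Basis. (X p \<bullet> b) *\<^sub>R F b w)) (at p)"
    by (rule has_derivative_transform_within_open[OF _ S])
       (simp add: linear_representation[OF lin, symmetric])
  then have "FD (\<lambda>q. L q (X p)) p w = (\<Sum>b\<in>Basis. (X p \<bullet> b) *\<^sub>R F b w)" for w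
    by (simp add: FD_eq)
  with D show ?thesis
    by (simp add: sum.distrib linear_representation[OF lin[OF S(2)], symmetric])
qed

lemma has_derivative_bilinear_field:
  fixes A :: "'p::euclidean_space \<Rightarrow> 'a::euclidean_space \<Rightarrow> 'b::euclidean_space \<Rightarrow> 'c::real_normed_vector"
  assumes S: "open S" "p \<in> S" and bil: "\<And>q. q \<in> S \<Longrightarrow> bilinear (A q)"
    and d: "\<And>u v. (\<lambda>q. A q u v) differentiable (at p)"
    and X: "(X has_derivative X') (at p)" and Y: "(Y has_derivative Y') (at p)"
  shows "((\<lambda>q. A q (X q) (Y q)) has_derivative
      (\<lambda>w. FD (\<lambda>q. A q (X p) (Y p)) p w + A p (X' w) (Y p) + A p (X p) (Y' w))) (at p)"
proof -
  have *: "((\<lambda>q. A q u (Y q)) has_derivative (\<lambda>w. FD (\<lambda>q. A q u (Y p)) p w + A p u (Y' w))) (at p)" for u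
    by (rule has_derivative_linear_field[OF S _ d Y]) (use bil in \<open>simp add: bilinear_def\<close>)
  have "((\<lambda>q. A q (X q) (Y q)) has_derivative (\<lambda>w. FD (\<lambda>q. A q (X p) (Y q)) p w + A p (X' w) (Y p))) (at p)"
    by (rule has_derivative_linear_field[where L = "\<lambda>q u. A q u (Y q)", OF S _ _ X])
       (use bil Derivative.differentiableI[OF *] in \<open>simp_all add: bilinear_def\<close>)
  then show ?thesis
    by (simp add: FD_eq[OF *] algebra_simps)
qed

lemma linear_FD_linear_field:
  fixes L :: "'p::euclidean_space \<Rightarrow> 'a::euclidean_space \<Rightarrow> 'c::real_normed_vector"
  assumes S: "open S" "p \<in> S" and lin: "\<And>q. q \<in> S \<Longrightarrow> linear (L q)"
    and d: "\<And>v. (\<lambda>q. L q v) differentiable (at p)"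
  shows "linear (\<lambda>v. FD (\<lambda>q. L q v) p w)"
proof (rule linearI)
  fix v v' :: 'a and r :: real
  have "((\<lambda>q. L q (v + v')) has_derivative (\<lambda>w. FD (\<lambda>q. L q v) p w + FD (\<lambda>q. L q v') p w)) (at p)"
    by (rule has_derivative_transform_within_open[OF has_derivative_add[OF FD_has[OF d] FD_has[OF d]] S])
       (simp add: linear_add[OF lin])
  then show "FD (\<lambda>q. L q (v + v')) p w = FD (\<lambda>q. L q v) p w + FD (\<lambda>q. L q v') p w"
    by (simp add: FD_eq)
  have "((\<lambda>q. L q (r *\<^sub>R v)) has_derivative (\<lambda>w. r *\<^sub>R FD (\<lambda>q. L q v) p w)) (at p)"
    by (rule has_derivative_transform_within_open[OF has_derivative_scaleR_right[OF FD_has[OF d]] S])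
       (simp add: linear_cmul[OF lin])
  then show "FD (\<lambda>q. L q (r *\<^sub>R v)) p w = r *\<^sub>R FD (\<lambda>q. L q v) p w"
    by (simp add: FD_eq)
qed

lemma continuous_on_linear_field:
  fixes L :: "'p::topological_space \<Rightarrow> 'a::euclidean_space \<Rightarrow> 'c::real_normed_vector"
  assumes "\<And>q. q \<in> S \<Longrightarrow> linear (L q)" "\<And>v. continuous_on S (\<lambda>q. L q v)" "continuous_on S X"
  shows "continuous_on S (\<lambda>q. L q (X q))"
proof (rule continuous_on_eq)
  show "continuous_on S (\<lambda>q. \<Sum>b\<in>Basis. (X q \<bullet> b) *\<^sub>R L q b)"
    by (intro continuous_intros assms)
qed (simp add: linear_representation[OF assms(1), symmetric])

lemma continuous_on_bilinear_field:
  fixes A :: "'p::topological_space \<Rightarrow> 'a::euclidean_space \<Rightarrow> 'b::euclidean_space \<Rightarrow> 'c::real_normed_vector"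
  assumes "\<And>q. q \<in> S \<Longrightarrow> bilinear (A q)" "\<And>u v. continuous_on S (\<lambda>q. A q u v)"
    "continuous_on S X" "continuous_on S Y"
  shows "continuous_on S (\<lambda>q. A q (X q) (Y q))"
  by (rule continuous_on_linear_field[OF _ continuous_on_linear_field[OF _ _ assms(4)] assms(3)])
     (use assms in \<open>auto simp: bilinear_def\<close>)

section \<open>Radial primitives and estimates for the Picard iteration\<close>

lemma radial_point_in_ball:
  fixes c x :: "'a::real_normed_vector"
  assumes "x \<in> ball c r" "t \<in> {0..1}"
  shows "c + t *\<^sub>R (x - c) \<in> ball c r"
proof -
  have "t * norm (x - c) \<le> 1 * norm (x - c)"
    using assms by (intro mult_right_mono) auto
  moreover have "norm (x - c) < r" using assms by (simp add: dist_norm norm_minus_commute)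
  ultimately show ?thesis using assms by (simp add: dist_norm)
qed

text \<open>This is the homotopy formula of the Poincare lemma. \<open>D y u v\<close> is the
  derivative at \<open>y\<close> of \<theta>(v) in direction \<open>u\<close>, so the integral on
  the right contains d\<theta>(v, x - c): the radial primitive has differential \<theta> up to a
  term that measures how far \<theta> is from closed.\<close>

lemma has_derivative_radial_integral:
  fixes \<theta> :: "'a::euclidean_space \<Rightarrow> 'a \<Rightarrow> 'e::banach"
  assumes x: "x \<in> ball c r"
    and lin: "\<And>y. y \<in> ball c r \<Longrightarrow> linear (\<theta> y)"
    and der: "\<And>y v. y \<in> ball c r \<Longrightarrow> ((\<lambda>q. \<theta> q v) has_derivative (\<lambda>u. D y u v)) (at y)"
    and cont: "\<And>u v. continuous_on (ball c r) (\<lambda>y. D y u v)"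
  shows "((\<lambda>x. integral {0..1} (\<lambda>t. \<theta> (c + t *\<^sub>R (x - c)) (x - c))) has_derivative
     (\<lambda>v. \<theta> x v + integral {0..1} (\<lambda>t. t *\<^sub>R (D (c + t *\<^sub>R (x - c)) v (x - c) - D (c + t *\<^sub>R (x - c)) (x - c) v)))) (at x)"
proof -
  let ?B = "ball c r"
  define y where "y x t = c + t *\<^sub>R (x - c)" for x :: 'a and t
  have y: "y x t \<in> ?B" if "x \<in> ?B" "t \<in> {0..1}" for x t
    unfolding y_def using that by (rule radial_point_in_ball)
  have diff: "(\<lambda>q. \<theta> q v) differentiable (at q)" if "q \<in> ?B" for q v
    using Derivative.differentiableI[OF der[OF that]] .
  have FDD: "FD (\<lambda>q. \<theta> q v) q u = D q u v" if "q \<in> ?B" for q u v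
    by (simp add: FD_eq[OF der[OF that]])
  have linD2: "linear (D q u)" if "q \<in> ?B" for q u
    using linear_FD_linear_field[where L = \<theta> and w = u, OF open_ball that lin diff[OF that]] by (simp add: FDD[OF that])
  have linD1: "linear (\<lambda>u. D q u v)" if "q \<in> ?B" for q v
    using der[OF that] has_derivative_linear by blast
  have cont\<theta>: "continuous_on ?B (\<lambda>q. \<theta> q v)" for v
    using der by (intro continuous_at_imp_continuous_on ballI has_derivative_continuous) blast
  have ycont: "continuous_on (?B \<times> {0..1}) (\<lambda>p. y (fst p) (snd p))"
    unfolding y_def by (intro continuous_intros)
  have ycont1: "continuous_on {0..1} (y x)" for x
    unfolding y_def by (intro continuous_intros)
  have contDy: "continuous_on (?B \<times> {0..1}) (\<lambda>p. D (y (fst p) (snd p)) u v)" for u v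
    by (rule continuous_on_compose2[OF cont ycont]) (use y in auto)
  have cont\<theta>y: "continuous_on (?B \<times> {0..1}) (\<lambda>p. \<theta> (y (fst p) (snd p)) v)" for v
    by (rule continuous_on_compose2[OF cont\<theta> ycont]) (use y in auto)
  have D1: "((\<lambda>x. integral {0..1} (\<lambda>t. \<theta> (y x t) (x - c))) has_derivative
      (\<lambda>v. integral {0..1} (\<lambda>t. t *\<^sub>R D (y x t) v (x - c) + \<theta> (y x t) v))) (at x)"
  proof (rule leibniz_unit_interval[where U = ?B])
    fix x t assume xt: "x \<in> ?B" "t \<in> {0..1::real}"
    note yt = y[OF xt]
    have yd: "((\<lambda>x. y x t) has_derivative (\<lambda>v. t *\<^sub>R v)) (at x)"
      unfolding y_def by (auto intro!: derivative_eq_intros)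
    have d\<theta>: "((\<lambda>x. \<theta> (y x t) v) has_derivative (\<lambda>u. D (y x t) (t *\<^sub>R u) v)) (at x)" for v
      using has_derivative_compose[OF yd der[OF yt]] by simp
    have "((\<lambda>x. \<theta> (y x t) (x - c)) has_derivative
        (\<lambda>w. FD (\<lambda>x'. \<theta> (y x' t) (x - c)) x w + \<theta> (y x t) w)) (at x)"
      by (rule has_derivative_linear_field[where L = "\<lambda>x. \<theta> (y x t)", OF open_ball xt(1)])
         (use Derivative.differentiableI[OF d\<theta>] y xt lin in \<open>auto intro!: derivative_eq_intros\<close>)
    then show "((\<lambda>x. \<theta> (y x t) (x - c)) has_derivative (\<lambda>v. t *\<^sub>R D (y x t) v (x - c) + \<theta> (y x t) v)) (at x)"
      by (simp add: FD_eq[OF d\<theta>] linear_cmul[OF linD1[OF yt]])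
  next
    fix v
    have "continuous_on (?B \<times> {0..1}) (\<lambda>p. D (y (fst p) (snd p)) v (fst p - c))"
    proof (rule continuous_on_linear_field[where L = "\<lambda>p. D (y (fst p) (snd p)) v", OF _ contDy])
      fix p assume "p \<in> ?B \<times> {0..1::real}"
      then show "linear (D (y (fst p) (snd p)) v)" by (intro linD2 y) auto
    qed (intro continuous_intros)
    then show "continuous_on (?B \<times> {0..1}) (\<lambda>(x, t). t *\<^sub>R D (y x t) v (x - c) + \<theta> (y x t) v)"
      unfolding case_prod_unfold by (intro continuous_intros cont\<theta>y)
  next
    fix x assume "x \<in> ?B"
    then show "continuous_on {0..1} (\<lambda>t. \<theta> (y x t) (x - c))"
      by (intro continuous_on_compose2[OF cont\<theta> ycont1]) (use y in auto)
  qed (use x in auto)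
  have "integral {0..1} (\<lambda>t. t *\<^sub>R D (y x t) v (x - c) + \<theta> (y x t) v)
     = \<theta> x v + integral {0..1} (\<lambda>t. t *\<^sub>R (D (y x t) v (x - c) - D (y x t) (x - c) v))" for v
  proof -
    have c1: "continuous_on {0..1} (\<lambda>t. D (y x t) u w)" for u w
      by (rule continuous_on_compose2[OF cont ycont1]) (use y x in auto)
    have c2: "continuous_on {0..1} (\<lambda>t. \<theta> (y x t) w)" for w
      by (rule continuous_on_compose2[OF cont\<theta> ycont1]) (use y x in auto)
    \<comment> \<open>Once the two arguments of \<open>D\<close> are exchanged, the integrand is the
      exact derivative of t \<theta>(v) along the ray, whose integral is the value at the end point
      \<open>x\<close>.\<close>
    have "((\<lambda>t. t *\<^sub>R D (y x t) (x - c) v + \<theta> (y x t) v) has_integral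
        1 *\<^sub>R \<theta> (y x 1) v - 0 *\<^sub>R \<theta> (y x 0) v) {0..1}"
    proof (rule fundamental_theorem_of_calculus)
      fix t :: real assume t: "t \<in> {0..1}"
      have yd: "((\<lambda>t. y x t) has_derivative (\<lambda>s. s *\<^sub>R (x - c))) (at t within {0..1})"
        unfolding y_def by (auto intro!: derivative_eq_intros)
      have "((\<lambda>t. \<theta> (y x t) v) has_derivative (\<lambda>s. s *\<^sub>R D (y x t) (x - c) v)) (at t within {0..1})"
        using has_derivative_compose[OF yd der[OF y[OF x t]]] linear_cmul[OF linD1[OF y[OF x t]]] by simp
      then have "((\<lambda>t. \<theta> (y x t) v) has_vector_derivative D (y x t) (x - c) v) (at t within {0..1})"
        by (simp add: has_vector_derivative_def)
      from has_vector_derivative_scaleR[OF DERIV_ident this]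
      show "((\<lambda>t. t *\<^sub>R \<theta> (y x t) v) has_vector_derivative t *\<^sub>R D (y x t) (x - c) v + \<theta> (y x t) v)
          (at t within {0..1})" by simp
    qed simp
    then have "integral {0..1} (\<lambda>t. t *\<^sub>R D (y x t) (x - c) v + \<theta> (y x t) v) = \<theta> x v"
      by (simp add: y_def integral_unique)
    moreover have "integral {0..1} (\<lambda>t. t *\<^sub>R D (y x t) v (x - c) + \<theta> (y x t) v)
      = integral {0..1} (\<lambda>t. t *\<^sub>R D (y x t) (x - c) v + \<theta> (y x t) v)
        + integral {0..1} (\<lambda>t. t *\<^sub>R (D (y x t) v (x - c) - D (y x t) (x - c) v))"
      by (subst integral_add[symmetric])
         (auto intro!: integrable_continuous_real continuous_intros c1 c2 integral_cong simp: algebra_simps)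
    ultimately show ?thesis by simp
  qed
  then show ?thesis using D1 by (simp add: y_def)
qed

text \<open>Compactness bounds the finitely many basis coefficients. The summand 1 in
  \<open>C\<close> makes the constant positive, as it will be divided by.\<close>

lemma bilinear_field_bound:
  fixes A :: "'p::topological_space \<Rightarrow> 'a::euclidean_space \<Rightarrow> 'b::euclidean_space \<Rightarrow> 'c::real_normed_vector"
  assumes K: "compact K" and bil: "\<And>q. q \<in> K \<Longrightarrow> bilinear (A q)"
    and cont: "\<And>u v. continuous_on K (\<lambda>q. A q u v)"
  shows "\<exists>C>0. \<forall>q\<in>K. \<forall>u v. norm (A q u v) \<le> C * norm u * norm v"
proof -
  have "\<exists>M. \<forall>q\<in>K. norm (A q i j) \<le> M" for i j
  proof -
    have "bounded ((\<lambda>q. A q i j) ` K)"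
      by (intro compact_imp_bounded compact_continuous_image cont K)
    then show ?thesis by (auto simp: bounded_iff)
  qed
  then obtain M where M: "\<And>i j q. q \<in> K \<Longrightarrow> norm (A q i j) \<le> M i j" by metis
  define C where "C = 1 + (\<Sum>i\<in>Basis. \<Sum>j\<in>Basis. \<bar>M i j\<bar>)"
  have "C > 0" unfolding C_def by (intro add_pos_nonneg sum_nonneg) auto
  moreover have "norm (A q u v) \<le> C * norm u * norm v" if q: "q \<in> K" for q u v
  proof -
    have "A q u v = (\<Sum>i\<in>Basis. (u \<bullet> i) *\<^sub>R A q i v)"
      by (rule linear_representation[where f = "\<lambda>u. A q u v"]) (use bil[OF q] in \<open>simp add: bilinear_def\<close>)
    also have "\<dots> = (\<Sum>i\<in>Basis. (u \<bullet> i) *\<^sub>R (\<Sum>j\<in>Basis. (v \<bullet> j) *\<^sub>R A q i j))"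
      by (subst linear_representation[of "A q _" v]) (use bil[OF q] in \<open>simp_all add: bilinear_def\<close>)
    also have "norm \<dots> \<le> (\<Sum>i\<in>Basis. norm u * (\<Sum>j\<in>Basis. norm v * \<bar>M i j\<bar>))"
    proof (intro sum_norm_le)
      fix i :: 'a assume i: "i \<in> Basis"
      have "norm (\<Sum>j\<in>Basis. (v \<bullet> j) *\<^sub>R A q i j) \<le> (\<Sum>j\<in>Basis. norm v * \<bar>M i j\<bar>)"
      proof (intro sum_norm_le)
        fix j :: 'b assume "j \<in> Basis"
        then show "norm ((v \<bullet> j) *\<^sub>R A q i j) \<le> norm v * \<bar>M i j\<bar>"
          using M[OF q, of i j] by (auto simp: Basis_le_norm intro!: mult_mono)
      qed
      then show "norm ((u \<bullet> i) *\<^sub>R (\<Sum>j\<in>Basis. (v \<bullet> j) *\<^sub>R A q i j)) \<le> norm u * (\<Sum>j\<in>Basis. norm v * \<bar>M i j\<bar>)"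
        using i by (auto simp: Basis_le_norm intro!: mult_mono)
    qed
    also have "\<dots> = (\<Sum>i\<in>Basis. \<Sum>j\<in>Basis. \<bar>M i j\<bar>) * (norm u * norm v)"
      by (simp add: sum_distrib_left sum_distrib_right mult_ac)
    also have "\<dots> \<le> C * (norm u * norm v)"
      unfolding C_def by (intro mult_right_mono) auto
    finally show ?thesis by (simp add: mult.assoc)
  qed
  ultimately show ?thesis by blast
qed

text \<open>The geometric tail sums to \<open>8/7\<close> of its first term; 2 is a convenient upper
  bound. The ratio \<open>1/8\<close> is the contraction factor of the Picard iteration
  below.\<close>

lemma convergent_geometric_increments:
  fixes f :: "nat \<Rightarrow> 'a::banach"
  assumes "\<And>k. norm (f (Suc k) - f k) \<le> M * (1/8)^k"
  shows "\<exists>l. f \<longlonglongrightarrow> l \<and> (\<forall>k. norm (l - f k) \<le> 2 * M * (1/8)^k)"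
proof -
  have M: "M \<ge> 0" using order_trans[OF norm_ge_zero assms[of 0]] by simp
  have 1: "norm (f (k + n) - f k) \<le> 2 * M * ((1/8)^k - (1/8)^(k+n))" for k n
  proof (induction n)
    case (Suc n)
    have "norm (f (k + Suc n) - f k) \<le> norm (f (Suc (k + n)) - f (k + n)) + norm (f (k + n) - f k)"
      by (metis add_Suc_right diff_add_cancel diff_add_eq norm_triangle_ineq add_diff_eq)
    also have "\<dots> \<le> M * (1/8)^(k+n) + 2 * M * ((1/8)^k - (1/8)^(k+n))"
      using assms[of "k+n"] Suc by simp
    also have "\<dots> \<le> 2 * M * ((1/8)^k - (1/8)^(k + Suc n))"
      using M by (simp add: field_simps)
    finally show ?case .
  qed simp
  have 2: "norm (f (k + n) - f k) \<le> 2 * M * (1/8)^k" for k n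
    using 1[of k n] M by (smt (verit) mult_left_mono zero_le_power zero_le_divide_1_iff)
  have lim: "(\<lambda>k. 2 * M * (1/8)^k) \<longlonglongrightarrow> 0"
    by (intro tendsto_mult_right_zero LIMSEQ_realpow_zero) auto
  have "Cauchy f"
  proof (rule metric_CauchyI)
    fix e :: real assume "e > 0"
    then have "\<forall>\<^sub>F k in sequentially. 2 * M * (1/8)^k < e / 2"
      by (intro order_tendstoD[OF lim]) simp
    then obtain N where N: "2 * M * (1/8)^N < e / 2" by (auto simp: eventually_sequentially)
    have "dist (f m) (f N) < e / 2" if "m \<ge> N" for m
      using 2[of N "m - N"] N that by (simp add: dist_norm)
    then show "\<exists>N. \<forall>m\<ge>N. \<forall>n\<ge>N. dist (f m) (f n) < e"
      by (intro exI[of _ N] allI impI) (metis dist_triangle_half_l)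
  qed
  then obtain l where l: "f \<longlonglongrightarrow> l" using Cauchy_convergent_iff convergent_def by metis
  have "norm (l - f k) \<le> 2 * M * (1/8)^k" for k
  proof (rule LIMSEQ_le_const2)
    show "(\<lambda>n. norm (f (k + n) - f k)) \<longlonglongrightarrow> norm (l - f k)"
      by (intro tendsto_intros) (use LIMSEQ_ignore_initial_segment[OF l, of k] in \<open>simp add: add.commute\<close>)
  qed (use 2 in blast)
  then show ?thesis using l by blast
qed

lemma norm_integral_unit_le:
  fixes f :: "real \<Rightarrow> 'a::euclidean_space"
  assumes "continuous_on {0..1} f" "\<And>t. t \<in> {0..1} \<Longrightarrow> norm (f t) \<le> B"
  shows "norm (integral {0..1} f) \<le> B"
  using integral_bound[of 0 1 f B] assms by simp

text \<open>The defect \<open>D a\<^sub>k - A(\<cdot>, a\<^sub>k)\<close> of the Picard iterates \<open>a\<^sub>k\<close> along rays satisfies, by integrability, a linear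
  recursion without derivatives; on a small ball it contracts to zero uniformly, and so the
  derivatives of the iterates converge.\<close>

theorem total_linear_system:
  fixes A :: "'a::euclidean_space \<Rightarrow> 'a \<Rightarrow> 'e::euclidean_space \<Rightarrow> 'e"
  assumes S: "open S" "c \<in> S"
    and bil: "\<And>x. x \<in> S \<Longrightarrow> bilinear (A x)"
    and C1: "\<And>v e. Ck_on 1 S (\<lambda>x. A x v e)"
    and integrable: "\<And>x u v e. x \<in> S \<Longrightarrow>
      FD (\<lambda>q. A q v e) x u + A x v (A x u e) = FD (\<lambda>q. A q u e) x v + A x u (A x v e)"
  obtains r where "r > 0" "ball c r \<subseteq> S"
    "\<And>e. \<exists>a. a c = e \<and> (\<forall>x\<in>ball c r. (a has_derivative (\<lambda>v. A x v (a x))) (at x))"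
proof -
  obtain r0 where r0: "r0 > 0" "cball c r0 \<subseteq> S"
    using open_contains_cball_eq[OF S(1)] S(2) by blast
  have contA: "continuous_on S (\<lambda>q. A q u v)" for u v
    using Ck_on_Suc_D[OF C1[unfolded One_nat_def]] by simp
  have dA: "(\<lambda>q. A q u v) differentiable (at x)" if "x \<in> S" for u v x
    using C1[of u v] that by simp
  have contDA: "continuous_on S (\<lambda>x. FD (\<lambda>q. A q u v) x w)" for u v w
    using C1[of u v] by simp
  have bilK: "bilinear (A q)" if "q \<in> cball c r0" for q using bil r0(2) that by blast
  obtain C where C: "C > 0" and bound: "\<And>q u v. q \<in> cball c r0 \<Longrightarrow> norm (A q u v) \<le> C * norm u * norm v"
    using bilinear_field_bound[OF compact_cball bilK continuous_on_subset[OF contA r0(2)]] by blast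
  \<comment> \<open>This gives \<open>C * r \<le> 1/8\<close>. The iterates then contract by
    \<open>1/8\<close>, and each of the two terms in the defect recursion contributes
    \<open>1/8\<close>.\<close>
  define r where "r = min r0 (1 / (8 * C))"
  have r: "r > 0" "C * r \<le> 1/8"
    using r0 C by (auto simp: r_def min_def field_simps)
  let ?B = "ball c r"
  have B0: "?B \<subseteq> cball c r0" by (auto simp: r_def)
  have BS: "?B \<subseteq> S" using B0 r0 by blast
  have bilB: "bilinear (A x)" if "x \<in> ?B" for x using bil BS that by blast
  define y where "y x t = c + t *\<^sub>R (x - c)" for x :: 'a and t
  have y: "y x t \<in> ?B" if "x \<in> ?B" "t \<in> {0..1}" for x t
    unfolding y_def using that by (rule radial_point_in_ball)
  have ycont: "continuous_on (?B \<times> cbox 0 1) (\<lambda>p. y (fst p) (snd p))"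
    unfolding y_def by (intro continuous_intros)
  have ycont1: "continuous_on {0..1} (y x)" for x
    unfolding y_def by (intro continuous_intros)
  have boundB: "norm (A x u v) \<le> C * norm u * norm v" if "x \<in> ?B" for x u v
    using bound B0 that by blast
  have boundr: "norm (A q (x - c) v) \<le> 1/8 * norm v" if "x \<in> ?B" "q \<in> ?B" for x q v
  proof -
    have "norm (A q (x - c) v) \<le> C * norm (x - c) * norm v" by (rule boundB[OF that(2)])
    also have "\<dots> \<le> C * r * norm v"
      using that C by (intro mult_right_mono mult_left_mono) (auto simp: dist_norm norm_minus_commute)
    also have "\<dots> \<le> 1/8 * norm v" using r by (intro mult_right_mono) auto
    finally show ?thesis .
  qed
  have "\<exists>a. a c = e \<and> (\<forall>x\<in>?B. (a has_derivative (\<lambda>v. A x v (a x))) (at x))" for e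
  proof -
    define a where "a = rec_nat (\<lambda>_. e) (\<lambda>_ b x. e + integral {0..1} (\<lambda>t. A (y x t) (x - c) (b (y x t))))"
    have a0: "a 0 = (\<lambda>_. e)"
      and aS: "a (Suc k) = (\<lambda>x. e + integral {0..1} (\<lambda>t. A (y x t) (x - c) (a k (y x t))))" for k
      by (simp_all add: a_def)
    define E where "E k x v = FD (a k) x v - A x v (a k x)" for k x v
    define I where "I k x v t = t *\<^sub>R (A (y x t) (x - c) (E k (y x t) v) - A (y x t) v (E k (y x t) (x - c)))" for k x v t
    have bil_diff: "A q u v - A q u w = A q u (v - w)"
      if "q \<in> ?B" for q u v w
      using bilB[OF that] by (simp add: bilinear_rsub)
    \<comment> \<open>The formula for the radial primitive needs a continuous derivative of the
      integrand, so continuous differentiability has to be carried from each iterate to the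
      next.\<close>
    define C1k where "C1k k \<longleftrightarrow> (\<forall>x\<in>?B. a k differentiable (at x)) \<and> (\<forall>v. continuous_on ?B (\<lambda>x. FD (a k) x v))" for k
    have step: "C1k (Suc k) \<and>
        (\<forall>x\<in>?B. \<forall>v. FD (a (Suc k)) x v = A x v (a k x) + integral {0..1} (I k x v)) \<and>
        (\<forall>x\<in>?B. \<forall>v. continuous_on {0..1} (I k x v))"
      if C1: "C1k k" for k
    proof -
      have C1k: "\<forall>x\<in>?B. a k differentiable (at x)" "\<And>v. continuous_on ?B (\<lambda>x. FD (a k) x v)"
        using C1 by (simp_all add: C1k_def)
      have conta: "continuous_on ?B (a k)"
        using C1k(1) by (simp add: continuous_at_imp_continuous_on differentiable_imp_continuous_within)
      have lina: "linear (FD (a k) x)" if "x \<in> ?B" for x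
        using C1k(1) that by (simp add: linear_frechet_derivative)
      have linA1: "linear (\<lambda>v. A x v w)" "linear (A x v)" if "x \<in> ?B" for x v w
        using bilB[OF that] by (simp_all add: bilinear_def)
      have contAB: "continuous_on ?B (\<lambda>q. A q u v)" for u v
        using contA BS continuous_on_subset by blast
      have contAa: "continuous_on ?B (\<lambda>q. A q v (X q))" if "continuous_on ?B X" for v and X :: "'a \<Rightarrow> 'e"
        by (rule continuous_on_linear_field[OF linA1(2) contAB that])
      have contE: "continuous_on ?B (\<lambda>q. E k q v)" for v
        unfolding E_def by (intro continuous_intros C1k(2) contAa conta)
      have linE: "linear (E k q)" if "q \<in> ?B" for q
        unfolding E_def using lina[OF that] linA1(1)[OF that] by (intro linear_compose_sub)
      define D where "D q u v = FD (\<lambda>q'. A q' v (a k q)) q u + A q v (FD (a k) q u)" for q u v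
      have dD: "((\<lambda>q. A q v (a k q)) has_derivative (\<lambda>u. D q u v)) (at q)" if "q \<in> ?B" for q v
        unfolding D_def
        by (rule has_derivative_linear_field[OF open_ball that])
           (use linA1 dA BS that C1k(1) in \<open>auto intro!: FD_has\<close>)
      have contD: "continuous_on ?B (\<lambda>q. D q u v)" for u v
      proof -
        have "continuous_on ?B (\<lambda>q. FD (\<lambda>q'. A q' v (a k q)) q u)"
        proof (rule continuous_on_linear_field[where L = "\<lambda>q e. FD (\<lambda>q'. A q' v e) q u", OF _ _ conta])
          show "linear (\<lambda>e. FD (\<lambda>q'. A q' v e) q u)" if "q \<in> ?B" for q
            by (rule linear_FD_linear_field[OF open_ball that]) (use linA1 dA BS that in auto)
          show "continuous_on ?B (\<lambda>q. FD (\<lambda>q'. A q' v e) q u)" for e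
            using contDA BS continuous_on_subset by blast
        qed
        then show ?thesis unfolding D_def by (intro continuous_intros contAa C1k(2))
      qed
      have der: "(a (Suc k) has_derivative (\<lambda>v. A x v (a k x) + integral {0..1} (I k x v))) (at x)"
        if x: "x \<in> ?B" for x
      proof -
        \<comment> \<open>Integrability cancels the derivatives of \<open>A\<close>. What is left of
          the curl of \<open>A(., a k)\<close> depends on the defect \<open>E k\<close> alone; this
          is why the integrand \<open>I\<close> contains no derivative of \<open>A\<close>.\<close>
        have "D q v w - D q w v = A q w (E k q v) - A q v (E k q w)" if "q \<in> ?B" for q v w
        proof -
          have "FD (\<lambda>q'. A q' w (a k q)) q v + A q w (A q v (a k q)) = FD (\<lambda>q'. A q' v (a k q)) q w + A q v (A q w (a k q))"
            using integrable BS that by blast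
          then show ?thesis
            unfolding D_def E_def by (simp add: bil_diff[OF that, symmetric] algebra_simps)
        qed
        then have eq: "integral {0..1} (\<lambda>t. t *\<^sub>R (D (y x t) v (x - c) - D (y x t) (x - c) v)) =
            integral {0..1} (I k x v)" for v
          using y[OF x] by (intro integral_cong) (simp add: I_def)
        have "((\<lambda>x. integral {0..1} (\<lambda>t. A (y x t) (x - c) (a k (y x t)))) has_derivative
          (\<lambda>v. A x v (a k x) + integral {0..1} (\<lambda>t. t *\<^sub>R (D (y x t) v (x - c) - D (y x t) (x - c) v)))) (at x)"
          unfolding y_def
          by (rule has_derivative_radial_integral[where \<theta> = "\<lambda>q v. A q v (a k q)", OF x linA1(1) dD contD])
        from has_derivative_add[OF has_derivative_const[of e] this] show ?thesis
          unfolding aS eq by simp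
      qed
      have contI: "continuous_on (?B \<times> cbox 0 1) (\<lambda>(x, t). I k x v t)" for v
      proof -
        let ?P = "?B \<times> cbox 0 (1::real)"
        have y': "y (fst p) (snd p) \<in> ?B" if "p \<in> ?P" for p using that by (intro y) auto
        have cA: "continuous_on ?P (\<lambda>p. A (y (fst p) (snd p)) u w)" for u w
          by (rule continuous_on_compose2[OF contAB ycont]) (use y' in auto)
        have cE: "continuous_on ?P (\<lambda>p. E k (y (fst p) (snd p)) w)" for w
          by (rule continuous_on_compose2[OF contE ycont]) (use y' in auto)
        have "continuous_on ?P (\<lambda>p. E k (y (fst p) (snd p)) (fst p - c))"
          by (rule continuous_on_linear_field[where L = "\<lambda>p. E k (y (fst p) (snd p))", OF linE[OF y'] cE])
             (auto intro!: continuous_intros)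
        from continuous_on_linear_field[where L = "\<lambda>p. A (y (fst p) (snd p)) v", OF linA1(2)[OF y'] cA this]
        have 1: "continuous_on ?P (\<lambda>p. A (y (fst p) (snd p)) v (E k (y (fst p) (snd p)) (fst p - c)))" .
        have "continuous_on ?P (\<lambda>p. A (y (fst p) (snd p)) (fst p - c) (E k (y (fst p) (snd p)) v))"
          by (rule continuous_on_bilinear_field[where A = "\<lambda>p. A (y (fst p) (snd p))", OF bilB[OF y'] cA _ cE])
             (auto intro!: continuous_intros)
        with 1 show ?thesis unfolding case_prod_unfold I_def by (intro continuous_intros)
      qed
      have FDa: "FD (a (Suc k)) x v = A x v (a k x) + integral {0..1} (I k x v)" if "x \<in> ?B" for x v
        by (simp add: FD_eq[OF der[OF that]])
      have cFD: "continuous_on ?B (\<lambda>x. FD (a (Suc k)) x v)" for v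
      proof (rule continuous_on_eq)
        show "continuous_on ?B (\<lambda>x. A x v (a k x) + integral (cbox 0 1) (I k x v))"
          by (intro continuous_on_add contAa conta integral_continuous_on_param contI)
      qed (simp add: FDa)
      have cI1: "continuous_on {0..1} (I k x v)" if "x \<in> ?B" for x v
      proof -
        have "continuous_on {0..1} (\<lambda>t. (\<lambda>(x, t). I k x v t) (x, t))"
          by (rule continuous_on_compose2[OF contI]) (use that in \<open>auto intro!: continuous_intros\<close>)
        then show ?thesis by simp
      qed
      from der FDa cFD cI1 show ?thesis
        unfolding C1k_def using Derivative.differentiableI by blast
    qed
    have C1a: "C1k k" for k
      by (induction k) (use step in \<open>auto simp: C1k_def a0\<close>)
    have rec: "FD (a (Suc k)) x v = A x v (a k x) + integral {0..1} (I k x v)"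
      and contE: "continuous_on {0..1} (I k x v)" if "x \<in> ?B" for k x v
      using step[OF C1a] that by blast+
    define M where "M = norm e"
    have conta: "continuous_on ?B (a k)" for k
      using C1a[of k] unfolding C1k_def by (simp add: continuous_at_imp_continuous_on differentiable_imp_continuous_within)
    have contint: "continuous_on {0..1} (\<lambda>t. A (y x t) (x - c) (a k (y x t)))" if x: "x \<in> ?B" for x k
    proof (rule continuous_on_linear_field[where L = "\<lambda>t. A (y x t) (x - c)"])
      show "linear (A (y x t) (x - c))" if "t \<in> {0..1}" for t
        using bilB[OF y[OF x that]] by (simp add: bilinear_def)
      show "continuous_on {0..1} (\<lambda>t. A (y x t) (x - c) v)" for v
        by (rule continuous_on_compose2[OF contA ycont1]) (use y[OF x] BS in blast)
      show "continuous_on {0..1} (\<lambda>t. a k (y x t))"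
        by (rule continuous_on_compose2[OF conta ycont1]) (use y[OF x] in blast)
    qed
    have incr: "norm (a (Suc k) x - a k x) \<le> M * (1/8)^k" if "x \<in> ?B" for k x
      using that
    proof (induction k arbitrary: x)
      case 0
      have "norm (integral {0..1} (\<lambda>t. A (y x t) (x - c) (a 0 (y x t)))) \<le> 1/8 * norm e"
        by (intro norm_integral_unit_le contint 0) (use boundr[OF 0 y[OF 0]] in \<open>auto simp: a0\<close>)
      also have "\<dots> \<le> M" by (simp add: M_def)
      finally show ?case by (simp add: aS) (simp add: a0)
    next
      case (Suc k)
      have "a (Suc (Suc k)) x - a (Suc k) x = integral {0..1} (\<lambda>t. A (y x t) (x - c) (a (Suc k) (y x t)))
          - integral {0..1} (\<lambda>t. A (y x t) (x - c) (a k (y x t)))"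
        by (simp add: aS[of "Suc k"] aS[of k])
      also have "\<dots> = integral {0..1} (\<lambda>t. A (y x t) (x - c) (a (Suc k) (y x t)) - A (y x t) (x - c) (a k (y x t)))"
        by (intro integral_diff[symmetric] integrable_continuous_real contint Suc.prems)
      also have "norm \<dots> \<le> 1/8 * (M * (1/8)^k)"
      proof (intro norm_integral_unit_le continuous_intros contint Suc.prems)
        fix t :: real assume t: "t \<in> {0..1}"
        note yt = y[OF Suc.prems t]
        have "norm (A (y x t) (x - c) (a (Suc k) (y x t)) - A (y x t) (x - c) (a k (y x t)))
          \<le> 1/8 * norm (a (Suc k) (y x t) - a k (y x t))"
          unfolding bil_diff[OF yt] by (rule boundr[OF Suc.prems yt])
        also have "\<dots> \<le> 1/8 * (M * (1/8)^k)" using Suc.IH[OF yt] by simp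
        finally show "norm (A (y x t) (x - c) (a (Suc k) (y x t)) - A (y x t) (x - c) (a k (y x t)))
          \<le> 1/8 * (M * (1/8)^k)" .
      qed
      finally show ?case by simp
    qed
    \<comment> \<open>With this choice the term \<open>C * norm v * M\<close> equals a quarter of
      \<open>K * norm v\<close>. Together with the quarter from the integral of \<open>I\<close>,
      the defect is halved in each step.\<close>
    define K where "K = 4 * C * M"
    have KM: "M \<ge> 0" "K \<ge> 0" using C by (simp_all add: M_def K_def)
    have defect: "norm (E k x v) \<le> K * (1/2)^k * norm v" if "x \<in> ?B" for k x v
      using that
    proof (induction k arbitrary: x v)
      case 0
      have "norm (E 0 x v) \<le> C * norm v * M"
        using boundB[OF 0, of v e] by (simp add: E_def a0 M_def)
      also have "\<dots> \<le> K * (1/2)^0 * norm v"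
        using C KM by (simp add: K_def mult_ac)
      finally show ?case .
    next
      case (Suc k)
      let ?I = "integral {0..1} (I k x v)"
      have "norm ?I \<le> K * (1/2)^k * norm v / 4"
      proof (intro norm_integral_unit_le contE Suc.prems)
        fix t :: real assume t: "t \<in> {0..1}"
        note yt = y[OF Suc.prems t]
        have 1: "norm (A (y x t) (x - c) (E k (y x t) v)) \<le> 1/8 * (K * (1/2)^k * norm v)"
          using boundr[OF Suc.prems yt, of "E k (y x t) v"] Suc.IH[OF yt, of v] by simp
        have "norm (A (y x t) v (E k (y x t) (x - c))) \<le> C * norm v * (K * (1/2)^k * norm (x - c))"
          using boundB[OF yt, of v "E k (y x t) (x - c)"] Suc.IH[OF yt, of "x - c"] C
          by (smt (verit) mult_left_mono norm_ge_zero mult_nonneg_nonneg)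
        also have "\<dots> \<le> C * norm v * (K * (1/2)^k * r)"
          using Suc.prems C KM by (intro mult_left_mono) (auto simp: dist_norm norm_minus_commute)
        also have "\<dots> = (C * r) * (K * (1/2)^k * norm v)" by simp
        also have "\<dots> \<le> 1/8 * (K * (1/2)^k * norm v)"
          using r KM by (intro mult_right_mono) auto
        finally have 2: "norm (A (y x t) v (E k (y x t) (x - c))) \<le> 1/8 * (K * (1/2)^k * norm v)" .
        have "norm (I k x v t) \<le> 1 * norm (A (y x t) (x - c) (E k (y x t) v) - A (y x t) v (E k (y x t) (x - c)))"
          using t unfolding I_def norm_scaleR by (intro mult_right_mono) auto
        also have "\<dots> \<le> norm (A (y x t) (x - c) (E k (y x t) v)) + norm (A (y x t) v (E k (y x t) (x - c)))"
          using norm_triangle_ineq4 by auto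
        finally show "norm (I k x v t) \<le> K * (1/2)^k * norm v / 4" using 1 2 by simp
      qed
      moreover have "norm (A x v (a (Suc k) x - a k x)) \<le> C * norm v * (M * (1/2)^k)"
      proof -
        \<comment> \<open>The increments shrink faster than needed; they are weakened to the slower
          rate of the defect so that the two contributions can be added.\<close>
        have "(1/8::real)^k \<le> (1/2)^k" by (intro power_mono) auto
        then have "M * (1/8)^k \<le> M * (1/2)^k" using KM by (intro mult_left_mono)
        then have "norm (a (Suc k) x - a k x) \<le> M * (1/2)^k" using incr[OF Suc.prems, of k] by simp
        then show ?thesis
          using boundB[OF Suc.prems, of v "a (Suc k) x - a k x"] C
          by (smt (verit) mult_left_mono norm_ge_zero mult_nonneg_nonneg)
      qed
      moreover have "E (Suc k) x v = ?I - A x v (a (Suc k) x - a k x)"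
        unfolding E_def[of "Suc k"] rec[OF Suc.prems] bil_diff[OF Suc.prems, symmetric] by simp
      ultimately have "norm (E (Suc k) x v) \<le> K * (1/2)^k * norm v / 4 + C * norm v * (M * (1/2)^k)"
        using norm_triangle_ineq4[of ?I "A x v (a (Suc k) x - a k x)"] by simp
      also have "\<dots> = K * (1/2)^(Suc k) * norm v" by (simp add: K_def)
      finally show ?case .
    qed
    have "\<forall>x\<in>?B. \<exists>l. (\<lambda>k. a k x) \<longlonglongrightarrow> l \<and> (\<forall>k. norm (l - a k x) \<le> 2 * M * (1/8)^k)"
      by (intro ballI convergent_geometric_increments incr)
    then obtain L where L: "\<And>x. x \<in> ?B \<Longrightarrow> (\<lambda>k. a k x) \<longlonglongrightarrow> L x"
      "\<And>x k. x \<in> ?B \<Longrightarrow> norm (L x - a k x) \<le> 2 * M * (1/8)^k" by metis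
    \<comment> \<open>Uniform convergence of the derivatives passes differentiability to the limit.
      The defects tend to zero, so the limit of the derivatives is \<open>A x v (L x)\<close>, which
      is the equation to be solved.\<close>
    have "\<exists>g. \<forall>x\<in>?B. (\<lambda>n. a n x) \<longlonglongrightarrow> g x \<and> (g has_derivative (\<lambda>v. A x v (L x))) (at x within ?B)"
    proof (rule has_derivative_sequence[where f' = "\<lambda>n x v. FD (a n) x v"])
      show "(a n has_derivative FD (a n) x) (at x within ?B)" if "x \<in> ?B" for n x
        by (rule has_derivative_at_withinI[OF FD_has[OF C1a[unfolded C1k_def, THEN conjunct1, rule_format, OF that]]])
      show "c \<in> ?B" using r by simp
      then show "(\<lambda>n. a n c) \<longlonglongrightarrow> L c" by (rule L(1))
      fix d :: real assume d: "d > 0"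
      have "(\<lambda>n. (K + 2 * C * M) * (1/2)^n) \<longlonglongrightarrow> 0"
        by (intro tendsto_mult_right_zero LIMSEQ_realpow_zero) auto
      then have "\<forall>\<^sub>F n in sequentially. (K + 2 * C * M) * (1/2)^n < d"
        using d by (rule order_tendstoD)
      then show "\<forall>\<^sub>F n in sequentially. \<forall>x\<in>?B. \<forall>h. norm (FD (a n) x h - A x h (L x)) \<le> d * norm h"
      proof eventually_elim
        case (elim n)
        have "norm (FD (a n) x h - A x h (L x)) \<le> d * norm h" if x: "x \<in> ?B" for x h
        proof -
          have "(1/8::real)^n \<le> (1/2)^n" by (intro power_mono) auto
          then have "2 * M * (1/8)^n \<le> 2 * M * (1/2)^n" using KM by (intro mult_left_mono) auto
          then have "norm (L x - a n x) \<le> 2 * M * (1/2)^n" using L(2)[OF x, of n] by simp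
          then have 1: "norm (A x h (L x - a n x)) \<le> C * norm h * (2 * M * (1/2)^n)"
            using boundB[OF x, of h "L x - a n x"] C
            by (smt (verit) mult_left_mono norm_ge_zero mult_nonneg_nonneg)
          have "FD (a n) x h - A x h (L x) = E n x h - A x h (L x - a n x)"
            unfolding E_def bil_diff[OF x, symmetric] by simp
          then have "norm (FD (a n) x h - A x h (L x)) \<le> K * (1/2)^n * norm h + C * norm h * (2 * M * (1/2)^n)"
            using norm_triangle_ineq4[of "E n x h" "A x h (L x - a n x)"] defect[OF x, of n h] 1 by simp
          also have "\<dots> = ((K + 2 * C * M) * (1/2)^n) * norm h" by (simp add: algebra_simps)
          also have "\<dots> \<le> d * norm h" using elim by (intro mult_right_mono) auto
          finally show ?thesis .
        qed
        then show ?case by blast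
      qed
    qed simp
    then obtain g where g: "\<And>x. x \<in> ?B \<Longrightarrow> (\<lambda>n. a n x) \<longlonglongrightarrow> g x"
      "\<And>x. x \<in> ?B \<Longrightarrow> (g has_derivative (\<lambda>v. A x v (L x))) (at x within ?B)" by blast
    have gL: "g x = L x" if "x \<in> ?B" for x
      using LIMSEQ_unique[OF g(1) L(1)] that by blast
    have c: "c \<in> ?B" using r by simp
    \<comment> \<open>At the centre the radial vector vanishes, so no iterate changes the initial
      value.\<close>
    have "a k c = e" for k
    proof (cases k)
      case (Suc j)
      have "integral {0..1} (\<lambda>t. A (y c t) (c - c) (a j (y c t))) = integral {0..1::real} (\<lambda>t. 0)"
        by (intro integral_cong) (simp add: bilinear_lzero[OF bilB[OF y[OF c]]])
      then show ?thesis using Suc by (simp add: aS)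
    qed (simp add: a0)
    then have "(\<lambda>k. a k c) \<longlonglongrightarrow> e" by simp
    then have "g c = e" by (rule LIMSEQ_unique[OF g(1)[OF c]])
    moreover have "(g has_derivative (\<lambda>v. A x v (g x))) (at x)" if "x \<in> ?B" for x
      using g(2)[OF that] by (simp add: gL[OF that] at_within_open[OF that open_ball])
    ultimately show ?thesis by blast
  qed
  then show ?thesis using that r BS by blast
qed

section \<open>Symplectic linear algebra\<close>

lemma linear_functional_inner:
  fixes f :: "'v::euclidean_space \<Rightarrow> real"
  assumes "linear f"
  shows "\<exists>\<xi>. \<forall>u. f u = \<xi> \<bullet> u"
proof -
  have "f u = (\<Sum>b\<in>Basis. f b *\<^sub>R b) \<bullet> u" for u
    by (subst linear_representation[OF assms]) (simp add: inner_sum_left inner_commute[of u] mult.commute)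
  then show ?thesis by blast
qed

lemma alternating_skew:
  fixes \<omega> :: "'v::euclidean_space \<Rightarrow> 'v \<Rightarrow> real"
  assumes "bilinear \<omega>" "\<And>u. \<omega> u u = 0"
  shows "\<omega> u v = - \<omega> v u"
proof -
  have "\<omega> (u + v) (u + v) = \<omega> u u + \<omega> u v + (\<omega> v u + \<omega> v v)"
    by (simp only: bilinear_ladd[OF assms(1)] bilinear_radd[OF assms(1)] add_ac)
  then show ?thesis by (simp add: assms(2))
qed

text \<open>Darboux reduction: if \<open>\<omega>(e, f) = 1\<close>, subtracting \<open>\<omega>(\<cdot>, f) \<and> \<omega>(e, \<cdot>)\<close> adds \<open>e\<close> and \<open>f\<close> to the kernel.
  The pairs that are left over when \<open>\<omega>\<close> vanishes are padded with zeros.\<close>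

lemma alternating_normal_form:
  fixes \<omega> :: "'v::euclidean_space \<Rightarrow> 'v \<Rightarrow> real"
  assumes "finite I" "bilinear \<omega>" "\<And>u. \<omega> u u = 0" "DIM('v) \<le> dim {u. \<forall>v. \<omega> u v = 0} + 2 * card I"
  shows "\<exists>\<xi> \<eta> :: 'i \<Rightarrow> 'v. \<forall>u v. \<omega> u v = (\<Sum>i\<in>I. (\<xi> i \<bullet> u) * (\<eta> i \<bullet> v) - (\<xi> i \<bullet> v) * (\<eta> i \<bullet> u))"
  using assms
proof (induction I arbitrary: \<omega> rule: finite_induct)
  case empty
  have sub: "subspace {u. \<forall>v. \<omega> u v = 0}"
    using empty.prems(1) by (auto simp: subspace_def bilinear_lzero bilinear_ladd bilinear_lmul)
  have "{u. \<forall>v. \<omega> u v = 0} = UNIV"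
    by (rule subspace_dim_equal[OF sub subspace_UNIV]) (use empty.prems(3) in auto)
  then show ?case by auto
next
  case (insert k I)
  note bil = insert.prems(1) and alt = insert.prems(2)
  note bl = bilinear_ladd[OF bil] bilinear_radd[OF bil] bilinear_lmul[OF bil] bilinear_rmul[OF bil]
    bilinear_lsub[OF bil] bilinear_lzero[OF bil]
  note skew = alternating_skew[OF bil alt]
  show ?case
  proof (cases "\<forall>u v. \<omega> u v = 0")
    case True
    then show ?thesis by (intro exI[of _ "\<lambda>_. 0"]) simp
  next
    case False
    then obtain e f' where "\<omega> e f' \<noteq> 0" by blast
    then obtain f where ef: "\<omega> e f = 1"
      using bl(4)[of e "1 / \<omega> e f'" f'] by auto
    define \<tau> where "\<tau> u v = \<omega> u v - (\<omega> u f * \<omega> e v - \<omega> v f * \<omega> e u)" for u v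
    let ?K = "{u. \<forall>v. \<omega> u v = 0}" and ?K' = "{u. \<forall>v. \<tau> u v = 0}"
    have subK: "subspace ?K" by (auto simp: subspace_def bl)
    have "\<omega> e x = 0" if "x \<in> ?K" for x using that skew[of e x] by simp
    \<comment> \<open>The hypothesis says that the rank is at most \<open>2 * card I\<close>.
      Removing the index \<open>k\<close> costs 2 on the right, which the new kernel vectors
      \<open>e\<close> and \<open>f\<close> repay, being independent modulo the old kernel.\<close>
    then have "insert e (insert f ?K) \<subseteq> ?K'"
      using skew[of f] by (auto simp: \<tau>_def ef alt)
    then have "dim (insert e (insert f ?K)) \<le> dim ?K'" by (rule dim_subset)
    moreover have "f \<notin> span ?K"
      using ef skew[of e f] by (auto simp: span_eq_iff[THEN iffD2, OF subK] intro!: exI[of _ e])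
    moreover have "e \<notin> span (insert f ?K)"
    proof
      assume "e \<in> span (insert f ?K)"
      then obtain r where "e - r *\<^sub>R f \<in> ?K"
        by (auto simp: span_breakdown_eq span_eq_iff[THEN iffD2, OF subK])
      then have "\<omega> (e - r *\<^sub>R f) f = 0" by blast
      then show False by (simp add: bl ef alt)
    qed
    ultimately have "DIM('v) \<le> dim ?K' + 2 * card I"
      using insert.prems(3) insert.hyps by (simp add: dim_insert)
    moreover have "bilinear \<tau>"
      unfolding bilinear_def \<tau>_def by (auto intro!: linearI simp: bl algebra_simps)
    moreover have "\<tau> u u = 0" for u by (simp add: \<tau>_def alt)
    ultimately obtain \<xi> \<eta> :: "'i \<Rightarrow> 'v" where
      IH: "\<And>u v. \<tau> u v = (\<Sum>i\<in>I. (\<xi> i \<bullet> u) * (\<eta> i \<bullet> v) - (\<xi> i \<bullet> v) * (\<eta> i \<bullet> u))"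
      using insert.IH by blast
    obtain x y where xy: "\<And>u. \<omega> u f = x \<bullet> u" "\<And>u. \<omega> e u = y \<bullet> u"
      using linear_functional_inner[of "\<lambda>u. \<omega> u f"] linear_functional_inner[of "\<omega> e"] bil
      unfolding bilinear_def by blast
    have "\<omega> u v = (x \<bullet> u) * (y \<bullet> v) - (x \<bullet> v) * (y \<bullet> u) + \<tau> u v" for u v
      by (simp add: \<tau>_def xy)
    moreover have "(\<Sum>i\<in>I. ((\<xi>(k := x)) i \<bullet> u) * ((\<eta>(k := y)) i \<bullet> v) - ((\<xi>(k := x)) i \<bullet> v) * ((\<eta>(k := y)) i \<bullet> u)) = \<tau> u v" for u v
      unfolding IH using insert.hyps(2) by (intro sum.cong) auto
    ultimately show ?thesis
      using insert.hyps by (intro exI[of _ "\<xi>(k := x)"] exI[of _ "\<eta>(k := y)"]) simp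
  qed
qed

text \<open>If the two subspaces covered everything, each witness would lie in the other subspace,
  and their sum would lie in neither.\<close>

lemma subspace_avoid_two:
  assumes A: "subspace A" "s1 \<notin> A" and B: "subspace B" "s2 \<notin> B"
  shows "\<exists>s. s \<notin> A \<and> s \<notin> B"
proof (rule ccontr)
  assume n: "\<nexists>s. s \<notin> A \<and> s \<notin> B"
  then have s: "s1 \<in> B" "s2 \<in> A" using A B by blast+
  have "s1 + s2 \<in> A \<or> s1 + s2 \<in> B" using n by blast
  then show False
    using subspace_diff[OF A(1) _ s(2), of "s1 + s2"] subspace_diff[OF B(1) _ s(1), of "s1 + s2"] A B by auto
qed

section \<open>Complex linear forms with prescribed real parts\<close>

lemma complex_vec_scalar_expand:
  fixes v :: "complex^'n"
  shows "c *s v = Re c *\<^sub>R v + Im c *\<^sub>R (\<i> *s v)"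
  by (simp add: vec_eq_iff complex_eq_iff)

text \<open>\<open>covec \<xi> u\<close> is the value on \<open>u\<close> of the complex linear forms whose real parts are the \<open>\<xi>\<^sub>i\<close>.\<close>

definition covec :: "('n \<Rightarrow> complex^'n) \<Rightarrow> complex^'n \<Rightarrow> complex^'n" where
  "covec \<xi> u = (\<chi> i. Complex (\<xi> i \<bullet> u) (- (\<xi> i \<bullet> (\<i> *s u))))"

lemma covec_scalar: "covec \<xi> (c *s u) = c *s covec \<xi> u"
proof -
  have i: "\<i> *s (c *s u) = Re c *\<^sub>R (\<i> *s u) - Im c *\<^sub>R u"
    by (simp add: vec_eq_iff complex_eq_iff)
  show ?thesis
    by (simp only: covec_def i)
       (simp add: complex_vec_scalar_expand[of c u] vec_eq_iff complex_eq_iff inner_add_right inner_diff_right algebra_simps)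
qed

lemma covec_add: "covec \<xi> (u + v) = covec \<xi> u + covec \<xi> v"
  by (simp add: covec_def vec_eq_iff complex_eq_iff inner_add_right vector_add_ldistrib algebra_simps)

lemma linear_covec: "linear (covec \<xi>)"
proof (rule linearI)
  fix r u
  have "r *\<^sub>R u = complex_of_real r *s u" "r *\<^sub>R covec \<xi> u = complex_of_real r *s covec \<xi> u"
    by (simp_all add: vec_eq_iff complex_eq_iff)
  then show "covec \<xi> (r *\<^sub>R u) = r *\<^sub>R covec \<xi> u" by (simp only: covec_scalar)
qed (rule covec_add)

lemma covec_eq_0_iff: "covec \<xi> u = 0 \<longleftrightarrow> (\<forall>i. \<xi> i \<bullet> u = 0 \<and> \<xi> i \<bullet> (\<i> *s u) = 0)"
  by (simp add: covec_def vec_eq_iff complex_eq_iff)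

text \<open>The shear \<open>\<xi>\<^sub>i \<mapsto> \<xi>\<^sub>i + s\<^sub>i \<Sum>\<^sub>j s\<^sub>j \<eta>\<^sub>j\<close> preserves \<open>\<Sum> \<xi>\<^sub>i \<and> \<eta>\<^sub>i\<close>. If the real vector \<open>s\<close> is not in the range of
  \<open>covec \<xi>\<close> it does not enlarge the kernel of \<open>covec \<xi>\<close>, and it strictly shrinks the kernel for generic \<open>s\<close>.\<close>

lemma symplectic_normal_form_totally_complex:
  fixes \<omega> :: "complex^'n \<Rightarrow> complex^'n \<Rightarrow> real"
  assumes bil: "bilinear \<omega>" and alt: "\<And>u. \<omega> u u = 0"
    and nondeg: "\<And>u. (\<And>v. \<omega> u v = 0) \<Longrightarrow> u = 0"
  shows "\<exists>\<xi> \<eta> :: 'n \<Rightarrow> complex^'n. (\<forall>u v.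
    \<omega> u v = 2 * (\<Sum>i\<in>UNIV. (\<xi> i \<bullet> u) * (\<eta> i \<bullet> v) - (\<xi> i \<bullet> v) * (\<eta> i \<bullet> u))) \<and>
    inj (covec \<xi>)"
proof -
  define P where "P \<xi> \<eta> \<longleftrightarrow> (\<forall>u v.
    \<omega> u v = 2 * (\<Sum>i\<in>UNIV. (\<xi> i \<bullet> u) * (\<eta> i \<bullet> v) - (\<xi> i \<bullet> v) * (\<eta> i \<bullet> u)))"
    for \<xi> \<eta> :: "'n \<Rightarrow> complex^'n"
  \<comment> \<open>Halving absorbs the factor 2 in the induced form. The real dimension is twice
    the number of indices, so the rank condition of the normal form holds whatever the kernel
    is.\<close>
  have "bilinear (\<lambda>u v. \<omega> u v / 2)"
    using bil by (auto simp: bilinear_def linear_iff add_divide_distrib)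
  then obtain \<xi> \<eta> :: "'n \<Rightarrow> complex^'n" where
    "\<And>u v. \<omega> u v / 2 = (\<Sum>i\<in>UNIV. (\<xi> i \<bullet> u) * (\<eta> i \<bullet> v) - (\<xi> i \<bullet> v) * (\<eta> i \<bullet> u))"
    using alternating_normal_form[of "UNIV :: 'n set" "\<lambda>u v. \<omega> u v / 2"] alt by auto
  then have "P \<xi> \<eta>" unfolding P_def by (metis field_sum_of_halves mult_2)
  then have "\<exists>\<xi> \<eta>. P \<xi> \<eta>" by blast
  \<comment> \<open>A coframe with kernel of least dimension replaces an iteration of shears: a
    nonzero kernel vector \<open>a\<close> would permit one more shear and contradict
    minimality.\<close>
  then obtain \<xi> \<eta> where P: "P \<xi> \<eta>"
    and least: "\<And>\<xi>' \<eta>'. P \<xi>' \<eta>' \<Longrightarrow> dim {u. covec \<xi> u = 0} \<le> dim {u. covec \<xi>' u = 0}"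
    using ex_has_least_nat[of "\<lambda>p. P (fst p) (snd p)" _ "\<lambda>p. dim {u. covec (fst p) u = 0}"] by (metis fst_conv snd_conv)
  have "a = 0" if a: "covec \<xi> a = 0" for a
  proof (rule ccontr)
    assume a0: "a \<noteq> 0"
    have \<xi>a: "\<xi> i \<bullet> a = 0" "\<xi> i \<bullet> (\<i> *s a) = 0" for i using a by (simp_all add: covec_eq_0_iff)
    define \<iota> where "\<iota> w = (\<chi> i. complex_of_real (w $ i))" for w :: "real^'n"
    have lin\<iota>: "linear \<iota>" by (rule linearI) (simp_all add: \<iota>_def vec_eq_iff complex_eq_iff)
    define A where "A = {w. \<iota> w \<in> range (covec \<xi>)}"
    \<comment> \<open>These are the shear parameters for which \<open>a\<close> survives in the
      kernel, whereas \<open>A\<close> collects those that could create new kernel vectors.\<close>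
    define B where "B = {w :: real^'n. (\<Sum>j\<in>UNIV. w $ j * (\<eta> j \<bullet> a)) = 0 \<and> (\<Sum>j\<in>UNIV. w $ j * (\<eta> j \<bullet> (\<i> *s a))) = 0}"
    have subA: "subspace A"
      using linear_subspace_vimage[OF lin\<iota> linear_subspace_image[OF linear_covec subspace_UNIV]]
      by (simp add: A_def vimage_def)
    have subB: "subspace B"
      unfolding B_def subspace_def
      by (auto simp: distrib_right sum.distrib mult.assoc simp flip: sum_distrib_left)
    \<comment> \<open>Real vectors span \<complex>^n over \<complex>. If all of them were values of
      the complex linear map \<open>covec \<xi>\<close>, it would be surjective, hence injective,
      against \<open>a\<close>.\<close>
    have "A \<noteq> UNIV"
    proof
      assume U: "A = UNIV"
      have "surj (covec \<xi>)"
      proof (rule surjI)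
        fix z :: "complex^'n"
        define u1 where "u1 = (SOME u. covec \<xi> u = \<iota> (\<chi> i. Re (z $ i)))"
        define u2 where "u2 = (SOME u. covec \<xi> u = \<iota> (\<chi> i. Im (z $ i)))"
        have "\<exists>u. covec \<xi> u = \<iota> w" for w using U unfolding A_def by (metis UNIV_I imageE mem_Collect_eq)
        then have "covec \<xi> u1 = \<iota> (\<chi> i. Re (z $ i))" "covec \<xi> u2 = \<iota> (\<chi> i. Im (z $ i))"
          unfolding u1_def u2_def by (metis (mono_tags, lifting) someI_ex)+
        then have "covec \<xi> (u1 + \<i> *s u2) = z"
          by (simp add: covec_add covec_scalar \<iota>_def vec_eq_iff complex_eq_iff)
        then show "covec \<xi> (SOME u. covec \<xi> u = z) = z" by (metis (mono_tags, lifting) someI)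
      qed
      then have "inj (covec \<xi>)" by (rule linear_surj_imp_inj[OF linear_covec])
      then show False using a a0 linear_covec by (metis injD linear_0)
    qed
    \<comment> \<open>Otherwise all \<open>\<eta> j\<close> vanish on \<open>a\<close>, as all
      \<open>\<xi> i\<close> do, and \<open>a\<close> lies in the kernel of \<omega>.\<close>
    moreover have "B \<noteq> UNIV"
    proof
      assume U: "B = UNIV"
      have "\<eta> j \<bullet> a = 0" for j
      proof -
        have "(\<Sum>k\<in>UNIV. (axis j 1 :: real^'n) $ k * (\<eta> k \<bullet> a)) = 0"
          using U by (auto simp: B_def)
        then show ?thesis by (simp add: axis_def if_distrib if_distribR cong: if_cong)
      qed
      then have "\<omega> a v = 0" for v using P \<xi>a by (simp add: P_def)
      then show False using nondeg a0 by blast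
    qed
    ultimately obtain s where s: "s \<notin> A" "s \<notin> B"
      using subspace_avoid_two[OF subA _ subB] by blast
    define \<sigma> where "\<sigma> = (\<Sum>j\<in>UNIV. s $ j *\<^sub>R \<eta> j)"
    define \<xi>' where "\<xi>' i = \<xi> i + s $ i *\<^sub>R \<sigma>" for i
    have cov': "covec \<xi>' u = covec \<xi> u + Complex (\<sigma> \<bullet> u) (- (\<sigma> \<bullet> (\<i> *s u))) *s \<iota> s" for u
      by (simp add: covec_def \<xi>'_def \<iota>_def vec_eq_iff complex_eq_iff inner_add_left)
    \<comment> \<open>The shear adds \<sigma> \<and> \<sigma> = 0 to the form.\<close>
    have P': "P \<xi>' \<eta>"
      unfolding P_def
    proof (intro allI)
      fix u v
      have "(\<Sum>i\<in>UNIV. (\<xi>' i \<bullet> u) * (\<eta> i \<bullet> v) - (\<xi>' i \<bullet> v) * (\<eta> i \<bullet> u))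
         = (\<Sum>i\<in>UNIV. (\<xi> i \<bullet> u) * (\<eta> i \<bullet> v) - (\<xi> i \<bullet> v) * (\<eta> i \<bullet> u))
           + ((\<sigma> \<bullet> u) * (\<Sum>i\<in>UNIV. s $ i * (\<eta> i \<bullet> v)) - (\<sigma> \<bullet> v) * (\<Sum>i\<in>UNIV. s $ i * (\<eta> i \<bullet> u)))"
        by (simp add: \<xi>'_def inner_add_left sum_distrib_left sum.distrib sum_subtractf algebra_simps)
      moreover have "(\<Sum>i\<in>UNIV. s $ i * (\<eta> i \<bullet> v)) = \<sigma> \<bullet> v" for v
        by (simp add: \<sigma>_def inner_sum_left)
      ultimately show "\<omega> u v = 2 * (\<Sum>i\<in>UNIV. (\<xi>' i \<bullet> u) * (\<eta> i \<bullet> v) - (\<xi>' i \<bullet> v) * (\<eta> i \<bullet> u))"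
        using P by (simp add: P_def)
    qed
    \<comment> \<open>A nonzero complex factor could be divided out, exhibiting the real vector
      \<open>s\<close> as a value of \<open>covec \<xi>\<close>.\<close>
    have ker: "covec \<xi> u = 0 \<and> Complex (\<sigma> \<bullet> u) (- (\<sigma> \<bullet> (\<i> *s u))) = 0" if "covec \<xi>' u = 0" for u
    proof -
      let ?c = "Complex (\<sigma> \<bullet> u) (- (\<sigma> \<bullet> (\<i> *s u)))"
      have e: "covec \<xi> u = - ?c *s \<iota> s" using that cov'[of u] by (simp add: eq_neg_iff_add_eq_0)
      have "?c = 0"
      proof (rule ccontr)
        assume c: "?c \<noteq> 0"
        then have "covec \<xi> ((- 1 / ?c) *s u) = \<iota> s"
          unfolding covec_scalar e by (simp add: vec_eq_iff)
        then show False using s(1) by (auto simp: A_def intro: range_eqI[OF sym])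
      qed
      then show ?thesis using e by simp
    qed
    have "a \<notin> {u. covec \<xi>' u = 0}"
    proof
      assume "a \<in> {u. covec \<xi>' u = 0}"
      then have "\<sigma> \<bullet> a = 0 \<and> \<sigma> \<bullet> (\<i> *s a) = 0" using ker[of a] by (auto simp: complex_eq_iff)
      then show False using s(2) by (simp add: B_def \<sigma>_def inner_sum_left)
    qed
    moreover have "{u. covec \<xi>' u = 0} \<subseteq> {u. covec \<xi> u = 0}" using ker by blast
    ultimately have "{u. covec \<xi>' u = 0} \<subset> {u. covec \<xi> u = 0}" using a by blast
    then have "span {u. covec \<xi>' u = 0} \<subset> span {u. covec \<xi> u = 0}"
      using linear_subspace_kernel[OF linear_covec] by (metis span_eq_iff)
    from dim_psubset[OF this] least[OF P'] show False by simp
  qed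
  then have "inj (covec \<xi>)" by (simp add: linear_injective_0[OF linear_covec])
  then show ?thesis using P unfolding P_def by blast
qed

section \<open>Affine coordinates of a connection\<close>

lemma smooth_on_linear_field:
  fixes L :: "'p::euclidean_space \<Rightarrow> 'a::euclidean_space \<Rightarrow> 'c::real_normed_vector"
  assumes S: "open S" and lin: "\<And>q. q \<in> S \<Longrightarrow> linear (L q)"
    and L: "\<And>v. smooth_on S (\<lambda>q. L q v)" and X: "smooth_on S X"
  shows "smooth_on S (\<lambda>q. L q (X q))"
proof -
  have "smooth_on S (\<lambda>q. \<Sum>b\<in>Basis. (X q \<bullet> b) *\<^sub>R L q b)"
    by (intro smooth_on_sum S smooth_on_bounded_bilinear[OF bounded_bilinear_scaleR]
        smooth_on_bounded_linear[OF bounded_linear_inner_left] L X)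
  then show ?thesis
    by (subst smooth_on_cong[OF S, where g = "\<lambda>q. \<Sum>b\<in>Basis. (X q \<bullet> b) *\<^sub>R L q b"])
       (auto simp: linear_representation[OF lin])
qed

lemma smooth_on_bilinear_field:
  fixes A :: "'p::euclidean_space \<Rightarrow> 'a::euclidean_space \<Rightarrow> 'b::euclidean_space \<Rightarrow> 'c::real_normed_vector"
  assumes S: "open S" and bil: "\<And>q. q \<in> S \<Longrightarrow> bilinear (A q)"
    and A: "\<And>u v. smooth_on S (\<lambda>q. A q u v)" and X: "smooth_on S X" and Y: "smooth_on S Y"
  shows "smooth_on S (\<lambda>q. A q (X q) (Y q))"
proof (rule smooth_on_linear_field[where L = "\<lambda>q u. A q u (Y q)", OF S _ _ X])
  show "smooth_on S (\<lambda>q. A q u (Y q))" for u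
    by (rule smooth_on_linear_field[OF S _ A Y]) (use bil in \<open>simp add: bilinear_def\<close>)
qed (use bil in \<open>simp add: bilinear_def\<close>)

lemma smooth_on_along:
  assumes "open S" "smooth_on S X" "smooth_on S h"
  shows "smooth_on S (along X h)"
  using smooth_on_linear_field[where L = "\<lambda>q v. FD h q v", OF assms(1) smooth_on_linear_FD[OF assms(3)] smooth_on_FD[OF assms(3)] assms(2)]
  by (simp add: along_def[abs_def])

lemma along_cong:
  assumes "open S" "p \<in> S" "\<And>q. q \<in> S \<Longrightarrow> f q = g q"
  shows "along X f p = along X g p"
  unfolding along_def by (simp only: FD_cong[OF assms])

lemma along_along:
  assumes "open S" "smooth_on S h" "Y differentiable (at p)" "p \<in> S"
  shows "along X (along Y h) p = FD (\<lambda>q. FD h q (Y p)) p (X p) + FD h p (along X Y p)"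
proof -
  have "((\<lambda>q. FD h q (Y q)) has_derivative (\<lambda>w. FD (\<lambda>q. FD h q (Y p)) p w + FD h p (FD Y p w))) (at p)"
    by (rule has_derivative_linear_field[where L = "\<lambda>q v. FD h q v", OF assms(1,4) smooth_on_linear_FD[OF assms(2)]
          smooth_on_differentiable[OF smooth_on_FD[OF assms(2)] assms(4)] FD_has[OF assms(3)]])
  from FD_eq[OF this] show ?thesis
    by (simp add: along_def[abs_def])
qed

text \<open>The second derivatives of \<open>h\<close> cancel by symmetry; the first-order
  remainders form the bracket.\<close>

lemma along_bracket:
  fixes h :: "complex^'n \<Rightarrow> 'b::euclidean_space"
  assumes "open S" "smooth_on S h" "smooth_on S X" "smooth_on S Y" "p \<in> S"
  shows "along X (along Y h) p - along Y (along X h) p = along (bracket X Y) h p"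
proof -
  note d = smooth_on_differentiable[OF _ assms(5)]
  show ?thesis
    using FD_commute[OF assms(1,2,5), of "Y p" "X p"]
    by (simp add: along_along[OF assms(1,2) d assms(5)] assms)
       (simp add: along_def bracket_def linear_diff[OF smooth_on_linear_FD[OF assms(2,5)]])
qed

lemma local_connection_bilinear: "local_connection S \<Gamma> \<Longrightarrow> p \<in> S \<Longrightarrow> bilinear (\<Gamma> p)"
  by (simp add: local_connection_def)

lemma smooth_on_covd:
  assumes "open S" "local_connection S \<Gamma>" "smooth_on S X" "smooth_on S Y"
  shows "smooth_on S (covd \<Gamma> X Y)"
proof -
  have "smooth_on S (\<lambda>p. \<Gamma> p (X p) (Y p))"
    by (rule smooth_on_bilinear_field[OF assms(1) _ _ assms(3,4)])
       (use assms(2) in \<open>auto simp: local_connection_def\<close>)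
  then show ?thesis
    unfolding covd_def[abs_def] by (intro smooth_on_add smooth_on_along assms)
qed

lemma covd_const: "covd \<Gamma> (\<lambda>_. u) (\<lambda>_. v) p = \<Gamma> p u v"
  by (simp add: covd_def along_def)

text \<open>\<open>\<nabla> dh = 0\<close> for a vector-valued map \<open>h\<close>, tested on constant fields.\<close>

definition affine_map_on :: "(complex^'n) set \<Rightarrow> 'n::finite christoffel \<Rightarrow> (complex^'n \<Rightarrow> 'b::real_normed_vector) \<Rightarrow> bool" where
  "affine_map_on S \<Gamma> h \<longleftrightarrow> (\<forall>p\<in>S. \<forall>u v. FD (\<lambda>q. FD h q v) p u = FD h p (\<Gamma> p u v))"

text \<open>The Hessian of \<open>h\<close> is absorbed by \<open>\<Gamma>\<close>, and the
  derivative of \<open>Y\<close> supplies the rest. \<open>Y\<close> enters only through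
  differentiability at \<open>p\<close>, so it may itself be a covariant derivative.\<close>

lemma along_affine_map:
  assumes S: "open S" "smooth_on S h" "affine_map_on S \<Gamma> h" "p \<in> S" and Y: "Y differentiable (at p)"
  shows "along X (\<lambda>q. FD h q (Y q)) p = FD h p (covd \<Gamma> X Y p)"
proof -
  have "along X (\<lambda>q. FD h q (Y q)) p = along X (along Y h) p"
    by (simp add: along_def[abs_def])
  also have "\<dots> = FD h p (covd \<Gamma> X Y p)"
    using assms(3,4)
    by (simp add: along_along[OF S(1,2) Y S(4)] affine_map_on_def covd_def
        linear_add[OF smooth_on_linear_FD[OF S(2,4)]])
  finally show ?thesis .
qed

text \<open>\<open>\<nabla> df\<close> is a tensor: its value at a point depends only on the values
  of the fields there, and constant fields realize all values.\<close>

lemma affine_function_iff: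
  assumes "open S" "smooth_on S f"
  shows "affine_function S \<Gamma> f \<longleftrightarrow> affine_map_on S \<Gamma> f"
proof
  assume A: "affine_function S \<Gamma> f"
  have "along (\<lambda>_. u) (along (\<lambda>_. v) f) p - along (covd \<Gamma> (\<lambda>_. u) (\<lambda>_. v)) f p = 0" if "p \<in> S" for p u v
    using A that smooth_on_const unfolding affine_function_def by blast
  then show "affine_map_on S \<Gamma> f"
    by (simp add: affine_map_on_def along_def[abs_def] covd_def)
next
  assume A: "affine_map_on S \<Gamma> f"
  have "along X (along Y f) p - along (covd \<Gamma> X Y) f p = 0" if "smooth_on S Y" "p \<in> S" for X Y p
    using along_affine_map[OF assms A that(2) smooth_on_differentiable[OF that]]
    by (simp add: along_def[abs_def])
  then show "affine_function S \<Gamma> f"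
    using assms by (simp add: affine_function_def)
qed

lemma affine_map_on_vec_iff:
  fixes h :: "complex^'n \<Rightarrow> real^'m"
  assumes "open S" "smooth_on S h"
  shows "affine_map_on S \<Gamma> h \<longleftrightarrow> (\<forall>i. affine_map_on S \<Gamma> (\<lambda>z. h z $ i))"
proof -
  have 1: "FD (\<lambda>z. h z $ i) q v = FD h q v $ i" if "q \<in> S" for q v i
    by (rule FD_vec_nth[OF smooth_on_differentiable[OF assms(2) that]])
  have 2: "FD (\<lambda>q. FD (\<lambda>z. h z $ i) q v) p u = FD (\<lambda>q. FD h q v) p u $ i" if "p \<in> S" for p u v i
    using FD_cong[OF assms(1) that 1]
    by (simp add: FD_vec_nth[OF smooth_on_differentiable[OF smooth_on_FD[OF assms(2)] that]])
  show ?thesis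
    by (auto simp: affine_map_on_def 1 2 vec_eq_iff)
qed

lemma affine_coordinates_unique:
  assumes "affine_map_on S \<Gamma> h" "affine_map_on S \<Gamma>' h" "p \<in> S" "inj (FD h p)"
  shows "\<Gamma> p = \<Gamma>' p"
proof (intro ext)
  fix u v
  have "FD h p (\<Gamma> p u v) = FD h p (\<Gamma>' p u v)"
    using assms by (simp add: affine_map_on_def)
  then show "\<Gamma> p u v = \<Gamma>' p u v" using assms(4) by (simp add: inj_eq)
qed

text \<open>\<open>\<Gamma>\<close> is the Hessian of \<open>h\<close> read through the injective
  differential, so it inherits the symmetry of second derivatives.\<close>

lemma affine_coordinates_torsionfree:
  fixes h :: "complex^'n \<Rightarrow> 'b::euclidean_space"
  assumes "open S" "smooth_on S h" "affine_map_on S \<Gamma> h" "\<And>p. p \<in> S \<Longrightarrow> inj (FD h p)"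
  shows "local_torsionfree S \<Gamma>"
  unfolding local_torsionfree_def
proof (intro allI impI ballI)
  fix X Y :: "complex^'n \<Rightarrow> complex^'n" and p assume p: "smooth_on S X" "smooth_on S Y" "p \<in> S"
  have "FD h p (\<Gamma> p (X p) (Y p)) = FD h p (\<Gamma> p (Y p) (X p))"
    using FD_commute[OF assms(1,2) p(3), of "Y p" "X p"] assms(3) p(3) by (simp add: affine_map_on_def)
  then have "\<Gamma> p (X p) (Y p) = \<Gamma> p (Y p) (X p)"
    using assms(4)[OF p(3)] by (simp add: inj_eq)
  then show "covd \<Gamma> X Y p - covd \<Gamma> Y X p - bracket X Y p = 0"
    by (simp add: covd_def bracket_def)
qed

text \<open>\<open>FD h\<close> turns iterated covariant derivatives of \<open>Z\<close> into
  iterated derivatives of the single map \<open>k = Z h\<close>. The curvature thus becomes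
  \<open>along_bracket\<close> for \<open>k\<close>.\<close>

lemma affine_coordinates_flat:
  fixes h :: "complex^'n \<Rightarrow> 'b::euclidean_space"
  assumes S: "open S" and h: "smooth_on S h" and aff: "affine_map_on S \<Gamma> h"
    and inj: "\<And>p. p \<in> S \<Longrightarrow> inj (FD h p)" and \<Gamma>: "local_connection S \<Gamma>"
  shows "local_flat S \<Gamma>"
  unfolding local_flat_def
proof (intro allI impI ballI)
  fix X Y Z :: "complex^'n \<Rightarrow> complex^'n" and p assume X: "smooth_on S X" and Y: "smooth_on S Y" and Z: "smooth_on S Z" and p: "p \<in> S"
  define k where "k = along Z h"
  have k: "smooth_on S k" unfolding k_def by (rule smooth_on_along[OF S Z h])
  have 1: "along X' k q = FD h q (covd \<Gamma> X' Z q)" if "q \<in> S" for X' q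
    using along_affine_map[OF S h aff that smooth_on_differentiable[OF Z that]]
    by (simp add: k_def along_def[abs_def])
  have 2: "along X' (along Y' k) p = FD h p (covd \<Gamma> X' (covd \<Gamma> Y' Z) p)" if "smooth_on S Y'" for X' Y'
  proof -
    have "along X' (along Y' k) p = along X' (\<lambda>q. FD h q (covd \<Gamma> Y' Z q)) p"
      by (rule along_cong[OF S p 1])
    also have "\<dots> = FD h p (covd \<Gamma> X' (covd \<Gamma> Y' Z) p)"
      by (rule along_affine_map[OF S h aff p smooth_on_differentiable[OF smooth_on_covd[OF S \<Gamma> that Z] p]])
    finally show ?thesis .
  qed
  let ?c = "covd \<Gamma> X (covd \<Gamma> Y Z) p - covd \<Gamma> Y (covd \<Gamma> X Z) p - covd \<Gamma> (bracket X Y) Z p"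
  have lin: "linear (FD h p)" by (rule smooth_on_linear_FD[OF h p])
  have "FD h p ?c = 0"
    using along_bracket[OF S k X Y p] by (simp add: 1[OF p] 2 X Y linear_diff[OF lin])
  then show "?c = 0"
    using inj[OF p] linear_injective_0[OF lin] by blast
qed

text \<open>Parallelism expands the three derivatives and torsion-freeness the three brackets. The
  twelve resulting terms cancel in pairs, three of the pairs through skewness.\<close>

lemma parallel_torsionfree_closed:
  assumes \<omega>: "\<And>p. p \<in> S \<Longrightarrow> bilinear (\<omega> p)" "\<And>p u. p \<in> S \<Longrightarrow> \<omega> p u u = 0"
    and tf: "local_torsionfree S \<Gamma>" and par: "local_parallel S \<Gamma> \<omega>"
    and X: "smooth_on S X" and Y: "smooth_on S Y" and Z: "smooth_on S Z" and p: "p \<in> S"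
  shows "ext_deriv2 \<omega> X Y Z p = 0"
proof -
  have br: "bracket X' Y' p = covd \<Gamma> X' Y' p - covd \<Gamma> Y' X' p" if "smooth_on S X'" "smooth_on S Y'" for X' Y'
  proof -
    have "covd \<Gamma> X' Y' p - covd \<Gamma> Y' X' p - bracket X' Y' p = 0"
      using tf p that unfolding local_torsionfree_def by blast
    then show ?thesis by simp
  qed
  have pr: "along X' (\<lambda>q. \<omega> q (Y' q) (Z' q)) p = \<omega> p (covd \<Gamma> X' Y' p) (Z' p) + \<omega> p (Y' p) (covd \<Gamma> X' Z' p)"
    if "smooth_on S X'" "smooth_on S Y'" "smooth_on S Z'" for X' Y' Z'
    using par p that unfolding local_parallel_def by blast
  note skew = alternating_skew[OF \<omega>(1)[OF p] \<omega>(2)[OF p]]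
  note bl = bilinear_lsub[OF \<omega>(1)[OF p]]
  show ?thesis
    unfolding ext_deriv2_def pr[OF X Y Z] pr[OF Y X Z] pr[OF Z X Y] br[OF X Y] br[OF X Z] br[OF Y Z] bl
    using skew[of "Y p" "covd \<Gamma> X Z p"] skew[of "X p" "covd \<Gamma> Y Z p"] skew[of "X p" "covd \<Gamma> Z Y p"] by simp
qed

section \<open>One-forms\<close>

definition re_parts :: "complex^'m \<Rightarrow> real^'m" where
  "re_parts v = (\<chi> k. Re (v $ k))"

definition im_parts :: "complex^'m \<Rightarrow> real^'m" where
  "im_parts v = (\<chi> k. Im (v $ k))"

lemma linear_re_parts: "linear re_parts" and linear_im_parts: "linear im_parts"
  by (auto simp: re_parts_def im_parts_def vec_eq_iff intro!: linearI)

lemmas bounded_linear_re_parts = linear_re_parts[THEN linear_conv_bounded_linear[THEN iffD1]]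
lemmas bounded_linear_im_parts = linear_im_parts[THEN linear_conv_bounded_linear[THEN iffD1]]

lemma re_parts_i: "re_parts (\<i> *s v) = - im_parts v"
  by (simp add: re_parts_def im_parts_def vec_eq_iff)

lemma holo_on_one_form_map:
  assumes "holo_on U F"
  shows "holo_on U (one_form_map F)"
  unfolding holo_on_iff_holo_fun_on
proof
  fix k :: "'a + 'a"
  show "holo_fun_on U (\<lambda>z. one_form_map F z $ k)"
  proof (cases k)
    case (Inl i)
    have d: "((\<lambda>z. z $ i) has_derivative (\<lambda>v. v $ i)) (at x)" for x :: "complex^'a"
      by (rule bounded_linear.has_derivative[OF bounded_linear_vec_nth has_derivative_ident])
    then show ?thesis
      using FD_eq[OF d] by (auto simp: Inl one_form_map_def holo_fun_on_def intro: Derivative.differentiableI[OF d])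
  next
    case (Inr i)
    then show ?thesis using assms by (simp add: one_form_map_def holo_on_iff_holo_fun_on)
  qed
qed

lemma FD_one_form_map:
  assumes "holo_on U F" "p \<in> U"
  shows "FD (one_form_map F) p v $ Inl i = v $ i" "FD (one_form_map F) p v $ Inr i = FD F p v $ i"
proof -
  have d: "one_form_map F differentiable (at p)" "F differentiable (at p)"
    using holo_on_one_form_map[OF assms(1)] assms by (auto simp: holo_on_def)
  have "((\<lambda>z. z $ i) has_derivative (\<lambda>v. v $ i)) (at p)"
    by (rule bounded_linear.has_derivative[OF bounded_linear_vec_nth has_derivative_ident])
  then show "FD (one_form_map F) p v $ Inl i = v $ i"
    by (simp add: FD_vec_nth[OF d(1), symmetric] one_form_map_def FD_eq)
  show "FD (one_form_map F) p v $ Inr i = FD F p v $ i"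
    by (simp add: FD_vec_nth[OF d(1), symmetric] FD_vec_nth[OF d(2), symmetric] one_form_map_def)
qed

text \<open>Links the one-variable derivative in the definition of regularity with the total
  differential: on a coordinate line the differential is complex linear, hence a complex
  derivative.\<close>

lemma cpartial_eq_FD:
  assumes "holo_on U F" "p \<in> U"
  shows "cpartial F i j p = FD F p (axis j 1) $ i"
proof -
  have d: "(F has_derivative FD F p) (at p)" and c: "\<And>c v. FD F p (c *s v) = c *s FD F p v"
    using assms by (auto simp: holo_on_def FD_has)
  have 1: "((\<lambda>t. p + t *s axis j 1) has_derivative (\<lambda>t. t *s axis j 1)) (at 0)"
    using bounded_linear.has_derivative[OF bounded_linear_vector_scalar_mult_left has_derivative_ident]
    by (auto intro!: derivative_eq_intros)
  have "(F has_derivative FD F p) (at (p + 0 *s axis j 1))" using d by simp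
  from bounded_linear.has_derivative[OF bounded_linear_vec_nth has_derivative_compose[OF 1 this]]
  have "((\<lambda>t. F (p + t *s axis j 1) $ i) has_derivative (\<lambda>t. FD F p (t *s axis j 1) $ i)) (at 0)" .
  then have "((\<lambda>t. F (p + t *s axis j 1) $ i) has_field_derivative FD F p (axis j 1) $ i) (at 0)"
    by (rule has_derivative_imp_has_field_derivative) (simp add: c)
  then show ?thesis by (simp add: cpartial_def DERIV_imp_deriv)
qed

lemma FD_holo_expand:
  assumes "holo_on U F" "p \<in> U"
  shows "FD F p v $ i = (\<Sum>j\<in>UNIV. cpartial F i j p * v $ j)"
proof -
  have c: "\<And>c v. FD F p (c *s v) = c *s FD F p v" and lin: "linear (FD F p)"
    using assms by (auto simp: holo_on_def linear_frechet_derivative)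
  have "FD F p v = FD F p (\<Sum>j\<in>UNIV. v $ j *s axis j 1)"
    by (simp add: basis_expansion)
  also have "\<dots> = (\<Sum>j\<in>UNIV. v $ j *s FD F p (axis j 1))"
    by (simp add: linear_sum[OF lin] c)
  finally show ?thesis
    by (simp add: cpartial_eq_FD[OF assms] mult.commute)
qed


lemma regular_1form_holo: "regular_1form U F \<Longrightarrow> holo_on U F"
  by (simp add: regular_1form_def)

text \<open>The z-components of the image are \<open>v\<close> itself, so a real image forces
  \<open>v\<close> real. For real \<open>v\<close> the imaginary part of \<open>DF v\<close> is the
  matrix of regularity applied to \<open>v\<close>.\<close>

lemma regular_1form_real_kernel:
  fixes F :: "complex^'n \<Rightarrow> complex^'n"
  assumes reg: "regular_1form U F" and p: "p \<in> U"
    and v: "\<And>k. Im (FD (one_form_map F) p v $ k) = 0"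
  shows "v = 0"
proof -
  note h = regular_1form_holo[OF reg]
  have Imv: "Im (v $ i) = 0" for i
    using v[of "Inl i"] by (simp add: FD_one_form_map[OF h p])
  define B :: "real^'n^'n" where "B = (\<chi> i j. Im (cpartial F i j p))"
  have "(B *v re_parts v) $ i = Im (FD F p v $ i)" for i
    unfolding FD_holo_expand[OF h p] B_def re_parts_def
    by (simp add: matrix_vector_mult_def Imv)
  also have "Im (FD F p v $ i) = 0" for i
    using v[of "Inr i"] by (simp add: FD_one_form_map[OF h p])
  finally have B0: "B *v re_parts v = 0" by (simp add: vec_eq_iff)
  obtain B' where "B' ** B = mat 1"
    using reg p unfolding regular_1form_def B_def invertible_def by blast
  then have "re_parts v = B' *v (B *v re_parts v)"
    by (simp add: matrix_vector_mul_assoc)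
  then have "re_parts v = 0" by (simp add: B0)
  then show "v = 0" using Imv by (simp add: re_parts_def vec_eq_iff complex_eq_iff)
qed

text \<open>The map \<rho> = Re \<phi>, whose components are the affine coordinates x^i and y_j
  restricted to the immersion.\<close>

definition real_coords :: "(complex^'n \<Rightarrow> complex^'n) \<Rightarrow> complex^'n \<Rightarrow> real^('n + 'n)" where
  "real_coords F z = re_parts (one_form_map F z)"

context
  fixes U :: "(complex^'n::finite) set" and F :: "complex^'n \<Rightarrow> complex^'n"
  assumes U: "open U" and reg: "regular_1form U F"
begin

lemma smooth_one_form_map: "smooth_on U (one_form_map F)"
  by (intro holo_on_smooth U holo_on_one_form_map regular_1form_holo reg)

lemma smooth_real_coords: "smooth_on U (real_coords F)"
  unfolding real_coords_def[abs_def]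
  by (rule smooth_on_bounded_linear[OF bounded_linear_re_parts U smooth_one_form_map])

lemma FD_one_form_map_scalar: "p \<in> U \<Longrightarrow> FD (one_form_map F) p (c *s v) = c *s FD (one_form_map F) p v"
  using holo_on_one_form_map[OF regular_1form_holo[OF reg]] by (simp add: holo_on_def)

lemma FD_real_coords: "p \<in> U \<Longrightarrow> FD (real_coords F) p v = re_parts (FD (one_form_map F) p v)"
  unfolding real_coords_def[abs_def]
  by (rule FD_bounded_linear[OF bounded_linear_re_parts smooth_on_differentiable[OF smooth_one_form_map]])

lemma FD_real_coords_nth:
  assumes "p \<in> U"
  shows "FD (real_coords F) p v $ Inl i = Re (v $ i)" "FD (real_coords F) p v $ Inr i = Re (FD F p v $ i)"
  by (simp_all add: FD_real_coords assms re_parts_def FD_one_form_map[OF regular_1form_holo[OF reg]])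

text \<open>Multiplication by \<i> exchanges real and imaginary parts up to sign: if the real part
  of d\<phi>(v) vanishes, then d\<phi>(\<i> v) is real.\<close>

lemma inj_FD_real_coords:
  assumes p: "p \<in> U"
  shows "inj (FD (real_coords F) p)"
  unfolding linear_injective_0[OF smooth_on_linear_FD[OF smooth_real_coords p]]
proof (intro allI impI)
  fix v assume "FD (real_coords F) p v = 0"
  then have "Im (FD (one_form_map F) p (\<i> *s v) $ k) = 0" for k
    by (simp add: FD_real_coords[OF p] FD_one_form_map_scalar[OF p] re_parts_def vec_eq_iff)
  then have "\<i> *s v = 0" by (rule regular_1form_real_kernel[OF reg p])
  then show "v = 0" by (simp add: vec_eq_iff)
qed

lemma surj_FD_real_coords:
  assumes p: "p \<in> U"
  shows "surj (FD (real_coords F) p)"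
  by (rule linear_injective_imp_surjective[OF smooth_on_linear_FD[OF smooth_real_coords p] inj_FD_real_coords[OF p]])
     simp

lemma holomorphic_immersion_one_form_map: "holomorphic_immersion U (one_form_map F)"
  unfolding holomorphic_immersion_def
proof (intro conjI ballI injI)
  show "holo_on U (one_form_map F)" by (intro holo_on_one_form_map regular_1form_holo reg)
  fix p v w assume "p \<in> U" "FD (one_form_map F) p v = FD (one_form_map F) p w"
  then show "v = w"
    by (metis FD_real_coords inj_FD_real_coords injD)
qed

lemma totally_complex_one_form_map: "totally_complex U (one_form_map F)"
  unfolding totally_complex_def
proof
  fix p assume p: "p \<in> U"
  have lin: "linear (FD (one_form_map F) p)" by (rule smooth_on_linear_FD[OF smooth_one_form_map p])
  have "FD (one_form_map F) p v = 0" if "FD (one_form_map F) p v \<in> real_points" for v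
  proof -
    have "v = 0" using regular_1form_real_kernel[OF reg p] that by (simp add: real_points_def)
    then show ?thesis by (simp add: linear_0[OF lin])
  qed
  moreover have "0 \<in> range (FD (one_form_map F) p)" using linear_0[OF lin] by (metis rangeI)
  moreover have "0 \<in> (real_points :: (complex^('n + 'n)) set)" by (simp add: real_points_def)
  ultimately show "real_points \<inter> range (FD (one_form_map F) p) = {0}" by blast
qed

text \<open>The 2n scalar conditions become one condition on a map with injective differential;
  injectivity is what permits equations for \<open>\<Gamma>\<close> to be tested after applying this
  differential.\<close>

lemma induced_connection_iff:
  "induced_connection U (one_form_map F) \<Gamma> \<longleftrightarrow>
    local_connection U \<Gamma> \<and> local_flat U \<Gamma> \<and> local_torsionfree U \<Gamma> \<and> affine_map_on U \<Gamma> (real_coords F)"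
proof -
  have s: "smooth_on U (\<lambda>z. real_coords F z $ k)" for k
    by (rule smooth_on_bounded_linear[OF bounded_linear_vec_nth U smooth_real_coords])
  have "(\<lambda>z. Re (one_form_map F z $ k)) = (\<lambda>z. real_coords F z $ k)" for k
    by (simp add: real_coords_def re_parts_def)
  then have "affine_function U \<Gamma> (\<lambda>z. Re (one_form_map F z $ k)) \<longleftrightarrow> affine_map_on U \<Gamma> (\<lambda>z. real_coords F z $ k)" for k
    using affine_function_iff[OF U s] by simp
  moreover have "(\<forall>k. Q k) \<longleftrightarrow> (\<forall>i. Q (Inl i)) \<and> (\<forall>i. Q (Inr i))" for Q :: "'n + 'n \<Rightarrow> bool"
    by (metis sum.exhaust)
  ultimately show ?thesis
    by (simp add: induced_connection_def affine_map_on_vec_iff[OF U smooth_real_coords])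
qed

text \<open>The connection is \<open>(D\<rho>)\<^sup>-\<^sup>1 D\<^sup>2\<rho>\<close> for \<open>\<rho> = Re \<phi>\<close>. Since \<open>\<rho>\<close> begins with \<open>Re z\<close>, it takes imaginary values, and
  the equation for it reduces to a linear system with matrix \<open>Im \<partial>F\<close>, solved by Cramer's rule.\<close>

lemma induced_connection_exists: "\<exists>\<Gamma>. induced_connection U (one_form_map F) \<Gamma>"
proof -
  note h = regular_1form_holo[OF reg]
  have sF: "smooth_on U F" by (rule holo_on_smooth[OF U h])
  define B :: "complex^'n \<Rightarrow> real^'n^'n" where "B p = (\<chi> i j. Im (cpartial F i j p))" for p
  define c :: "complex^'n \<Rightarrow> complex^'n \<Rightarrow> complex^'n \<Rightarrow> real^'n" where
    "c p u v = re_parts (FD (\<lambda>q. FD F q v) p u)" for p u v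
  define b :: "complex^'n \<Rightarrow> complex^'n \<Rightarrow> complex^'n \<Rightarrow> real^'n" where
    "b p u v = (\<chi> k. det (\<chi> i j. if j = k then c p u v $ i else B p $ i $ j) / det (B p))" for p u v
  \<comment> \<open>Here \<Gamma> = -\<i> b with \<open>b\<close> real, so the real part of
    \<open>DF \<Gamma>\<close> is the matrix Im \<partial>F applied to \<open>b\<close>, which
    Cramer's rule makes equal to \<open>c\<close>. The Re z components of the equation hold because
    both sides vanish.\<close>
  define \<Gamma> where "\<Gamma> p u v = (\<chi> k. Complex 0 (- (b p u v $ k)))" for p u v
  have detB: "det (B p) \<noteq> 0" if "p \<in> U" for p
    using reg that by (simp add: regular_1form_def B_def invertible_det_nz[symmetric])
  have Bb: "B p *v b p u v = c p u v" if "p \<in> U" for p u v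
    using cramer[OF detB[OF that], of "b p u v" "c p u v"] by (simp add: b_def)
  have second: "FD (\<lambda>q. FD (real_coords F) q v) p u = FD (real_coords F) p (\<Gamma> p u v)" if p: "p \<in> U" for p u v
  proof -
    have n: "FD (\<lambda>q. FD (real_coords F) q v) p u $ k = FD (\<lambda>q. FD (real_coords F) q v $ k) p u" for k
      by (rule FD_vec_nth[symmetric, OF smooth_on_differentiable[OF smooth_on_FD[OF smooth_real_coords] p]])
    have "FD (\<lambda>q. FD (real_coords F) q v) p u $ k = FD (real_coords F) p (\<Gamma> p u v) $ k" for k
    proof (cases k)
      case (Inl i)
      have "FD (\<lambda>q. FD (real_coords F) q v $ Inl i) p u = FD (\<lambda>q. Re (v $ i)) p u"
        using FD_cong[OF U p FD_real_coords_nth(1)] by simp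
      then show ?thesis unfolding n Inl FD_real_coords_nth[OF p] by (simp add: \<Gamma>_def)
    next
      case (Inr i)
      have d: "(\<lambda>q. FD F q v) differentiable (at p)"
        by (rule smooth_on_differentiable[OF smooth_on_FD[OF sF] p])
      have "FD (\<lambda>q. FD (real_coords F) q v $ Inr i) p u = FD (\<lambda>q. Re (FD F q v $ i)) p u"
        using FD_cong[OF U p FD_real_coords_nth(2)] by simp
      also have "\<dots> = Re (FD (\<lambda>q. FD F q v) p u $ i)"
        by (rule FD_bounded_linear[OF bounded_linear_compose[OF bounded_linear_Re bounded_linear_vec_nth] d])
      also have "\<dots> = (B p *v b p u v) $ i" by (simp add: Bb[OF p] c_def re_parts_def)
      also have "\<dots> = Re (FD F p (\<Gamma> p u v) $ i)"
        by (simp add: FD_holo_expand[OF h p] matrix_vector_mult_def B_def \<Gamma>_def)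
      finally show ?thesis unfolding n Inr FD_real_coords_nth[OF p] .
    qed
    then show ?thesis by (simp add: vec_eq_iff)
  qed
  then have aff: "affine_map_on U \<Gamma> (real_coords F)" by (simp add: affine_map_on_def)
  have lin\<rho>: "linear (FD (real_coords F) p)" if "p \<in> U" for p
    by (rule smooth_on_linear_FD[OF smooth_real_coords that])
  \<comment> \<open>Linearity is hidden in the quotient of determinants. It is recovered from the
    second derivative of \<rho>, which is bilinear, by cancelling the injective D\<rho>.\<close>
  have bil: "bilinear (\<Gamma> p)" if p: "p \<in> U" for p
  proof -
    have 1: "linear (\<lambda>u. FD (\<lambda>q. FD (real_coords F) q v) p u)" for v
      by (rule smooth_on_linear_FD[OF smooth_on_FD[OF smooth_real_coords] p])
    have 2: "linear (\<lambda>v. FD (\<lambda>q. FD (real_coords F) q v) p u)" for u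
      by (rule linear_FD_linear_field[OF U p lin\<rho> smooth_on_differentiable[OF smooth_on_FD[OF smooth_real_coords] p]])
    show ?thesis
      unfolding bilinear_def
      by (intro conjI allI linearI injD[OF inj_FD_real_coords[OF p]])
         (simp_all add: second[OF p, symmetric] linear_add[OF lin\<rho>[OF p]] linear_cmul[OF lin\<rho>[OF p]]
           linear_add[OF 1] linear_add[OF 2] linear_cmul[OF 1] linear_cmul[OF 2])
  qed
  have smooth\<Gamma>: "smooth_on U (\<lambda>p. \<Gamma> p u v)" for u v
  proof (rule smooth_on_vecI[OF U])
    fix k
    have sc: "smooth_on U (\<lambda>p. c p u v $ i)" for i
      unfolding c_def
      by (intro smooth_on_bounded_linear[OF bounded_linear_compose[OF bounded_linear_vec_nth bounded_linear_re_parts] U]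
          smooth_on_FD sF)
    have sB: "smooth_on U (\<lambda>p. B p $ i $ j)" for i j
    proof -
      have "smooth_on U (\<lambda>p. Im (FD F p (axis j 1) $ i))"
        by (rule smooth_on_bounded_linear[OF bounded_linear_compose[OF bounded_linear_Im bounded_linear_vec_nth] U smooth_on_FD[OF sF]])
      then show ?thesis
        by (subst smooth_on_cong[OF U, where g = "\<lambda>p. Im (FD F p (axis j 1) $ i)"])
           (simp_all add: B_def cpartial_eq_FD[OF h])
    qed
    have "smooth_on U (\<lambda>p. (\<chi> i j. if j = k then c p u v $ i else B p $ i $ j) $ i $ j)" for i j
      using sc sB by (cases "j = k") simp_all
    then have "smooth_on U (\<lambda>p. det (\<chi> i j. if j = k then c p u v $ i else B p $ i $ j))"
      by (rule smooth_on_det[OF U])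
    moreover have "smooth_on U (\<lambda>p. inverse (det (B p)))"
      by (intro smooth_on_inverse U smooth_on_det sB detB)
    ultimately have "smooth_on U (\<lambda>p. b p u v $ k)"
      using smooth_on_bounded_bilinear[OF bounded_bilinear_mult U] by (simp add: b_def divide_inverse)
    moreover have "bounded_linear (\<lambda>r. Complex 0 (- r))"
      by (rule bounded_linear_intro[where K = 1]) (auto simp: complex_eq_iff complex_norm)
    ultimately show "smooth_on U (\<lambda>p. \<Gamma> p u v $ k)"
      using smooth_on_bounded_linear[OF _ U] by (simp add: \<Gamma>_def)
  qed
  have lc: "local_connection U \<Gamma>" using bil smooth\<Gamma> by (simp add: local_connection_def)
  show ?thesis
    using lc aff affine_coordinates_flat[OF U smooth_real_coords aff inj_FD_real_coords lc]
      affine_coordinates_torsionfree[OF U smooth_real_coords aff inj_FD_real_coords]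
    unfolding induced_connection_iff by blast
qed

lemma induced_connection_unique:
  assumes "induced_connection U (one_form_map F) \<Gamma>" "induced_connection U (one_form_map F) \<Gamma>'" "p \<in> U"
  shows "\<Gamma> p = \<Gamma>' p"
  using assms affine_coordinates_unique[OF _ _ _ inj_FD_real_coords] unfolding induced_connection_iff by blast

end

section \<open>The structure defined by a regular one-form\<close>

definition std_form :: "real^('n::finite + 'n) \<Rightarrow> real^('n + 'n) \<Rightarrow> real" where
  "std_form u v = (\<Sum>i\<in>UNIV. u $ Inl i * v $ Inr i - v $ Inl i * u $ Inr i)"

lemma dx_wedge_dy_eq: "dx_wedge_dy u v = std_form (re_parts u) (re_parts v)"
  by (simp add: dx_wedge_dy_def std_form_def re_parts_def)

lemma bilinear_std_form: "bilinear std_form"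
  unfolding bilinear_def
  by (auto intro!: linearI simp: std_form_def algebra_simps sum.distrib sum_subtractf sum_distrib_left)

lemma bounded_bilinear_std_form: "bounded_bilinear std_form"
  using bilinear_std_form by (simp add: bilinear_conv_bounded_bilinear)

lemma std_form_self: "std_form u u = 0"
  by (simp add: std_form_def)

text \<open>The test vector is \<open>u\<close> with its two halves exchanged and one sign changed;
  the pairing becomes a sum of squares.\<close>

lemma std_form_nondegenerate:
  assumes "\<And>v. std_form u v = 0"
  shows "u = 0"
proof -
  have "std_form u (\<chi> k. case k of Inl i \<Rightarrow> - u $ Inr i | Inr i \<Rightarrow> u $ Inl i)
      = (\<Sum>i\<in>UNIV. (u $ Inl i)\<^sup>2 + (u $ Inr i)\<^sup>2)"
    by (simp add: std_form_def power2_eq_square)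
  then have "(\<Sum>i\<in>UNIV. (u $ Inl i)\<^sup>2 + (u $ Inr i)\<^sup>2) = 0" using assms by simp
  then have "(u $ Inl i)\<^sup>2 + (u $ Inr i)\<^sup>2 = 0" for i
    by (subst (asm) sum_nonneg_eq_0_iff) auto
  then have "u $ Inl i = 0 \<and> u $ Inr i = 0" for i
    by (metis sum_power2_eq_zero_iff)
  then show ?thesis by (metis vec_eq_iff zero_index sum.exhaust)
qed

lemma second_countable_euclidean: "second_countable (euclidean :: 'a::second_countable_topology topology)"
proof -
  obtain B :: "'a set set" where B: "countable B" "topological_basis B"
    using ex_countable_basis by blast
  show ?thesis
    unfolding second_countable_def
  proof (intro exI conjI)
    show "\<forall>V\<in>B. openin euclidean V" using B(2) by (simp add: topological_basis_open)
    show "\<forall>U x. openin euclidean U \<and> x \<in> U \<longrightarrow> (\<exists>V\<in>B. x \<in> V \<and> V \<subseteq> U)"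
      using topological_basisE[OF B(2)] by (metis open_openin)
  qed (rule B(1))
qed

lemma FD_ident_on:
  assumes "open U" "p \<in> U" "\<And>z. z \<in> U \<Longrightarrow> g z = z"
  shows "FD g p v = v"
  using FD_cong[OF assms(1,2), of g "\<lambda>z. z"] assms(3) by simp

text \<open>The coordinate change of a one-chart manifold is built with \<open>inv_into\<close> and
  is controlled only on \<open>U\<close>. Hence \<open>g\<close> is assumed to be the identity on
  \<open>U\<close> alone, and openness transfers the derivatives.\<close>

lemma conn_related_ident:
  assumes U: "open U" and g: "\<And>z. z \<in> U \<Longrightarrow> g z = z"
  shows "conn_related U g \<Gamma> \<Gamma>"
  unfolding conn_related_def
proof (intro allI impI)
  fix X Y X' Y' assume "vf_related U g X X'" "vf_related U g Y Y'"
  then have *: "X' p = X p" "Y' p = Y p" if "p \<in> U" for p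
    using that by (simp_all add: vf_related_def g FD_ident_on[OF U that g])
  show "vf_related U g (covd \<Gamma> X Y) (covd \<Gamma> X' Y')"
    unfolding vf_related_def
  proof
    fix p assume p: "p \<in> U"
    have "along X' Y' p = along X Y p"
      using along_cong[OF U p *(2)] by (simp add: along_def *[OF p])
    then show "covd \<Gamma> X' Y' (g p) = FD g p (covd \<Gamma> X Y p)"
      by (simp add: g[OF p] FD_ident_on[OF U p g] covd_def *[OF p])
  qed
qed

lemma form_related_ident:
  assumes "open U" "\<And>z. z \<in> U \<Longrightarrow> g z = z"
  shows "form_related U g \<omega> \<omega>"
  by (simp add: form_related_def assms FD_ident_on[OF assms(1) _ assms(2)])

section \<open>Open subsets of \<complex>^n as special symplectic manifolds with one chart\<close>

lemma open_set_data_simps [simp]: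
  "mtop (open_set_data U \<Gamma> \<omega>) = top_of_set U" "charts (open_set_data U \<Gamma> \<omega>) = {()}"
  "cdom (open_set_data U \<Gamma> \<omega>) i = U" "coord (open_set_data U \<Gamma> \<omega>) i = (\<lambda>z. z)"
  "conn (open_set_data U \<Gamma> \<omega>) i = \<Gamma>" "form (open_set_data U \<Gamma> \<omega>) i = \<omega>"
  by (simp_all add: open_set_data_def)

lemma inv_into_ident: "z \<in> U \<Longrightarrow> inv_into U (\<lambda>z. z) z = z"
  using f_inv_into_f[of z "\<lambda>z. z" U] by simp

lemma special_symplectic_open_set:
  assumes U: "open U" and "local_connection U \<Gamma>" "local_flat U \<Gamma>" "local_torsionfree U \<Gamma>"
    "local_special U \<Gamma>" "local_symplectic U \<omega>" "local_parallel U \<Gamma> \<omega>"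
  shows "special_symplectic_manifold (open_set_data U \<Gamma> \<omega>)"
proof -
  let ?M = "open_set_data U \<Gamma> \<omega>"
  have dom: "loc_dom ?M ?M id i j = U" for i j
    by (auto simp: loc_dom_def)
  have rep: "loc_rep ?M ?M id i j z = z" if "z \<in> U" for i j z
    using that by (simp add: loc_rep_def inv_into_ident)
  have "holo_on U (loc_rep ?M ?M id i j)" for i j
    unfolding holo_on_def
  proof (intro ballI conjI allI)
    fix p c v assume p: "p \<in> U"
    show "loc_rep ?M ?M id i j differentiable (at p)"
      using differentiable_cong_open[OF U p rep] by (simp add: differentiable_ident)
    show "FD (loc_rep ?M ?M id i j) p (c *s v) = c *s FD (loc_rep ?M ?M id i j) p v"
      by (simp add: FD_ident_on[OF U p rep])
  qed
  moreover have "homeomorphic_map (top_of_set U) (top_of_set U) (\<lambda>z. z)"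
    using homeomorphic_map_id[of "top_of_set U" "top_of_set U"] by (simp add: id_def)
  ultimately have "complex_manifold ?M"
    using U by (auto simp: complex_manifold_def dom subtopology_subtopology
        intro!: Hausdorff_space_subtopology second_countable_subtopology second_countable_euclidean)
  then show ?thesis
    using assms conn_related_ident[OF U rep] form_related_ident[OF U rep]
    by (simp add: special_symplectic_manifold_def special_complex_manifold_def is_connection_def
        is_symplectic_form_def dom)
qed

section \<open>Parallelism, closedness and the special condition for the induced structures\<close>

context
  fixes U :: "(complex^'n::finite) set" and F :: "complex^'n \<Rightarrow> complex^'n"
  assumes U: "open U" and reg: "regular_1form U F"
begin

lemma induced_form_eq:
  "p \<in> U \<Longrightarrow> induced_form (one_form_map F) p u v = 2 * std_form (FD (real_coords F) p u) (FD (real_coords F) p v)"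
  by (simp add: induced_form_def dx_wedge_dy_eq FD_real_coords[OF U reg])

text \<open>\<omega> is the pullback under \<rho> of a form with constant coefficients.
  Differentiation therefore hits only \<open>D\<rho> Y\<close> and \<open>D\<rho> Z\<close>, and
  affinity makes these derivatives the images of the covariant ones.\<close>

lemma induced_form_parallel:
  assumes aff: "affine_map_on U \<Gamma> (real_coords F)"
  shows "local_parallel U \<Gamma> (induced_form (one_form_map F))"
  unfolding local_parallel_def
proof (intro allI impI ballI)
  fix X Y Z :: "complex^'n \<Rightarrow> complex^'n" and p
  assume X: "smooth_on U X" and Y: "smooth_on U Y" and Z: "smooth_on U Z" and p: "p \<in> U"
  let ?\<rho> = "real_coords F"
  note s = smooth_real_coords[OF U reg]
  define y where "y q = FD ?\<rho> q (Y q)" for q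
  define z where "z q = FD ?\<rho> q (Z q)" for q
  have sy: "smooth_on U y" and sz: "smooth_on U z"
    using smooth_on_along[OF U Y s] smooth_on_along[OF U Z s] by (simp_all add: y_def[abs_def] z_def[abs_def] along_def[abs_def])
  have dy: "FD y p (X p) = FD ?\<rho> p (covd \<Gamma> X Y p)" and dz: "FD z p (X p) = FD ?\<rho> p (covd \<Gamma> X Z p)"
    using along_affine_map[OF U s aff p smooth_on_differentiable[OF Y p], of X]
      along_affine_map[OF U s aff p smooth_on_differentiable[OF Z p], of X]
    by (simp_all add: along_def y_def[abs_def] z_def[abs_def])
  have "along X (\<lambda>q. induced_form (one_form_map F) q (Y q) (Z q)) p = along X (\<lambda>q. 2 * std_form (y q) (z q)) p"
    by (rule along_cong[OF U p]) (simp add: induced_form_eq y_def z_def)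
  also have "\<dots> = 2 * (std_form (y p) (FD z p (X p)) + std_form (FD y p (X p)) (z p))"
  proof -
    have "((\<lambda>q. 2 * std_form (y q) (z q)) has_derivative
        (\<lambda>v. 2 * (std_form (y p) (FD z p v) + std_form (FD y p v) (z p)))) (at p)"
      by (intro has_derivative_mult_right bounded_bilinear.FDERIV[OF bounded_bilinear_std_form]
          smooth_on_FD_has[OF sy p] smooth_on_FD_has[OF sz p])
    from FD_eq[OF this] show ?thesis by (simp add: along_def)
  qed
  also have "\<dots> = induced_form (one_form_map F) p (covd \<Gamma> X Y p) (Z p) + induced_form (one_form_map F) p (Y p) (covd \<Gamma> X Z p)"
    by (simp add: induced_form_eq[OF p] dy dz y_def z_def)
  finally show "along X (\<lambda>q. induced_form (one_form_map F) q (Y q) (Z q)) p = \<dots>" .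
qed

lemma induced_form_symplectic:
  assumes aff: "affine_map_on U \<Gamma> (real_coords F)" and tf: "local_torsionfree U \<Gamma>"
  shows "local_symplectic U (induced_form (one_form_map F))"
proof -
  let ?\<rho> = "real_coords F" and ?\<omega> = "induced_form (one_form_map F)"
  note s = smooth_real_coords[OF U reg]
  have bil: "bilinear (?\<omega> p)" if p: "p \<in> U" for p
    unfolding bilinear_def
    by (auto intro!: linearI simp: induced_form_eq[OF p] linear_add[OF smooth_on_linear_FD[OF s p]]
        linear_cmul[OF smooth_on_linear_FD[OF s p]] bilinear_ladd[OF bilinear_std_form] bilinear_radd[OF bilinear_std_form]
        bilinear_lmul[OF bilinear_std_form] bilinear_rmul[OF bilinear_std_form])
  have alt: "?\<omega> p u u = 0" if "p \<in> U" for p u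
    by (simp add: induced_form_eq[OF that] std_form_self)
  have sm: "smooth_on U (\<lambda>p. ?\<omega> p u v)" for u v
  proof -
    have "smooth_on U (\<lambda>p. 2 * std_form (FD ?\<rho> p u) (FD ?\<rho> p v))"
      by (intro smooth_on_bounded_linear[OF bounded_linear_mult_right U]
          smooth_on_bounded_bilinear[OF bounded_bilinear_std_form U] smooth_on_FD s)
    then show ?thesis
      by (subst smooth_on_cong[OF U induced_form_eq])
  qed
  have nd: "u = 0" if p: "p \<in> U" and 0: "\<forall>v. ?\<omega> p u v = 0" for p u
  proof -
    have "std_form (FD ?\<rho> p u) w = 0" for w
    proof -
      obtain v where "w = FD ?\<rho> p v" using surj_FD_real_coords[OF U reg p] by (metis surjD)
      then show ?thesis using 0 by (simp add: induced_form_eq[OF p])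
    qed
    then have "FD ?\<rho> p u = 0" by (rule std_form_nondegenerate)
    then show "u = 0"
      using inj_FD_real_coords[OF U reg p] linear_injective_0[OF smooth_on_linear_FD[OF s p]] by blast
  qed
  have "ext_deriv2 ?\<omega> X Y Z p = 0"
    if "smooth_on U X" "smooth_on U Y" "smooth_on U Z" "p \<in> U" for X Y Z p
    using parallel_torsionfree_closed[OF bil alt tf induced_form_parallel[OF aff]] that by blast
  then show ?thesis
    using bil alt sm nd unfolding local_symplectic_def local_2form_def by blast
qed

text \<open>Holomorphy gives D\<rho>(J v) = -D\<iota>(v) with \<iota> = Im \<phi>. So applying
  D\<rho> to (\<nabla>_X J) Y yields D\<iota>(\<nabla>_X Y) - X (Y \<iota>). The antisymmetric part
  in X and Y is D\<iota>([X, Y]) - [X, Y] \<iota> = 0, by torsion-freeness.\<close>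

lemma induced_connection_special:
  assumes aff: "affine_map_on U \<Gamma> (real_coords F)" and tf: "local_torsionfree U \<Gamma>"
  shows "local_special U \<Gamma>"
  unfolding local_special_def
proof (intro allI impI ballI)
  fix X Y :: "complex^'n \<Rightarrow> complex^'n" and p
  assume X: "smooth_on U X" and Y: "smooth_on U Y" and p: "p \<in> U"
  let ?\<rho> = "real_coords F"
  define \<iota> where "\<iota> z = im_parts (one_form_map F z)" for z
  note s = smooth_real_coords[OF U reg]
  have s\<iota>: "smooth_on U \<iota>"
    unfolding \<iota>_def[abs_def] by (rule smooth_on_bounded_linear[OF bounded_linear_im_parts U smooth_one_form_map[OF U reg]])
  have FD\<iota>: "FD \<iota> q v = im_parts (FD (one_form_map F) q v)" if "q \<in> U" for q v
    unfolding \<iota>_def[abs_def]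
    by (rule FD_bounded_linear[OF bounded_linear_im_parts smooth_on_differentiable[OF smooth_one_form_map[OF U reg] that]])
  have J: "FD ?\<rho> q (Jc v) = - FD \<iota> q v" if "q \<in> U" for q v
    by (simp add: Jc_def FD_real_coords[OF U reg that] FD_one_form_map_scalar[OF U reg that] re_parts_i FD\<iota>[OF that])
  have smJ: "smooth_on U (\<lambda>q. Jc (Z q))" if "smooth_on U Z" for Z
    unfolding Jc_def by (rule smooth_on_bounded_linear[OF bounded_linear_vector_scalar_mult_right U that])
  have lin: "linear (FD ?\<rho> p)" "linear (FD \<iota> p)"
    by (rule smooth_on_linear_FD[OF s p] smooth_on_linear_FD[OF s\<iota> p])+
  have *: "FD ?\<rho> p (nablaJ \<Gamma> A B p) = FD \<iota> p (covd \<Gamma> A B p) - along A (along B \<iota>) p"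
    if B: "smooth_on U B" for A B
  proof -
    have "along A (\<lambda>q. FD ?\<rho> q (Jc (B q))) p = along A (\<lambda>q. - along B \<iota> q) p"
      by (rule along_cong[OF U p]) (simp add: J along_def)
    also have "\<dots> = - along A (along B \<iota>) p"
      unfolding along_def[of A]
      by (rule FD_bounded_linear[OF bounded_linear_minus[OF bounded_linear_ident]
            smooth_on_differentiable[OF smooth_on_along[OF U B s\<iota>] p]])
    finally have "FD ?\<rho> p (covd \<Gamma> A (\<lambda>q. Jc (B q)) p) = - along A (along B \<iota>) p"
      using along_affine_map[OF U s aff p smooth_on_differentiable[OF smJ[OF B] p]] by simp
    then show ?thesis
      by (simp add: nablaJ_def linear_diff[OF lin(1)] J[OF p])
  qed
  have "covd \<Gamma> X Y p - covd \<Gamma> Y X p - bracket X Y p = 0"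
    using tf X Y p unfolding local_torsionfree_def by blast
  then have "FD \<iota> p (covd \<Gamma> X Y p) - FD \<iota> p (covd \<Gamma> Y X p) = along (bracket X Y) \<iota> p"
    by (simp add: linear_diff[OF lin(2), symmetric] along_def)
  then have "FD ?\<rho> p (nablaJ \<Gamma> X Y p) = FD ?\<rho> p (nablaJ \<Gamma> Y X p)"
    using along_bracket[OF U s\<iota> X Y p] by (simp add: *[OF X] *[OF Y] algebra_simps)
  then show "nablaJ \<Gamma> X Y p = nablaJ \<Gamma> Y X p"
    using inj_FD_real_coords[OF U reg p] by (simp add: inj_eq)
qed

lemma induced_special_symplectic:
  assumes "induced_connection U (one_form_map F) \<Gamma>"
  shows "special_symplectic_manifold (open_set_data U \<Gamma> (induced_form (one_form_map F)))"
  using assms unfolding induced_connection_iff[OF U reg]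
  by (intro special_symplectic_open_set U induced_connection_special induced_form_symplectic induced_form_parallel) auto

end

section \<open>Special coordinates\<close>

lemma along_const: "along (\<lambda>_. u) h p = FD h p u"
  by (simp add: along_def)

lemma bracket_const: "bracket (\<lambda>_. u) (\<lambda>_. v) = (\<lambda>_. 0)"
  by (simp add: bracket_def[abs_def] along_def)

lemma torsionfree_symmetric:
  assumes "local_torsionfree S \<Gamma>" "p \<in> S"
  shows "\<Gamma> p u v = \<Gamma> p v u"
proof -
  have "covd \<Gamma> (\<lambda>_. u) (\<lambda>_. v) p - covd \<Gamma> (\<lambda>_. v) (\<lambda>_. u) p - bracket (\<lambda>_. u) (\<lambda>_. v) p = 0"
    using assms smooth_on_const unfolding local_torsionfree_def by blast
  then show ?thesis by (simp add: covd_const bracket_const)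
qed

text \<open>On constant fields \<open>nablaJ\<close> is this expression minus \<i> \<Gamma>(u, v),
  which is symmetric already. The identity says that a o J is closed for every parallel covector
  field a.\<close>

lemma special_symmetric:
  assumes "local_special S \<Gamma>" "local_torsionfree S \<Gamma>" "p \<in> S"
  shows "\<Gamma> p u (\<i> *s v) = \<Gamma> p v (\<i> *s u)"
proof -
  have n: "nablaJ \<Gamma> (\<lambda>_. u) (\<lambda>_. v) p = \<Gamma> p u (\<i> *s v) - \<i> *s \<Gamma> p u v" for u v
    by (simp add: nablaJ_def covd_const Jc_def)
  have "nablaJ \<Gamma> (\<lambda>_. u) (\<lambda>_. v) p = nablaJ \<Gamma> (\<lambda>_. v) (\<lambda>_. u) p"
    using assms smooth_on_const unfolding local_special_def by blast
  then show ?thesis using torsionfree_symmetric[OF assms(2,3)] by (simp add: n)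
qed

text \<open>Constant fields have bracket zero, so the curvature reduces to the commutator of second
  covariant derivatives. In this form flatness is the integrability condition of parallel transport,
  for vectors and for covectors.\<close>

lemma flat_const:
  assumes "local_flat S \<Gamma>" "local_connection S \<Gamma>" "p \<in> S"
  shows "FD (\<lambda>q. \<Gamma> q v w) p u + \<Gamma> p u (\<Gamma> p v w) = FD (\<lambda>q. \<Gamma> q u w) p v + \<Gamma> p v (\<Gamma> p u w)"
proof -
  have n: "covd \<Gamma> (\<lambda>_. u) (covd \<Gamma> (\<lambda>_. v) (\<lambda>_. w)) p = FD (\<lambda>q. \<Gamma> q v w) p u + \<Gamma> p u (\<Gamma> p v w)" for u v
    by (simp add: covd_def[abs_def] along_def)
  have "covd \<Gamma> (\<lambda>_. u) (covd \<Gamma> (\<lambda>_. v) (\<lambda>_. w)) p - covd \<Gamma> (\<lambda>_. v) (covd \<Gamma> (\<lambda>_. u) (\<lambda>_. w)) p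
      - covd \<Gamma> (bracket (\<lambda>_. u) (\<lambda>_. v)) (\<lambda>_. w) p = 0"
    using assms smooth_on_const unfolding local_flat_def by blast
  then show ?thesis
    by (simp add: n bracket_const covd_const bilinear_lzero[OF local_connection_bilinear[OF assms(2,3)]])
qed

lemma parallel_const:
  assumes "local_parallel S \<Gamma> \<omega>" "p \<in> S"
  shows "FD (\<lambda>q. \<omega> q v w) p u = \<omega> p (\<Gamma> p u v) w + \<omega> p v (\<Gamma> p u w)"
proof -
  have "along (\<lambda>_. u) (\<lambda>q. \<omega> q v w) p
      = \<omega> p (covd \<Gamma> (\<lambda>_. u) (\<lambda>_. v) p) w + \<omega> p v (covd \<Gamma> (\<lambda>_. u) (\<lambda>_. w) p)"
    using assms smooth_on_const unfolding local_parallel_def by blast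
  then show ?thesis by (simp add: covd_const along_const)
qed

lemma smooth_on_Pair:
  assumes S: "open S" and "smooth_on S f" "smooth_on S g"
  shows "smooth_on S (\<lambda>x. (f x, g x))"
proof -
  have "smooth_on S (\<lambda>x. (f x, 0) + (0, g x))"
    by (intro smooth_on_add S smooth_on_bounded_linear[OF _ S assms(2), of "\<lambda>y. (y, 0)"]
        smooth_on_bounded_linear[OF _ S assms(3), of "\<lambda>y. (0, y)"] bounded_linear_Pair
        bounded_linear_ident bounded_linear_zero)
  then show ?thesis by simp
qed

text \<open>The action of the connection on covectors, represented by the inner product.\<close>

definition cotr :: "'n::finite christoffel \<Rightarrow> complex^'n \<Rightarrow> complex^'n \<Rightarrow> complex^'n \<Rightarrow> complex^'n" where
  "cotr \<Gamma> x v a = (\<Sum>b\<in>Basis. (a \<bullet> \<Gamma> x v b) *\<^sub>R b)"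

lemma cotr_inner:
  assumes "bilinear (\<Gamma> x)"
  shows "cotr \<Gamma> x v a \<bullet> w = a \<bullet> \<Gamma> x v w"
proof -
  have "\<Gamma> x v w = (\<Sum>b\<in>Basis. (w \<bullet> b) *\<^sub>R \<Gamma> x v b)"
    by (rule linear_representation) (use assms in \<open>simp add: bilinear_def\<close>)
  then show ?thesis
    by (simp add: cotr_def inner_sum_left inner_sum_right inner_commute[of w] mult.commute)
qed

context
  fixes S :: "(complex^'n::finite) set" and \<Gamma> :: "'n christoffel"
  assumes S: "open S" and \<Gamma>: "local_connection S \<Gamma>"
    and flat: "local_flat S \<Gamma>" and tf: "local_torsionfree S \<Gamma>" and special: "local_special S \<Gamma>"
begin

text \<open>The field \<open>a\<close> represents the differential of Re f by the inner product. Its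
  equation says that it is parallel, so Re f is affine; the imaginary part is prescribed so that df
  is complex linear.\<close>

lemma affine_holomorphic_functions:
  assumes c: "c \<in> S"
  shows "\<exists>r>0. ball c r \<subseteq> S \<and> (\<forall>\<alpha>. \<exists>f a. a c = \<alpha> \<and> (\<forall>x\<in>ball c r.
    (f has_derivative (\<lambda>v. Complex (a x \<bullet> v) (- (a x \<bullet> (\<i> *s v))))) (at x) \<and>
    (a has_derivative (\<lambda>v. cotr \<Gamma> x v (a x))) (at x)))"
proof -
  define A :: "complex^'n \<Rightarrow> complex^'n \<Rightarrow> complex \<times> (complex^'n) \<Rightarrow> complex \<times> (complex^'n)" where
    "A x v e = (Complex (snd e \<bullet> v) (- (snd e \<bullet> (\<i> *s v))), cotr \<Gamma> x v (snd e))" for x v e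
  note bil = local_connection_bilinear[OF \<Gamma>]
  have bl: "\<Gamma> x (u + u') w = \<Gamma> x u w + \<Gamma> x u' w" "\<Gamma> x (k *\<^sub>R u) w = k *\<^sub>R \<Gamma> x u w" if "x \<in> S" for x u u' w k
    using bilinear_ladd[OF bil[OF that]] bilinear_lmul[OF bil[OF that]] by auto
  have iadd: "\<i> *s (u + v) = \<i> *s u + \<i> *s v" "\<i> *s (k *\<^sub>R u) = k *\<^sub>R (\<i> *s u)" for u v :: "complex^'n" and k
    by (simp_all add: vec_eq_iff distrib_left)
  have sm\<Gamma>: "smooth_on S (\<lambda>x. \<Gamma> x v b)" for v b using \<Gamma> by (simp add: local_connection_def)
  obtain r where r: "r > 0" "ball c r \<subseteq> S"
    and sol: "\<And>e. \<exists>s. s c = e \<and> (\<forall>x\<in>ball c r. (s has_derivative (\<lambda>v. A x v (s x))) (at x))"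
  proof (rule total_linear_system[of S c A])
    show "bilinear (A x)" if "x \<in> S" for x
      unfolding bilinear_def A_def cotr_def
      by (auto intro!: linearI simp: bl[OF that] iadd inner_add_left inner_add_right complex_eq_iff
          scaleR_add_left sum.distrib scaleR_sum_right)
    show "Ck_on 1 S (\<lambda>x. A x v e)" for v e
    proof -
      have "smooth_on S (\<lambda>x. A x v e)"
        unfolding A_def cotr_def
        by (intro smooth_on_Pair S smooth_on_const smooth_on_sum
            smooth_on_bounded_linear[OF bounded_linear_scaleR_left S]
            smooth_on_bounded_linear[OF bounded_linear_inner_right S] sm\<Gamma>)
      then show ?thesis by (simp add: smooth_on_def)
    qed
    fix x u v :: "complex^'n" and e :: "complex \<times> (complex^'n)" assume x: "x \<in> S"
    define a where "a = snd e"
    have D: "FD (\<lambda>q. A q v e) x u = (0, \<Sum>b\<in>Basis. (a \<bullet> FD (\<lambda>q. \<Gamma> q v b) x u) *\<^sub>R b)" for u v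
    proof -
      have "((\<lambda>q. A q v e) has_derivative (\<lambda>u. (0, \<Sum>b\<in>Basis. (a \<bullet> FD (\<lambda>q. \<Gamma> q v b) x u) *\<^sub>R b))) (at x)"
        unfolding A_def cotr_def a_def
        by (intro has_derivative_Pair has_derivative_const has_derivative_sum has_derivative_scaleR_left
            has_derivative_inner_right smooth_on_FD_has[OF sm\<Gamma> x])
      from FD_eq[OF this] show ?thesis by simp
    qed
    \<comment> \<open>Three symmetries in \<open>u\<close> and \<open>v\<close> are required, one
      for each entry: torsion-freeness gives it for the real part of the function, the special
      condition for the imaginary part, and flatness for the covector.\<close>
    have E: "FD (\<lambda>q. A q v e) x u + A x v (A x u e) =
       (Complex (a \<bullet> \<Gamma> x u v) (- (a \<bullet> \<Gamma> x u (\<i> *s v))),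
        \<Sum>b\<in>Basis. (a \<bullet> (FD (\<lambda>q. \<Gamma> q v b) x u + \<Gamma> x u (\<Gamma> x v b))) *\<^sub>R b)" for u v
      unfolding D unfolding A_def a_def[symmetric]
      by (simp add: cotr_inner[of \<Gamma> x, OF bil[OF x]])
         (simp add: cotr_def[of _ _ v] cotr_inner[of \<Gamma> x, OF bil[OF x]] inner_add_right scaleR_add_left sum.distrib)
    show "FD (\<lambda>q. A q v e) x u + A x v (A x u e) = FD (\<lambda>q. A q u e) x v + A x u (A x v e)"
      unfolding E flat_const[OF flat \<Gamma> x, of v _ u] torsionfree_symmetric[OF tf x, of u v]
        special_symmetric[OF special tf x, of u v] by simp
  qed (use S c in auto)
  have "\<exists>f a. a c = \<alpha> \<and> (\<forall>x\<in>ball c r.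
    (f has_derivative (\<lambda>v. Complex (a x \<bullet> v) (- (a x \<bullet> (\<i> *s v))))) (at x) \<and>
    (a has_derivative (\<lambda>v. cotr \<Gamma> x v (a x))) (at x))" for \<alpha>
  proof -
    \<comment> \<open>The additive constant of the function is set to 0; only its differential at
      \<open>c\<close> is prescribed.\<close>
    obtain s where s: "s c = (0, \<alpha>)" "\<And>x. x \<in> ball c r \<Longrightarrow> (s has_derivative (\<lambda>v. A x v (s x))) (at x)"
      using sol[of "(0, \<alpha>)"] by blast
    have "((\<lambda>x. fst (s x)) has_derivative (\<lambda>v. fst (A x v (s x)))) (at x)"
      "((\<lambda>x. snd (s x)) has_derivative (\<lambda>v. snd (A x v (s x)))) (at x)" if "x \<in> ball c r" for x
      using s(2)[OF that] by (rule has_derivative_fst has_derivative_snd)+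
    then show ?thesis
      by (intro exI[of _ "\<lambda>x. fst (s x)"] exI[of _ "\<lambda>x. snd (s x)"]) (simp add: A_def s(1))
  qed
  then show ?thesis using r by blast
qed

text \<open>Parallel vector fields serve as a moving frame: paired with parallel covectors or
  inserted into a parallel form they give constants, so identities at \<open>c\<close> spread over a
  ball.\<close>

lemma parallel_vector_fields:
  assumes c: "c \<in> S"
  shows "\<exists>r>0. ball c r \<subseteq> S \<and> (\<forall>e. \<exists>P. P c = e \<and>
    (\<forall>x\<in>ball c r. (P has_derivative (\<lambda>v. - \<Gamma> x v (P x))) (at x)))"
proof -
  note bil = local_connection_bilinear[OF \<Gamma>]
  have sm\<Gamma>: "smooth_on S (\<lambda>x. \<Gamma> x v b)" for v b using \<Gamma> by (simp add: local_connection_def)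
  have sm: "smooth_on S (\<lambda>x. - \<Gamma> x v e)" for v e
    by (rule smooth_on_bounded_linear[OF bounded_linear_minus[OF bounded_linear_ident] S sm\<Gamma>])
  obtain r where "r > 0" "ball c r \<subseteq> S"
    "\<And>e. \<exists>P. P c = e \<and> (\<forall>x\<in>ball c r. (P has_derivative (\<lambda>v. - \<Gamma> x v (P x))) (at x))"
  proof (rule total_linear_system[of S c "\<lambda>x v e. - \<Gamma> x v e"])
    show "bilinear (\<lambda>v e. - \<Gamma> x v e)" if "x \<in> S" for x
      using bil[OF that] unfolding bilinear_def by (simp add: linear_compose_neg)
    show "Ck_on 1 S (\<lambda>x. - \<Gamma> x v e)" for v e
      using sm by (simp add: smooth_on_def)
    fix x u v e :: "complex^'n" assume x: "x \<in> S"
    have "FD (\<lambda>q. - \<Gamma> q v e) x u = - FD (\<lambda>q. \<Gamma> q v e) x u" for u v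
      by (rule FD_bounded_linear[OF bounded_linear_minus[OF bounded_linear_ident] smooth_on_differentiable[OF sm\<Gamma> x]])
    then show "FD (\<lambda>q. - \<Gamma> q v e) x u + - \<Gamma> x v (- \<Gamma> x u e) = FD (\<lambda>q. - \<Gamma> q u e) x v + - \<Gamma> x u (- \<Gamma> x v e)"
      using flat_const[OF flat \<Gamma> x, of v e u] by (simp add: bilinear_rneg[OF bil[OF x]] algebra_simps)
  qed (use S c in auto)
  then show ?thesis by blast
qed

lemma special_coordinates:
  assumes c: "c \<in> S" and sym: "local_symplectic S \<omega>" and par: "local_parallel S \<Gamma> \<omega>"
  shows "\<exists>r>0. ball c r \<subseteq> S \<and> (\<exists>\<Phi> :: complex^'n \<Rightarrow> complex^('n + 'n). holo_on (ball c r) \<Phi> \<and>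
    inj (\<lambda>v. \<chi> i. FD \<Phi> c v $ Inl i) \<and>
    affine_map_on (ball c r) \<Gamma> (\<lambda>q. re_parts (\<Phi> q)) \<and>
    (\<forall>x\<in>ball c r. inj (\<lambda>v. re_parts (FD \<Phi> x v)) \<and>
      (\<forall>u v. \<omega> x u v = 2 * std_form (re_parts (FD \<Phi> x u)) (re_parts (FD \<Phi> x v)))))"
proof -
  note bil = local_connection_bilinear[OF \<Gamma>]
  have bil\<omega>: "bilinear (\<omega> x)" and alt: "\<omega> x u u = 0" and nd: "(\<And>v. \<omega> x u v = 0) \<Longrightarrow> u = 0"
    and sm\<omega>: "smooth_on S (\<lambda>x. \<omega> x u v)" if "x \<in> S" for x u v
    using sym that unfolding local_symplectic_def local_2form_def by blast+
  obtain \<xi> \<eta> :: "'n \<Rightarrow> complex^'n" where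
    \<xi>\<eta>: "\<And>u v. \<omega> c u v = 2 * (\<Sum>i\<in>UNIV. (\<xi> i \<bullet> u) * (\<eta> i \<bullet> v) - (\<xi> i \<bullet> v) * (\<eta> i \<bullet> u))"
    and inj\<xi>: "inj (covec \<xi>)"
    using symplectic_normal_form_totally_complex[OF bil\<omega>[OF c] alt[OF c] nd[OF c]] by blast
  obtain r1 where r1: "r1 > 0" "ball c r1 \<subseteq> S" and aff: "\<And>\<alpha>. \<exists>f a. a c = \<alpha> \<and> (\<forall>x\<in>ball c r1.
    (f has_derivative (\<lambda>v. Complex (a x \<bullet> v) (- (a x \<bullet> (\<i> *s v))))) (at x) \<and>
    (a has_derivative (\<lambda>v. cotr \<Gamma> x v (a x))) (at x))"
    using affine_holomorphic_functions[OF c] by blast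
  obtain r2 where r2: "r2 > 0" "ball c r2 \<subseteq> S" and parf: "\<And>e. \<exists>P. P c = e \<and>
    (\<forall>x\<in>ball c r2. (P has_derivative (\<lambda>v. - \<Gamma> x v (P x))) (at x))"
    using parallel_vector_fields[OF c] by blast
  define r where "r = min r1 r2"
  let ?B = "ball c r"
  have r: "r > 0" "?B \<subseteq> S" "?B \<subseteq> ball c r1" "?B \<subseteq> ball c r2" using r1 r2 by (auto simp: r_def)
  have cB: "c \<in> ?B" using r by simp
  \<comment> \<open>The \<xi> half of the coframe starts the coordinates z^i, the \<eta> half the
    functions w_i.\<close>
  define \<alpha> where "\<alpha> k = (case k of Inl i \<Rightarrow> \<xi> i | Inr i \<Rightarrow> \<eta> i)" for k
  define Q where "Q k f a \<longleftrightarrow> a c = \<alpha> k \<and> (\<forall>x\<in>?B. (f has_derivative (\<lambda>v. Complex (a x \<bullet> v) (- (a x \<bullet> (\<i> *s v))))) (at x) \<and>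
    (a has_derivative (\<lambda>v. cotr \<Gamma> x v (a x))) (at x))" for k f a
  have "\<exists>f a. Q k f a" for k
    using aff[of "\<alpha> k"] r(3) unfolding Q_def by (meson subsetD)
  then have "\<exists>f. \<forall>k. \<exists>a. Q k (f k) a" by (intro choice allI)
  then obtain f where "\<forall>k. \<exists>a. Q k (f k) a" ..
  then have "\<exists>a. \<forall>k. Q k (f k) (a k)" by (rule choice)
  then obtain a where Q: "\<forall>k. Q k (f k) (a k)" ..
  have ac: "a k c = \<alpha> k"
    and f: "x \<in> ?B \<Longrightarrow> (f k has_derivative (\<lambda>v. Complex (a k x \<bullet> v) (- (a k x \<bullet> (\<i> *s v))))) (at x)"
    and a: "x \<in> ?B \<Longrightarrow> (a k has_derivative (\<lambda>v. cotr \<Gamma> x v (a k x))) (at x)" for k x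
    using Q[rule_format, of k] unfolding Q_def by simp_all
  define \<Phi> :: "complex^'n \<Rightarrow> complex^('n + 'n)" where "\<Phi> x = (\<chi> k. f k x)" for x
  define h where "h q = re_parts (\<Phi> q)" for q
  have holo: "holo_on ?B \<Phi>"
    unfolding holo_on_iff_holo_fun_on holo_fun_on_def
  proof (intro allI ballI conjI)
    fix k x d v assume x: "x \<in> ?B"
    show "(\<lambda>x. \<Phi> x $ k) differentiable (at x)"
      using Derivative.differentiableI[OF f[OF x]] by (simp add: \<Phi>_def)
    have "Complex (a k x \<bullet> (d *s v)) (- (a k x \<bullet> (\<i> *s (d *s v)))) = d * Complex (a k x \<bullet> v) (- (a k x \<bullet> (\<i> *s v)))"
      using covec_scalar[of "\<lambda>_. a k x" d v] by (simp add: covec_def vec_eq_iff)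
    then show "FD (\<lambda>x. \<Phi> x $ k) x (d *s v) = d * FD (\<lambda>x. \<Phi> x $ k) x v"
      by (simp add: \<Phi>_def FD_eq[OF f[OF x]])
  qed
  then have sm\<Phi>: "smooth_on ?B \<Phi>" by (intro holo_on_smooth) auto
  have sh: "smooth_on ?B h"
    unfolding h_def[abs_def] by (rule smooth_on_bounded_linear[OF bounded_linear_re_parts open_ball sm\<Phi>])
  have FD\<Phi>: "FD \<Phi> x v $ k = Complex (a k x \<bullet> v) (- (a k x \<bullet> (\<i> *s v)))" if "x \<in> ?B" for x v k
    using FD_vec_nth[OF smooth_on_differentiable[OF sm\<Phi> that], of k v, symmetric]
    by (simp add: \<Phi>_def FD_eq[OF f[OF that]])
  have FDh: "FD h x v = re_parts (FD \<Phi> x v)" if "x \<in> ?B" for x v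
    unfolding h_def[abs_def] by (rule FD_bounded_linear[OF bounded_linear_re_parts smooth_on_differentiable[OF sm\<Phi> that]])
  have FDhk: "FD h x v $ k = a k x \<bullet> v" if "x \<in> ?B" for x v k
    by (simp add: FDh[OF that] re_parts_def FD\<Phi>[OF that])
  have affh: "affine_map_on ?B \<Gamma> h"
    unfolding affine_map_on_def
  proof (intro ballI allI)
    fix x u v assume x: "x \<in> ?B"
    have "FD (\<lambda>q. FD h q v) x u $ k = FD h x (\<Gamma> x u v) $ k" for k
    proof -
      have "FD (\<lambda>q. FD h q v) x u $ k = FD (\<lambda>q. FD h q v $ k) x u"
        by (rule FD_vec_nth[OF smooth_on_differentiable[OF smooth_on_FD[OF sh] x], symmetric])
      also have "\<dots> = FD (\<lambda>q. a k q \<bullet> v) x u"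
        using FD_cong[OF open_ball x FDhk] by simp
      also have "\<dots> = cotr \<Gamma> x u (a k x) \<bullet> v"
        using FD_eq[OF has_derivative_inner_left[OF a[OF x]]] by simp
      also have "\<dots> = FD h x (\<Gamma> x u v) $ k"
        using x r(2) by (simp add: cotr_inner[OF bil] FDhk subset_iff)
      finally show ?thesis .
    qed
    then show "FD (\<lambda>q. FD h q v) x u = FD h x (\<Gamma> x u v)" by (simp add: vec_eq_iff)
  qed
  have "\<exists>P. P c = e \<and> (\<forall>x\<in>?B. (P has_derivative (\<lambda>v. - \<Gamma> x v (P x))) (at x))" for e
  proof -
    obtain P where "P c = e" "\<forall>x\<in>ball c r2. (P has_derivative (\<lambda>v. - \<Gamma> x v (P x))) (at x)"
      using parf[of e] by blast
    then show ?thesis using subsetD[OF r(4)] by (intro exI[of _ P]) blast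
  qed
  then have "\<exists>P. \<forall>e. P e c = e \<and> (\<forall>x\<in>?B. (P e has_derivative (\<lambda>v. - \<Gamma> x v (P e x))) (at x))"
    by (intro choice allI)
  then obtain P where PP: "\<forall>e. P e c = e \<and> (\<forall>x\<in>?B. (P e has_derivative (\<lambda>v. - \<Gamma> x v (P e x))) (at x))" ..
  have Pc: "P e c = e" and P: "x \<in> ?B \<Longrightarrow> (P e has_derivative (\<lambda>v. - \<Gamma> x v (P e x))) (at x)" for e x
    using PP by simp_all
  have const: "g x = g c" if "\<And>y. y \<in> ?B \<Longrightarrow> (g has_derivative (\<lambda>v. 0)) (at y)" "x \<in> ?B" for g :: "complex^'n \<Rightarrow> real" and x
    by (rule has_derivative_zero_unique[OF convex_ball has_derivative_at_withinI[OF that(1)] that(2) cB])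
  \<comment> \<open>\<open>a k\<close> and \<open>P e\<close> are parallel, so their pairing has
    derivative zero and keeps its value at \<open>c\<close>.\<close>
  have hP: "FD h x (P e x) = FD h c e" if x: "x \<in> ?B" for x e
  proof -
    have "a k x \<bullet> P e x = a k c \<bullet> P e c" for k
    proof (rule const[OF _ x])
      fix y assume y: "y \<in> ?B"
      have "((\<lambda>q. a k q \<bullet> P e q) has_derivative (\<lambda>v. a k y \<bullet> (- \<Gamma> y v (P e y)) + cotr \<Gamma> y v (a k y) \<bullet> P e y)) (at y)"
        by (rule has_derivative_inner[OF a[OF y] P[OF y]])
      then show "((\<lambda>q. a k q \<bullet> P e q) has_derivative (\<lambda>v. 0)) (at y)"
        using y r(2) by (simp add: cotr_inner[OF bil] subset_iff)
    qed
    then show ?thesis by (simp add: vec_eq_iff FDhk[OF x] FDhk[OF cB] Pc)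
  qed
  have \<omega>P: "\<omega> x (P e x) (P e' x) = \<omega> c e e'" if x: "x \<in> ?B" for x e e'
  proof -
    have "\<omega> x (P e x) (P e' x) = \<omega> c (P e c) (P e' c)"
    proof (rule const[OF _ x])
      fix y assume "y \<in> ?B"
      then have y: "y \<in> ?B" "y \<in> S" using r(2) by auto
      have "((\<lambda>q. \<omega> q (P e q) (P e' q)) has_derivative (\<lambda>w. FD (\<lambda>q. \<omega> q (P e y) (P e' y)) y w
          + \<omega> y (- \<Gamma> y w (P e y)) (P e' y) + \<omega> y (P e y) (- \<Gamma> y w (P e' y)))) (at y)"
        by (rule has_derivative_bilinear_field[OF S y(2) bil\<omega> smooth_on_differentiable[OF sm\<omega>[OF y(2)] y(2)] P[OF y(1)] P[OF y(1)]])
      then show "((\<lambda>q. \<omega> q (P e q) (P e' q)) has_derivative (\<lambda>v. 0)) (at y)"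
        by (simp add: parallel_const[OF par y(2)] bilinear_lneg[OF bil\<omega>[OF y(2)]] bilinear_rneg[OF bil\<omega>[OF y(2)]])
    qed
    then show ?thesis by (simp add: Pc)
  qed
  have lin: "linear (FD h x)" if "x \<in> ?B" for x by (rule smooth_on_linear_FD[OF sh that])
  have \<omega>c: "\<omega> c u v = 2 * std_form (FD h c u) (FD h c v)" for u v
    by (simp add: \<xi>\<eta> std_form_def FDhk[OF cB] ac \<alpha>_def)
  have "inj (FD h c)"
    unfolding linear_injective_0[OF lin[OF cB]]
  proof (intro allI impI)
    fix u assume "FD h c u = 0"
    then have "\<omega> c u v = 0" for v by (simp add: \<omega>c bilinear_lzero[OF bilinear_std_form])
    then show "u = 0" by (rule nd[OF c])
  qed
  then have surj: "surj (FD h c)"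
    by (rule linear_injective_imp_surjective[OF lin[OF cB]]) simp
  \<comment> \<open>The parallel fields carry surjectivity of \<open>FD h\<close> from
    \<open>c\<close> to \<open>x\<close>; source and target have the same real dimension.\<close>
  have injx: "inj (FD h x)" if x: "x \<in> ?B" for x
  proof (rule linear_surjective_imp_injective[OF lin[OF x]])
    show "surj (FD h x)"
      unfolding surj_def
    proof
      fix y
      obtain e where "y = FD h c e" using surjD[OF surj] ..
      then have "y = FD h x (P e x)" by (simp only: hP[OF x])
      then show "\<exists>v. y = FD h x v" ..
    qed
  qed simp
  \<comment> \<open>By injectivity of \<open>FD h x\<close> every tangent vector at \<open>x\<close>
    is the value of a parallel field, and both sides are constant along such fields.\<close>
  have form: "\<omega> x u v = 2 * std_form (FD h x u) (FD h x v)" if x: "x \<in> ?B" for x u v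
  proof -
    obtain e e' where e: "FD h x u = FD h c e" "FD h x v = FD h c e'" using surj by (metis surjD)
    then have "FD h x u = FD h x (P e x)" "FD h x v = FD h x (P e' x)" by (simp_all only: hP[OF x])
    then have "u = P e x" "v = P e' x" using injD[OF injx[OF x]] by blast+
    then show ?thesis using \<omega>P[OF x] \<omega>c e by simp
  qed
  have "(\<lambda>v. \<chi> i. FD \<Phi> c v $ Inl i) = covec \<xi>"
    by (simp add: fun_eq_iff FD\<Phi>[OF cB] covec_def ac \<alpha>_def)
  then have "inj (\<lambda>v. \<chi> i. FD \<Phi> c v $ Inl i)" using inj\<xi> by simp
  moreover have "inj (\<lambda>v. re_parts (FD \<Phi> x v))" if "x \<in> ?B" for x
    using injx[OF that] FDh[OF that] by (simp add: inj_def)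
  moreover have "\<omega> x u v = 2 * std_form (re_parts (FD \<Phi> x u)) (re_parts (FD \<Phi> x v))" if "x \<in> ?B" for x u v
    using form[OF that] by (simp add: FDh[OF that])
  ultimately show ?thesis
    using r(1,2) holo affh unfolding h_def[abs_def] by blast
qed

end

section \<open>The local model\<close>

lemma FD_compose:
  assumes "f differentiable (at (g x))" "g differentiable (at x)"
  shows "FD (\<lambda>q. f (g q)) x v = FD f (g x) (FD g x v)" "(\<lambda>q. f (g q)) differentiable (at x)"
proof -
  have D: "((\<lambda>q. f (g q)) has_derivative (\<lambda>v. FD f (g x) (FD g x v))) (at x)"
    by (rule has_derivative_compose[OF FD_has[OF assms(2)] FD_has[OF assms(1)]])
  show "FD (\<lambda>q. f (g q)) x v = FD f (g x) (FD g x v)" by (simp add: FD_eq[OF D])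
  show "(\<lambda>q. f (g q)) differentiable (at x)" by (rule Derivative.differentiableI[OF D])
qed

lemma holo_on_compose:
  assumes "holo_on V f" "holo_on B g" "g ` B \<subseteq> V"
  shows "holo_on B (\<lambda>q. f (g q))"
  unfolding holo_on_def
proof (intro ballI conjI allI)
  fix x c v assume x: "x \<in> B"
  then have d: "f differentiable (at (g x))" "g differentiable (at x)"
    and l: "\<And>c v. FD f (g x) (c *s v) = c *s FD f (g x) v" "\<And>c v. FD g x (c *s v) = c *s FD g x v"
    using assms by (auto simp: holo_on_def)
  show "(\<lambda>q. f (g q)) differentiable (at x)" by (rule FD_compose(2)[OF d])
  show "FD (\<lambda>q. f (g q)) x (c *s v) = c *s FD (\<lambda>q. f (g q)) x v"
    by (simp add: FD_compose(1)[OF d] l)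
qed

lemma holo_on_cong:
  assumes "open B" "\<And>x. x \<in> B \<Longrightarrow> f x = g x"
  shows "holo_on B f \<longleftrightarrow> holo_on B g"
  unfolding holo_on_def using differentiable_cong_open[OF assms(1) _ assms(2)] FD_cong[OF assms(1) _ assms(2)]
  by auto

lemma holo_on_subset: "holo_on S f \<Longrightarrow> T \<subseteq> S \<Longrightarrow> holo_on T f"
  by (auto simp: holo_on_def)

lemma holo_on_differentiable: "holo_on S f \<Longrightarrow> x \<in> S \<Longrightarrow> f differentiable (at x)"
  by (simp add: holo_on_def)

section \<open>Transformation of connections under holomorphic coordinate changes\<close>

lemma FD_second_order_chain:
  fixes f :: "complex^'m \<Rightarrow> 'b::euclidean_space" and g :: "complex^'n \<Rightarrow> complex^'m"
  assumes B: "open B" "x \<in> B" and V: "open V" "g ` B \<subseteq> V" and f: "smooth_on V f" and g: "smooth_on B g"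
  shows "FD (\<lambda>q. FD (\<lambda>z. f (g z)) q v) x u =
    FD (\<lambda>y. FD f y (FD g x v)) (g x) (FD g x u) + FD f (g x) (FD (\<lambda>q. FD g q v) x u)"
proof -
  have gx: "g q \<in> V" if "q \<in> B" for q using V(2) that by blast
  have dfg: "((\<lambda>q. FD f (g q) w) has_derivative (\<lambda>u. FD (\<lambda>y. FD f y w) (g x) (FD g x u))) (at x)" for w
    by (rule has_derivative_compose[OF smooth_on_FD_has[OF g B(2)] smooth_on_FD_has[OF smooth_on_FD[OF f] gx[OF B(2)]]])
  have "FD (\<lambda>q. FD (\<lambda>z. f (g z)) q v) x u = FD (\<lambda>q. FD f (g q) (FD g q v)) x u"
    using FD_cong[OF B FD_compose(1)[OF smooth_on_differentiable[OF f gx] smooth_on_differentiable[OF g]]] by simp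
  also have "((\<lambda>q. FD f (g q) (FD g q v)) has_derivative
      (\<lambda>w. FD (\<lambda>q. FD f (g q) (FD g x v)) x w + FD f (g x) (FD (\<lambda>q. FD g q v) x w))) (at x)"
    by (rule has_derivative_linear_field[where L = "\<lambda>q w. FD f (g q) w", OF B smooth_on_linear_FD[OF f gx]
          Derivative.differentiableI[OF dfg] smooth_on_FD_has[OF smooth_on_FD[OF g] B(2)]])
  from FD_eq[OF this] have "FD (\<lambda>q. FD f (g q) (FD g q v)) x u
      = FD (\<lambda>q. FD f (g q) (FD g x v)) x u + FD f (g x) (FD (\<lambda>q. FD g q v) x u)" by simp
  also have "FD (\<lambda>q. FD f (g q) (FD g x v)) x u = FD (\<lambda>y. FD f y (FD g x v)) (g x) (FD g x u)"
    by (simp add: FD_eq[OF dfg])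
  finally show ?thesis .
qed

text \<open>The transformation law of Christoffel maps, which is the pointwise form of \<^const>\<open>conn_related\<close>.\<close>

definition christoffel_law :: "(complex^'n) set \<Rightarrow> (complex^'n \<Rightarrow> complex^'n) \<Rightarrow> 'n::finite christoffel \<Rightarrow> 'n christoffel \<Rightarrow> bool" where
  "christoffel_law S g \<Gamma> \<Gamma>' \<longleftrightarrow> (\<forall>p\<in>S. \<forall>u v.
    FD (\<lambda>q. FD g q v) p u + \<Gamma>' (g p) (FD g p u) (FD g p v) = FD g p (\<Gamma> p u v))"

text \<open>Differentiating \<open>Y' (g q) = FD g q (Y q)\<close> along \<open>X\<close> produces
  the second derivative of \<open>g\<close>, which the law trades for the difference of the two
  Christoffel terms.\<close>

lemma christoffel_law_imp_conn_related:
  fixes g :: "complex^'n::finite \<Rightarrow> complex^'n"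
  assumes S: "open S" and g: "smooth_on S g" and law: "christoffel_law S g \<Gamma> \<Gamma>'"
  shows "conn_related S g \<Gamma> \<Gamma>'"
  unfolding conn_related_def
proof (intro allI impI)
  fix X Y X' Y' :: "complex^'n \<Rightarrow> complex^'n"
  assume Y: "smooth_on S Y" and Y': "smooth_on (g ` S) Y'"
    and X: "vf_related S g X X'" and YY': "vf_related S g Y Y'"
  show "vf_related S g (covd \<Gamma> X Y) (covd \<Gamma>' X' Y')"
    unfolding vf_related_def
  proof
    fix p assume p: "p \<in> S"
    have X'p: "X' (g p) = FD g p (X p)" using X p by (simp add: vf_related_def)
    have Y'q: "Y' (g q) = FD g q (Y q)" if "q \<in> S" for q using YY' that by (simp add: vf_related_def)
    have "FD Y' (g p) (FD g p (X p)) = FD (\<lambda>q. Y' (g q)) p (X p)"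
      by (rule FD_compose(1)[symmetric, OF smooth_on_differentiable[OF Y'] smooth_on_differentiable[OF g p]]) (use p in blast)
    also have "\<dots> = along X (along Y g) p"
      using FD_cong[OF S p Y'q] by (simp add: along_def[abs_def])
    also have "\<dots> = FD (\<lambda>q. FD g q (Y p)) p (X p) + FD g p (along X Y p)"
      by (rule along_along[OF S g smooth_on_differentiable[OF Y p] p])
    finally have "covd \<Gamma>' X' Y' (g p) = FD (\<lambda>q. FD g q (Y p)) p (X p) + \<Gamma>' (g p) (FD g p (X p)) (FD g p (Y p))
        + FD g p (along X Y p)"
      by (simp add: covd_def along_def X'p Y'q[OF p])
    also have "\<dots> = FD g p (covd \<Gamma> X Y p)"
      using law p by (simp add: christoffel_law_def covd_def linear_add[OF smooth_on_linear_FD[OF g p]] add.commute)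
    finally show "covd \<Gamma>' X' Y' (g p) = FD g p (covd \<Gamma> X Y p)" .
  qed
qed

text \<open>The relation is tested on constant fields and their push-forwards. These are fields on
  the image only by means of the inverse \<open>k\<close>, and they are smooth because
  \<open>k\<close> is holomorphic on an open image.\<close>

lemma conn_related_imp_christoffel_law:
  assumes S: "open S" and g: "holo_on S g" and T: "open (g ` S)" and k: "holo_on (g ` S) k"
    and kg: "\<And>p. p \<in> S \<Longrightarrow> k (g p) = p" and rel: "conn_related S g \<Gamma> \<Gamma>'"
  shows "christoffel_law S g \<Gamma> \<Gamma>'"
  unfolding christoffel_law_def
proof (intro ballI allI)
  fix p u v assume p: "p \<in> S"
  define X' where "X' w y = FD g (k y) w" for w y
  have kT: "k ` g ` S \<subseteq> S" using kg by auto
  have sX': "smooth_on (g ` S) (X' w)" for w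
    unfolding X'_def by (rule holo_on_smooth[OF T holo_on_compose[OF holo_on_FD[OF S g] k kT]])
  have rX': "vf_related S g (\<lambda>_. w) (X' w)" for w
    by (simp add: vf_related_def X'_def kg)
  have "vf_related S g (covd \<Gamma> (\<lambda>_. u) (\<lambda>_. v)) (covd \<Gamma>' (X' u) (X' v))"
    using rel smooth_on_const sX' rX' unfolding conn_related_def by blast
  then have "covd \<Gamma>' (X' u) (X' v) (g p) = FD g p (\<Gamma> p u v)"
    using p by (simp add: vf_related_def covd_const)
  moreover have "covd \<Gamma>' (X' u) (X' v) (g p) = FD (X' v) (g p) (FD g p u) + \<Gamma>' (g p) (FD g p u) (FD g p v)"
    by (simp add: covd_def along_def X'_def kg[OF p])
  moreover have "FD (X' v) (g p) (FD g p u) = FD (\<lambda>q. FD g q v) p u"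
  proof -
    have "FD (X' v) (g p) (FD g p u) = FD (\<lambda>q. X' v (g q)) p u"
      by (rule FD_compose(1)[symmetric, OF smooth_on_differentiable[OF sX'] holo_on_differentiable[OF g p]]) (use p in blast)
    also have "\<dots> = FD (\<lambda>q. FD g q v) p u"
      by (subst FD_cong[OF S p, of _ "\<lambda>q. FD g q v"]) (simp_all add: X'_def kg)
    finally show ?thesis .
  qed
  ultimately show "FD (\<lambda>q. FD g q v) p u + \<Gamma>' (g p) (FD g p u) (FD g p v) = FD g p (\<Gamma> p u v)" by simp
qed

lemma christoffel_law_compose:
  assumes S: "open S" and g: "smooth_on S g" and T: "open T" "g ` S \<subseteq> T" and f: "smooth_on T f"
    and 1: "christoffel_law S g \<Gamma> \<Gamma>'" and 2: "christoffel_law T f \<Gamma>' \<Gamma>''"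
  shows "christoffel_law S (\<lambda>q. f (g q)) \<Gamma> \<Gamma>''"
  unfolding christoffel_law_def
proof (intro ballI allI)
  fix p u v assume p: "p \<in> S"
  then have gp: "g p \<in> T" using T by blast
  have D: "FD (\<lambda>q. f (g q)) p w = FD f (g p) (FD g p w)" for w
    by (rule FD_compose(1)[OF smooth_on_differentiable[OF f gp] smooth_on_differentiable[OF g p]])
  have e1: "FD (\<lambda>q. FD g q v) p u + \<Gamma>' (g p) (FD g p u) (FD g p v) = FD g p (\<Gamma> p u v)"
    using 1 p by (simp add: christoffel_law_def)
  have e2: "FD (\<lambda>q. FD f q (FD g p v)) (g p) (FD g p u) + \<Gamma>'' (f (g p)) (FD f (g p) (FD g p u)) (FD f (g p) (FD g p v))
      = FD f (g p) (\<Gamma>' (g p) (FD g p u) (FD g p v))"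
    using 2 gp by (simp add: christoffel_law_def)
  show "FD (\<lambda>q. FD (\<lambda>q. f (g q)) q v) p u + \<Gamma>'' (f (g p)) (FD (\<lambda>q. f (g q)) p u) (FD (\<lambda>q. f (g q)) p v)
      = FD (\<lambda>q. f (g q)) p (\<Gamma> p u v)"
    unfolding D FD_second_order_chain[OF S p T f g] e1[symmetric] linear_add[OF smooth_on_linear_FD[OF f gp]] e2[symmetric]
    by simp
qed

lemma christoffel_law_subset: "christoffel_law S g \<Gamma> \<Gamma>' \<Longrightarrow> T \<subseteq> S \<Longrightarrow> christoffel_law T g \<Gamma> \<Gamma>'"
  by (auto simp: christoffel_law_def)

lemma christoffel_law_cong:
  assumes S: "open S" and fg: "\<And>q. q \<in> S \<Longrightarrow> f q = g q"
  shows "christoffel_law S f \<Gamma> \<Gamma>' \<longleftrightarrow> christoffel_law S g \<Gamma> \<Gamma>'"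
proof -
  have 1: "FD f q = FD g q" if "q \<in> S" for q by (rule FD_cong[OF S that fg])
  have "FD (\<lambda>q. FD f q v) p = FD (\<lambda>q. FD g q v) p" if "p \<in> S" for p v
    by (rule FD_cong[OF S that]) (simp add: 1)
  then show ?thesis by (simp add: christoffel_law_def 1 fg)
qed

text \<open>The real inverse function theorem suffices: the differential of the inverse is the
  inverse of a complex linear bijection and is therefore complex linear.\<close>

lemma holo_inverse_function:
  fixes Z :: "complex^'n \<Rightarrow> complex^'n"
  assumes S: "open S" "c \<in> S" and Z: "holo_on S Z" and inj: "inj (FD Z c)"
  shows "\<exists>B V g. open B \<and> B \<subseteq> S \<and> c \<in> B \<and> open V \<and> homeomorphism B V Z g \<and> holo_on V g \<and>
    (\<forall>x\<in>B. bij (FD Z x))"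
proof -
  have sZ: "smooth_on S Z" by (rule holo_on_smooth[OF S(1) Z])
  define Z' where "Z' x = Blinfun (FD Z x)" for x
  have Z': "blinfun_apply (Z' x) = FD Z x" if "x \<in> S" for x
    unfolding Z'_def
    by (rule bounded_linear_Blinfun_apply) (rule has_derivative_bounded_linear[OF smooth_on_FD_has[OF sZ that]])
  have lin: "linear (FD Z c)" by (rule smooth_on_linear_FD[OF sZ S(2)])
  obtain k where k: "linear k" "k \<circ> FD Z c = id" using linear_injective_left_inverse[OF lin inj] by blast
  define K where "K = Blinfun k"
  have K: "blinfun_apply K = k"
    unfolding K_def by (rule bounded_linear_Blinfun_apply) (use k(1) linear_conv_bounded_linear in blast)
  have der: "(Z has_derivative blinfun_apply (Z' x)) (at x)" if "x \<in> S" for x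
    using smooth_on_FD_has[OF sZ that] by (simp add: Z'[OF that])
  have cont: "continuous_on S Z'"
  proof (rule continuous_on_blinfun_componentwise)
    fix i :: "complex^'n"
    show "continuous_on S (\<lambda>x. blinfun_apply (Z' x) i)"
      by (rule continuous_on_eq[OF smooth_on_continuous[OF smooth_on_FD[OF sZ]]]) (simp add: Z')
  qed
  have inv: "K o\<^sub>L Z' c = id_blinfun"
    by (rule blinfun_eqI) (use k(2) in \<open>simp add: K Z'[OF S(2)] fun_eq_iff\<close>)
  have "\<exists>B V g g'. open B \<and> B \<subseteq> S \<and> c \<in> B \<and> open V \<and> homeomorphism B V Z g \<and>
      (\<forall>y\<in>V. (g has_derivative (g' y)) (at y) \<and> g' y = Hilbert_Choice.inv (blinfun_apply (Z' (g y))) \<and>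
        bij (blinfun_apply (Z' (g y))))"
  proof (rule inverse_function_theorem[OF S(1) der cont S(2) inv])
    fix B V g and g' :: "complex^'n \<Rightarrow> complex^'n \<Rightarrow> complex^'n"
    assume "open B" "B \<subseteq> S" "c \<in> B" "open V" "homeomorphism B V Z g"
      "\<And>y. y \<in> V \<Longrightarrow> (g has_derivative (g' y)) (at y)"
      "\<And>y. y \<in> V \<Longrightarrow> g' y = Hilbert_Choice.inv (blinfun_apply (Z' (g y)))"
      "\<And>y. y \<in> V \<Longrightarrow> bij (blinfun_apply (Z' (g y)))"
    then show ?thesis by (intro exI[of _ B] exI[of _ V] exI[of _ g] exI[of _ g']) simp
  qed
  then obtain B V g g' where B: "open B" "B \<subseteq> S" "c \<in> B" and V: "open V" "homeomorphism B V Z g"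
    and g: "\<And>y. y \<in> V \<Longrightarrow> (g has_derivative (g' y)) (at y)"
      "\<And>y. y \<in> V \<Longrightarrow> g' y = Hilbert_Choice.inv (blinfun_apply (Z' (g y)))"
    and bij: "\<And>y. y \<in> V \<Longrightarrow> bij (blinfun_apply (Z' (g y)))"
    by blast
  have gV: "g y \<in> B" if "y \<in> V" for y using V(2) that by (auto simp: homeomorphism_def)
  have bijB: "bij (FD Z x)" if "x \<in> B" for x
  proof -
    have "Z x \<in> V" "g (Z x) = x" using V(2) that by (auto simp: homeomorphism_def)
    then show ?thesis using bij[of "Z x"] Z'[of x] B that by auto
  qed
  have "holo_on V g"
    unfolding holo_on_def
  proof (intro ballI conjI allI)
    fix y a v assume y: "y \<in> V"
    show "g differentiable (at y)" by (rule Derivative.differentiableI[OF g(1)[OF y]])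
    have gS: "g y \<in> S" using gV[OF y] B by blast
    have D: "FD g y = Hilbert_Choice.inv (FD Z (g y))" by (simp add: FD_eq[OF g(1)[OF y]] g(2)[OF y] Z'[OF gS])
    have b: "bij (FD Z (g y))" by (rule bijB[OF gV[OF y]])
    have l: "FD Z (g y) (a *s w) = a *s FD Z (g y) w" for w using Z gS by (simp add: holo_on_def)
    have "FD Z (g y) (FD g y (a *s v)) = FD Z (g y) (a *s FD g y v)"
      by (simp add: l D surj_f_inv_f[OF bij_is_surj[OF b]])
    then show "FD g y (a *s v) = a *s FD g y v" using bij_is_inj[OF b] by (simp add: inj_eq)
  qed
  then show ?thesis using B V bijB by blast
qed

text \<open>In special coordinates \<open>\<Phi> = (Z, W)\<close> the chart \<open>Z\<close> turns \<open>\<Phi>\<close> into the graph of \<open>F = W \<circ> Z\<^sup>-\<^sup>1\<close>.\<close>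

lemma local_special_symplectic_model:
  fixes S :: "(complex^'n::finite) set" and \<Gamma> :: "'n christoffel"
  assumes S: "open S" and \<Gamma>: "local_connection S \<Gamma>"
    and flat: "local_flat S \<Gamma>" and tf: "local_torsionfree S \<Gamma>" and special: "local_special S \<Gamma>"
    and sym: "local_symplectic S \<omega>" and par: "local_parallel S \<Gamma> \<omega>" and c: "c \<in> S"
  shows "\<exists>B V Z g F \<Gamma>'. open B \<and> B \<subseteq> S \<and> c \<in> B \<and> open V \<and> homeomorphism B V Z g \<and>
    holo_on B Z \<and> holo_on V g \<and> regular_1form V F \<and> induced_connection V (one_form_map F) \<Gamma>' \<and>
    christoffel_law B Z \<Gamma> \<Gamma>' \<and> form_related B Z \<omega> (induced_form (one_form_map F))"
proof -
  obtain r and \<Phi> :: "complex^'n \<Rightarrow> complex^('n + 'n)" where r: "r > 0" "ball c r \<subseteq> S"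
    and holo: "holo_on (ball c r) \<Phi>" and injc: "inj (\<lambda>v. \<chi> i. FD \<Phi> c v $ Inl i)"
    and aff: "affine_map_on (ball c r) \<Gamma> (\<lambda>q. re_parts (\<Phi> q))"
    and inj: "\<And>x. x \<in> ball c r \<Longrightarrow> inj (\<lambda>v. re_parts (FD \<Phi> x v))"
    and form: "\<And>x u v. x \<in> ball c r \<Longrightarrow> \<omega> x u v = 2 * std_form (re_parts (FD \<Phi> x u)) (re_parts (FD \<Phi> x v))"
    using special_coordinates[OF S \<Gamma> flat tf special c sym par] by blast
  have cB: "c \<in> ball c r" using r by simp
  define Z :: "complex^'n \<Rightarrow> complex^'n" where "Z x = (\<chi> i. \<Phi> x $ Inl i)" for x
  define W :: "complex^'n \<Rightarrow> complex^'n" where "W x = (\<chi> i. \<Phi> x $ Inr i)" for x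
  have hZ: "holo_on (ball c r) Z" and hW: "holo_on (ball c r) W"
    using holo by (simp_all add: holo_on_iff_holo_fun_on Z_def W_def)
  have FDZ: "FD Z x v $ i = FD \<Phi> x v $ Inl i" if "x \<in> ball c r" for x v i
    using FD_vec_nth[OF holo_on_differentiable[OF hZ that], of i v] FD_vec_nth[OF holo_on_differentiable[OF holo that], of "Inl i" v]
    by (simp add: Z_def)
  have "FD Z c = (\<lambda>v. \<chi> i. FD \<Phi> c v $ Inl i)"
    by (simp add: fun_eq_iff vec_eq_iff FDZ[OF cB])
  then have "inj (FD Z c)" using injc by simp
  from holo_inverse_function[OF open_ball cB hZ this]
  obtain B V g where B: "open B" "B \<subseteq> ball c r" "c \<in> B" and V: "open V" "homeomorphism B V Z g"
    and hg: "holo_on V g" and bij: "\<And>x. x \<in> B \<Longrightarrow> bij (FD Z x)" by blast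
  have gV: "g y \<in> B" "Z (g y) = y" if "y \<in> V" for y using V(2) that by (auto simp: homeomorphism_def)
  have ZB: "Z x \<in> V" "g (Z x) = x" if "x \<in> B" for x using V(2) that by (auto simp: homeomorphism_def)
  have xr: "x \<in> ball c r" if "x \<in> B" for x using B that by blast
  define F where "F y = W (g y)" for y
  have hF: "holo_on V F"
    unfolding F_def by (rule holo_on_compose[OF hW hg]) (use gV B in blast)
  have h\<phi>: "holo_on V (one_form_map F)" by (rule holo_on_one_form_map[OF hF])
  have \<Phi>: "one_form_map F (Z x) = \<Phi> x" if "x \<in> B" for x
  proof -
    have "F (Z x) = W x" by (simp add: F_def ZB[OF that])
    then show ?thesis unfolding one_form_map_def by (simp add: vec_eq_iff Z_def W_def split: sum.split)
  qed
  have FD\<Phi>: "FD (one_form_map F) (Z x) (FD Z x v) = FD \<Phi> x v" if x: "x \<in> B" for x v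
  proof -
    have "FD (one_form_map F) (Z x) (FD Z x v) = FD (\<lambda>q. one_form_map F (Z q)) x v"
      by (rule FD_compose(1)[symmetric, OF holo_on_differentiable[OF h\<phi> ZB(1)[OF x]] holo_on_differentiable[OF hZ xr[OF x]]])
    also have "\<dots> = FD \<Phi> x v" by (simp only: FD_cong[OF B(1) x \<Phi>])
    finally show ?thesis .
  qed
  have reg: "regular_1form V F"
    unfolding regular_1form_def
  proof (intro conjI ballI hF)
    fix y assume y: "y \<in> V"
    note x = gV[OF y]
    define M :: "real^'n^'n" where "M = (\<chi> i j. Im (cpartial F i j y))"
    \<comment> \<open>A real kernel vector of Im \<partial>F gives a tangent vector with real image
      under d\<phi>. Pulled back by \<open>Z\<close> to \<open>u\<close>, this says that Re d\<Phi>
      vanishes on \<i> u, so injectivity of Re d\<Phi> gives u = 0.\<close>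
    have "s = 0" if s: "M *v s = 0" for s
    proof -
      define v :: "complex^'n" where "v = (\<chi> i. complex_of_real (s $ i))"
      have "Im (FD F y v $ i) = (M *v s) $ i" for i
        by (simp add: FD_holo_expand[OF hF y] M_def v_def matrix_vector_mult_def)
      then have 1: "im_parts (FD (one_form_map F) y v) $ k = 0" for k
        by (cases k) (simp_all add: im_parts_def FD_one_form_map[OF hF y] s v_def)
      obtain u where u: "v = FD Z (g y) u" using bij_is_surj[OF bij[OF x(1)]] by (metis surjD)
      have "im_parts (FD \<Phi> (g y) u) $ k = 0" for k
        using 1[of k] FD\<Phi>[OF x(1), of u] by (simp add: x(2) u)
      then have "im_parts (FD \<Phi> (g y) u) = 0" by (simp add: vec_eq_iff)
      moreover have "FD \<Phi> (g y) (\<i> *s u) = \<i> *s FD \<Phi> (g y) u"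
        using holo xr[OF x(1)] by (simp add: holo_on_def)
      ultimately have "re_parts (FD \<Phi> (g y) (\<i> *s u)) = 0" by (simp add: re_parts_i)
      moreover have "re_parts (FD \<Phi> (g y) 0) = 0"
        using linear_0[OF linear_frechet_derivative[OF holo_on_differentiable[OF holo xr[OF x(1)]]]]
        by (simp add: re_parts_def vec_eq_iff)
      ultimately have "\<i> *s u = 0" using injD[OF inj[OF xr[OF x(1)]]] by metis
      then have "u = 0" by (simp add: vec_eq_iff)
      then have "v = 0"
        using linear_0[OF linear_frechet_derivative[OF holo_on_differentiable[OF hZ xr[OF x(1)]]]] by (simp add: u)
      then show "s = 0" by (simp add: v_def vec_eq_iff)
    qed
    then show "invertible (\<chi> i j. Im (cpartial F i j y) :: real^'n^'n)"
      unfolding invertible_left_inverse matrix_left_invertible_ker M_def by blast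
  qed
  obtain \<Gamma>' where \<Gamma>': "induced_connection V (one_form_map F) \<Gamma>'"
    using induced_connection_exists[OF V(1) reg] by blast
  have aff': "affine_map_on V \<Gamma>' (real_coords F)" using \<Gamma>' induced_connection_iff[OF V(1) reg] by blast
  have s\<rho>: "smooth_on V (real_coords F)" by (rule smooth_real_coords[OF V(1) reg])
  have sZ: "smooth_on B Z" by (rule smooth_on_subset[OF holo_on_smooth[OF open_ball hZ] B(2)])
  have ZBV: "Z ` B \<subseteq> V" using ZB by blast
  have \<rho>\<Phi>: "real_coords F (Z q) = re_parts (\<Phi> q)" if "q \<in> B" for q by (simp add: real_coords_def \<Phi>[OF that])
  have FD\<rho>: "FD (real_coords F) (Z x) (FD Z x v) = FD (\<lambda>q. re_parts (\<Phi> q)) x v" if x: "x \<in> B" for x v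
  proof -
    have "FD (real_coords F) (Z x) (FD Z x v) = FD (\<lambda>q. real_coords F (Z q)) x v"
      by (rule FD_compose(1)[symmetric, OF smooth_on_differentiable[OF s\<rho> ZB(1)[OF x]] smooth_on_differentiable[OF sZ x]])
    then show ?thesis by (simp only: FD_cong[OF B(1) x \<rho>\<Phi>])
  qed
  \<comment> \<open>The second derivative of \<rho> o Z = Re \<Phi> is computed twice, by affinity
    for \<open>\<Gamma>\<close> and by the chain rule with affinity for \<open>\<Gamma>'\<close>.
    Cancelling the injective D\<rho> leaves the law.\<close>
  have law: "christoffel_law B Z \<Gamma> \<Gamma>'"
    unfolding christoffel_law_def
  proof (intro ballI allI)
    fix x u v assume x: "x \<in> B"
    note Zx = ZB(1)[OF x]
    let ?D = "FD (real_coords F) (Z x)"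
    have "?D (FD Z x (\<Gamma> x u v)) = FD (\<lambda>q. FD (\<lambda>q. re_parts (\<Phi> q)) q v) x u"
      using aff xr[OF x] by (simp add: FD\<rho>[OF x] affine_map_on_def)
    also have "\<dots> = FD (\<lambda>q. FD (\<lambda>q. real_coords F (Z q)) q v) x u"
    proof -
      have "FD (\<lambda>q. re_parts (\<Phi> q)) q v = FD (\<lambda>q. real_coords F (Z q)) q v" if "q \<in> B" for q
        by (simp only: FD_cong[OF B(1) that \<rho>\<Phi>])
      then show ?thesis by (rule FD_cong[OF B(1) x, THEN fun_cong])
    qed
    also have "\<dots> = FD (\<lambda>y. FD (real_coords F) y (FD Z x v)) (Z x) (FD Z x u) + ?D (FD (\<lambda>q. FD Z q v) x u)"
      by (rule FD_second_order_chain[OF B(1) x V(1) ZBV s\<rho> sZ])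
    also have "FD (\<lambda>y. FD (real_coords F) y (FD Z x v)) (Z x) (FD Z x u) = ?D (\<Gamma>' (Z x) (FD Z x u) (FD Z x v))"
      using aff' Zx by (simp add: affine_map_on_def)
    finally have "?D (FD (\<lambda>q. FD Z q v) x u + \<Gamma>' (Z x) (FD Z x u) (FD Z x v)) = ?D (FD Z x (\<Gamma> x u v))"
      by (simp add: linear_add[OF smooth_on_linear_FD[OF s\<rho> Zx]])
    then show "FD (\<lambda>q. FD Z q v) x u + \<Gamma>' (Z x) (FD Z x u) (FD Z x v) = FD Z x (\<Gamma> x u v)"
      by (rule injD[OF inj_FD_real_coords[OF V(1) reg Zx]])
  qed
  have "form_related B Z \<omega> (induced_form (one_form_map F))"
    unfolding form_related_def
    by (simp add: induced_form_def FD\<Phi> dx_wedge_dy_eq form[OF xr])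
  then show ?thesis
    using B V r(2) hg reg \<Gamma>' law holo_on_subset[OF hZ B(2)] by (meson order_trans)
qed

section \<open>Charts of a special symplectic manifold\<close>

context
  fixes M :: "('a, 'i, 'n::finite, 'z) special_data_scheme"
  assumes M: "complex_manifold M" and conn: "is_connection M"
begin

lemma
  assumes "i \<in> charts M"
  shows openin_cdom: "openin (mtop M) (cdom M i)" and open_cimage: "open (cimage M i)"
    and chart_homeomorphic: "homeomorphic_map (subtopology (mtop M) (cdom M i)) (top_of_set (cimage M i)) (coord M i)"
  using M assms by (auto simp: complex_manifold_def)

lemma topspace_chart: "i \<in> charts M \<Longrightarrow> topspace (subtopology (mtop M) (cdom M i)) = cdom M i"
  using openin_subset[OF openin_cdom] by auto

lemma inj_on_coord: "i \<in> charts M \<Longrightarrow> inj_on (coord M i) (cdom M i)"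
  using homeomorphic_imp_injective_map[OF chart_homeomorphic] topspace_chart by metis

lemma open_chart_image:
  assumes i: "i \<in> charts M" and O: "openin (mtop M) O'"
  shows "open (coord M i ` (cdom M i \<inter> O'))"
proof -
  have "openin (subtopology (mtop M) (cdom M i)) (cdom M i \<inter> O')"
    using O by (simp add: openin_subtopology_Int2)
  then have "openin (top_of_set (cimage M i)) (coord M i ` (cdom M i \<inter> O'))"
    using homeomorphic_imp_open_map[OF chart_homeomorphic[OF i]] by (simp add: open_map_def)
  then show ?thesis using open_cimage[OF i] by (simp add: openin_open_eq)
qed

lemma change_dom: "loc_dom M M id i j = coord M i ` (cdom M i \<inter> cdom M j)"
  by (auto simp: loc_dom_def)

lemma open_change_dom: "i \<in> charts M \<Longrightarrow> j \<in> charts M \<Longrightarrow> open (loc_dom M M id i j)"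
  unfolding change_dom by (intro open_chart_image openin_cdom)

lemma change_coord: "i \<in> charts M \<Longrightarrow> q \<in> cdom M i \<Longrightarrow> loc_rep M M id i j (coord M i q) = coord M j q"
  by (simp add: loc_rep_def inv_into_f_f[OF inj_on_coord])

lemma holo_change: "i \<in> charts M \<Longrightarrow> j \<in> charts M \<Longrightarrow> holo_on (loc_dom M M id i j) (loc_rep M M id i j)"
  using M by (simp add: complex_manifold_def)

lemma change_image:
  assumes "i \<in> charts M"
  shows "loc_rep M M id i j ` loc_dom M M id i j = loc_dom M M id j i"
proof -
  have "loc_rep M M id i j ` loc_dom M M id i j = (\<lambda>q. loc_rep M M id i j (coord M i q)) ` (cdom M i \<inter> cdom M j)"
    by (simp add: change_dom image_image)
  also have "\<dots> = coord M j ` (cdom M i \<inter> cdom M j)"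
    using assms by (intro image_cong) (auto simp: change_coord)
  finally show ?thesis by (simp add: change_dom Int_commute)
qed

text \<open>The opposite coordinate change is the holomorphic inverse that is needed to push
  constant fields forward.\<close>

lemma change_christoffel_law:
  assumes i: "i \<in> charts M" and j: "j \<in> charts M"
  shows "christoffel_law (loc_dom M M id i j) (loc_rep M M id i j) (conn M i) (conn M j)"
proof (rule conn_related_imp_christoffel_law[where k = "loc_rep M M id j i"])
  show "open (loc_rep M M id i j ` loc_dom M M id i j)"
    and "holo_on (loc_rep M M id i j ` loc_dom M M id i j) (loc_rep M M id j i)"
    using open_change_dom[OF j i] holo_change[OF j i] by (simp_all add: change_image[OF i])
  show "loc_rep M M id j i (loc_rep M M id i j p) = p" if "p \<in> loc_dom M M id i j" for p
    using that i j by (auto simp: change_dom change_coord)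
qed (use conn i j in \<open>auto simp: is_connection_def holo_change open_change_dom\<close>)

end

lemma open_part_simps [simp]:
  "mtop (open_part M W) = subtopology (mtop M) W" "charts (open_part M W) = charts M"
  "cdom (open_part M W) i = cdom M i \<inter> W" "coord (open_part M W) = coord M"
  "conn (open_part M W) = conn M" "form (open_part M W) = form M"
  by (simp_all add: open_part_def)

text \<open>The model is built in one chart \<open>i\<close> around \<open>p\<close>. The
  isomorphism has to be verified in every chart \<open>j\<close> of the atlas, which is reduced to
  chart \<open>i\<close> by composing with the coordinate change.\<close>

theorem special_symplectic_locally_one_form:
  fixes M :: "('a, 'i, 'n::finite) special_data"
  assumes special: "special_symplectic_manifold M" and p: "p \<in> topspace (mtop M)"
  shows "\<exists>W U F \<Gamma> f. openin (mtop M) W \<and> p \<in> W \<and>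
    open U \<and> regular_1form U F \<and> induced_connection U (one_form_map F) \<Gamma> \<and>
    special_symplectic_iso (open_part M W) (open_set_data U \<Gamma> (induced_form (one_form_map F))) f"
proof -
  have M: "complex_manifold M" and conn: "is_connection M" and form: "is_symplectic_form M"
    using special by (simp_all add: special_symplectic_manifold_def special_complex_manifold_def)
  obtain i where i: "i \<in> charts M" and pi: "p \<in> cdom M i"
    using M p unfolding complex_manifold_def by blast
  let ?\<kappa> = "coord M i"
  have loc: "local_connection (cimage M i) (conn M i)" "local_flat (cimage M i) (conn M i)"
    "local_torsionfree (cimage M i) (conn M i)" "local_special (cimage M i) (conn M i)"
    "local_symplectic (cimage M i) (form M i)" "local_parallel (cimage M i) (conn M i) (form M i)"
    using special i by (auto simp: special_symplectic_manifold_def special_complex_manifold_def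
        is_connection_def is_symplectic_form_def)
  obtain B V Z g F \<Gamma>' where B: "open B" "B \<subseteq> cimage M i" "?\<kappa> p \<in> B" and V: "open V"
    and hom: "homeomorphism B V Z g" and hZ: "holo_on B Z" and hg: "holo_on V g"
    and reg: "regular_1form V F" and \<Gamma>': "induced_connection V (one_form_map F) \<Gamma>'"
    and law: "christoffel_law B Z (conn M i) \<Gamma>'"
    and fr: "form_related B Z (form M i) (induced_form (one_form_map F))"
    using local_special_symplectic_model[OF open_cimage[OF M conn i] loc imageI[OF pi]] by blast
  have ZB: "Z x \<in> V" "g (Z x) = x" if "x \<in> B" for x using hom that by (auto simp: homeomorphism_def)
  define W where "W = {q \<in> cdom M i. ?\<kappa> q \<in> B}"
  define f where "f q = Z (?\<kappa> q)" for q
  let ?M = "open_part M W" and ?N = "open_set_data V \<Gamma>' (induced_form (one_form_map F))"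
  have Wi: "W \<subseteq> cdom M i" by (auto simp: W_def)
  have \<kappa>W: "?\<kappa> ` W = B" using B(2) by (auto simp: W_def)
  have inj: "inj_on ?\<kappa> (cdom M i)" by (rule inj_on_coord[OF M conn i])
  have openW: "openin (mtop M) W"
  proof (rule openin_trans_full)
    have "openin (top_of_set (cimage M i)) B" using B by (simp add: open_subset)
    from openin_continuous_map_preimage[OF homeomorphic_imp_continuous_map[OF chart_homeomorphic[OF M conn i]] this]
    show "openin (subtopology (mtop M) (cdom M i)) W"
      by (simp only: topspace_chart[OF M conn i] W_def)
  qed (rule openin_cdom[OF M conn i])
  have topW: "topspace (mtop ?M) = W" using openin_subset[OF openW] by auto
  have homf: "homeomorphic_map (mtop ?M) (mtop ?N) f"
  proof -
    have "homeomorphic_map (subtopology (subtopology (mtop M) (cdom M i)) W) (subtopology (top_of_set (cimage M i)) B) ?\<kappa>"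
      by (rule homeomorphic_map_subtopologies[OF chart_homeomorphic[OF M conn i]])
         (use \<kappa>W B Wi topspace_chart[OF M conn i] in \<open>auto simp: Int_absorb1\<close>)
    then have 1: "homeomorphic_map (mtop ?M) (top_of_set B) ?\<kappa>"
      using Wi B by (simp add: subtopology_subtopology Int_absorb1 Int_absorb2)
    have "homeomorphic_maps (top_of_set B) (top_of_set V) Z g"
      using hom by (auto simp: homeomorphic_maps_def homeomorphism_def)
    then have "homeomorphic_map (top_of_set B) (mtop ?N) Z"
      using homeomorphic_maps_imp_map by auto
    from homeomorphic_map_compose[OF 1 this] show ?thesis by (simp add: f_def[abs_def] comp_def)
  qed
  have injf: "inj_on f W" and fW: "f ` W = V"
    using homeomorphic_imp_injective_map[OF homf] homeomorphic_imp_surjective_map[OF homf] by (simp_all only: topW) simp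
  let ?k = "inv_into W f"
  have kf: "?k (f q) = q" if "q \<in> W" for q by (rule inv_into_f_f[OF injf that])
  have kV: "?k y \<in> W" "f (?k y) = y" if "y \<in> V" for y
    using that fW by (metis inv_into_into f_inv_into_f)+
  \<comment> \<open>\<open>biholomorphic\<close> names the inverse by \<open>inv_into\<close>. It
    agrees on \<open>V\<close> with the continuous inverse that the homeomorphism provides.\<close>
  have contk: "continuous_map (mtop ?N) (mtop ?M) ?k"
  proof -
    obtain k' where k': "homeomorphic_maps (mtop ?M) (mtop ?N) f k'" using homf homeomorphic_map_maps by blast
    then have "continuous_map (mtop ?N) (mtop ?M) k'" by (simp add: homeomorphic_maps_def)
    moreover have "k' y = ?k y" if "y \<in> topspace (mtop ?N)" for y
      using k' that kf[of "k' y"] kV unfolding homeomorphic_maps_def topW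
      by (metis f_inv_into_f fW image_eqI topspace_euclidean_subtopology open_set_data_simps(1))
    ultimately show ?thesis by (rule continuous_map_eq)
  qed
  \<comment> \<open>In chart \<open>j\<close> the map is \<open>Z\<close> after the change from
    \<open>j\<close> to \<open>i\<close>; holomorphy, the Christoffel law and the relation of forms
    all pass to this composite.\<close>
  have forward: "holo_on (loc_dom ?M ?N f j ()) (loc_rep ?M ?N f j ()) \<and>
      conn_related (loc_dom ?M ?N f j ()) (loc_rep ?M ?N f j ()) (conn M j) \<Gamma>' \<and>
      form_related (loc_dom ?M ?N f j ()) (loc_rep ?M ?N f j ()) (form M j) (induced_form (one_form_map F))"
    if j: "j \<in> charts M" for j
  proof -
    let ?T = "loc_rep M M id j i"
    define D where "D = coord M j ` (cdom M j \<inter> W)"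
    have dom: "loc_dom ?M ?N f j () = D" using fW by (auto simp: loc_dom_def D_def)
    have oD: "open D" unfolding D_def by (rule open_chart_image[OF M conn j openW])
    have DT: "D \<subseteq> loc_dom M M id j i" using Wi by (auto simp: D_def change_dom[OF M conn])
    have T: "?T (coord M j q) = ?\<kappa> q" if "q \<in> cdom M j \<inter> W" for q
      using change_coord[OF M conn j] that by simp
    have TD: "?T ` D \<subseteq> B" using T \<kappa>W by (auto simp: D_def W_def)
    have rep: "loc_rep ?M ?N f j () x = Z (?T x)" if x: "x \<in> D" for x
    proof -
      obtain q where q: "q \<in> cdom M j \<inter> W" "x = coord M j q" using x by (auto simp: D_def)
      have "inv_into (cdom M j \<inter> W) (coord M j) x = q"
        unfolding q(2) by (rule inv_into_f_f[OF inj_on_subset[OF inj_on_coord[OF M conn j]] q(1)]) auto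
      then show ?thesis using T[OF q(1)] by (simp add: loc_rep_def f_def q(2))
    qed
    have hT: "holo_on D ?T" by (rule holo_on_subset[OF holo_change[OF M conn j i] DT])
    have sT: "smooth_on D ?T" by (rule holo_on_smooth[OF oD hT])
    have sZ: "smooth_on B Z" by (rule holo_on_smooth[OF B(1) hZ])
    have holo: "holo_on D (\<lambda>x. Z (?T x))" by (rule holo_on_compose[OF hZ hT TD])
    then have h: "holo_on D (loc_rep ?M ?N f j ())" by (simp only: holo_on_cong[OF oD rep])
    have "christoffel_law D ?T (conn M j) (conn M i)"
      by (rule christoffel_law_subset[OF change_christoffel_law[OF M conn j i] DT])
    from christoffel_law_compose[OF oD sT B(1) TD sZ this law]
    have "christoffel_law D (loc_rep ?M ?N f j ()) (conn M j) \<Gamma>'"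
      by (simp only: christoffel_law_cong[OF oD rep])
    then have cr: "conn_related D (loc_rep ?M ?N f j ()) (conn M j) \<Gamma>'"
      by (rule christoffel_law_imp_conn_related[OF oD holo_on_smooth[OF oD h]])
    have "form_related D (loc_rep ?M ?N f j ()) (form M j) (induced_form (one_form_map F))"
      unfolding form_related_def
    proof (intro ballI allI)
      fix x u v assume x: "x \<in> D"
      have Tx: "?T x \<in> B" using TD x by blast
      have "FD (loc_rep ?M ?N f j ()) x w = FD Z (?T x) (FD ?T x w)" for w
      proof -
        have "FD (loc_rep ?M ?N f j ()) x w = FD (\<lambda>x. Z (?T x)) x w" by (simp only: FD_cong[OF oD x rep])
        also have "\<dots> = FD Z (?T x) (FD ?T x w)"
          by (rule FD_compose(1)[OF holo_on_differentiable[OF hZ Tx] holo_on_differentiable[OF hT x]])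
        finally show ?thesis .
      qed
      moreover have "form_related (loc_dom M M id j i) ?T (form M j) (form M i)"
        using form i j by (simp add: is_symplectic_form_def)
      then have "form M i (?T x) (FD ?T x u) (FD ?T x v) = form M j x u v"
        using DT x by (auto simp: form_related_def)
      ultimately show "induced_form (one_form_map F) (loc_rep ?M ?N f j () x)
          (FD (loc_rep ?M ?N f j ()) x u) (FD (loc_rep ?M ?N f j ()) x v) = form M j x u v"
        using fr Tx by (simp add: form_related_def rep[OF x])
    qed
    then show ?thesis using h cr by (simp only: dom)
  qed
  have backward: "holo_on (loc_dom ?N ?M ?k () j) (loc_rep ?N ?M ?k () j)" if j: "j \<in> charts M" for j
  proof -
    let ?T = "loc_rep M M id i j"
    define D where "D = {y \<in> V. ?k y \<in> cdom M j}"
    have dom: "loc_dom ?N ?M ?k () j = D" using kV by (auto simp: loc_dom_def D_def)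
    have \<kappa>k: "?\<kappa> (?k y) = g y" if "y \<in> V" for y
      using kV[OF that] ZB(2)[of "?\<kappa> (?k y)"] by (simp add: f_def W_def)
    \<comment> \<open>Membership in \<open>D\<close> is rewritten through \<open>g\<close>, so that
      continuity of \<open>g\<close> and openness of chart images show that \<open>D\<close> is
      open.\<close>
    have "D = {y \<in> V. g y \<in> ?\<kappa> ` (cdom M i \<inter> (cdom M j \<inter> W))}"
    proof (intro set_eqI iffI)
      fix y assume "y \<in> D"
      then have "y \<in> V" "?k y \<in> cdom M i \<inter> (cdom M j \<inter> W)" using kV Wi by (auto simp: D_def)
      then show "y \<in> {y \<in> V. g y \<in> ?\<kappa> ` (cdom M i \<inter> (cdom M j \<inter> W))}" using \<kappa>k by (metis (mono_tags, lifting) imageI mem_Collect_eq)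
    next
      fix y assume "y \<in> {y \<in> V. g y \<in> ?\<kappa> ` (cdom M i \<inter> (cdom M j \<inter> W))}"
      then obtain q where y: "y \<in> V" and q: "q \<in> cdom M j" "q \<in> W" "g y = ?\<kappa> q" by blast
      then have "?\<kappa> (?k y) = ?\<kappa> q" by (simp add: \<kappa>k)
      then have "?k y = q" using inj kV(1)[OF y] q(2) Wi by (auto dest: inj_onD)
      then show "y \<in> D" using y q by (simp add: D_def)
    qed
    moreover have "open {y \<in> V. g y \<in> ?\<kappa> ` (cdom M i \<inter> (cdom M j \<inter> W))}"
    proof -
      have "open (?\<kappa> ` (cdom M i \<inter> (cdom M j \<inter> W)))"
        by (intro open_chart_image[OF M conn i] openin_Int openW openin_cdom[OF M conn j])
      from continuous_open_preimage[OF _ V this, of g] show ?thesis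
        using hom by (simp add: homeomorphism_def vimage_def Int_def)
    qed
    ultimately have oD: "open D" by simp
    have DV: "D \<subseteq> V" by (auto simp: D_def)
    have gD: "g ` D \<subseteq> loc_dom M M id i j"
    proof
      fix x assume "x \<in> g ` D"
      then obtain y where "y \<in> V" "?k y \<in> cdom M j" "x = g y" by (auto simp: D_def)
      then show "x \<in> loc_dom M M id i j"
        using \<kappa>k kV(1) Wi by (auto simp: change_dom[OF M conn] intro!: image_eqI[where x = "?k y"])
    qed
    have rep: "loc_rep ?N ?M ?k () j y = ?T (g y)" if "y \<in> D" for y
    proof -
      have y: "y \<in> V" using that DV by blast
      have "?T (?\<kappa> (?k y)) = coord M j (?k y)" using change_coord[OF M conn i] kV(1)[OF y] Wi by blast
      then show ?thesis by (simp add: loc_rep_def inv_into_ident[OF y] \<kappa>k[OF y])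
    qed
    have "holo_on D (\<lambda>y. ?T (g y))"
      by (rule holo_on_compose[OF holo_change[OF M conn i j] holo_on_subset[OF hg DV] gD])
    then show ?thesis unfolding dom by (simp only: holo_on_cong[OF oD rep])
  qed
  have "biholomorphic ?M ?N f"
    unfolding biholomorphic_def holomorphic_map_def topW
    using injf fW homeomorphic_imp_continuous_map[OF homf] contk forward backward
    by (auto simp: bij_betw_def)
  then have "special_symplectic_iso ?M ?N f"
    unfolding special_symplectic_iso_def using forward by simp
  moreover have "p \<in> W" using pi B by (simp add: W_def)
  ultimately show ?thesis using openW V reg \<Gamma>' by blast
qed

theorem corollary3:
  shows "(\<forall>(U :: (complex^'n::finite) set) F. open U \<and> regular_1form U F \<longrightarrow>
            holomorphic_immersion U (one_form_map F) \<and>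
            totally_complex U (one_form_map F) \<and>
            (\<exists>\<Gamma>. induced_connection U (one_form_map F) \<Gamma>) \<and>
            (\<forall>\<Gamma> \<Gamma>'. induced_connection U (one_form_map F) \<Gamma> \<and> induced_connection U (one_form_map F) \<Gamma>'
               \<longrightarrow> (\<forall>p\<in>U. \<Gamma> p = \<Gamma>' p)) \<and>
            (\<forall>\<Gamma>. induced_connection U (one_form_map F) \<Gamma> \<longrightarrow>
               special_symplectic_manifold (open_set_data U \<Gamma> (induced_form (one_form_map F)))))
       \<and>
         (\<forall>(M :: ('a, 'i, 'n) special_data) p.
            special_symplectic_manifold M \<and> p \<in> topspace (mtop M) \<longrightarrow>
            (\<exists>W U F \<Gamma> f. openin (mtop M) W \<and> p \<in> W \<and>
               open U \<and> regular_1form U F \<and> induced_connection U (one_form_map F) \<Gamma> \<and>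
               special_symplectic_iso (open_part M W)
                 (open_set_data U \<Gamma> (induced_form (one_form_map F))) f))"
proof (intro conjI allI impI; elim conjE)
  fix U :: "(complex^'n) set" and F
  assume U: "open U" "regular_1form U F"
  show "holomorphic_immersion U (one_form_map F)" by (rule holomorphic_immersion_one_form_map[OF U])
  show "totally_complex U (one_form_map F)" by (rule totally_complex_one_form_map[OF U])
  show "\<exists>\<Gamma>. induced_connection U (one_form_map F) \<Gamma>" by (rule induced_connection_exists[OF U])
  show "\<forall>p\<in>U. \<Gamma> p = \<Gamma>' p"
    if "induced_connection U (one_form_map F) \<Gamma>" "induced_connection U (one_form_map F) \<Gamma>'" for \<Gamma> \<Gamma>'
    using induced_connection_unique[OF U that] by blast
  show "special_symplectic_manifold (open_set_data U \<Gamma> (induced_form (one_form_map F)))"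
    if "induced_connection U (one_form_map F) \<Gamma>" for \<Gamma>
    by (rule induced_special_symplectic[OF U that])
qed (rule special_symplectic_locally_one_form)

end
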